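(* Let $J,J'\subset\mathbb{K}[\mathbf{x}]$ be two Borel adjacent strongly stable ideals in $\mathsf{S}^n_{p(t)}$, with degree-$r$ monomial sets $\mathfrak{J},\mathfrak{J}'$. Let $\mathbf{x}^{a}$ and $\mathbf{x}^{a'}$ be the Borel maxima of $\mathfrak{J}\setminus\mathfrak{J}'$ and $\mathfrak{J}'\setminus\mathfrak{J}$, and let $\mathcal{E}_{J,J'}$ be the associated set of compositions of decreasing moves. Let $I_{J,J'}\subset\mathbb{K}[y_0,y_1][\mathbf{x}]$ be the bihomogeneous ideal generated by $$(\mathfrak{J}\cap\mathfrak{J}')\cup\{\,y_0\,\mathsf{E}(\mathbf{x}^{a})+y_1\,\mathsf{E}(\mathbf{x}^{a'})\;:\;\mathsf{E}\in\mathcal{E}_{J,J'}\,\},$$ and let $X_{J,J'}\subset\mathbb{P}^1\times_{\mathbb{K}}\mathbb{P}^n$ be the closed subscheme defined by $I_{J,J'}$, where $\mathbb{P}^1=\operatorname{Proj}\mathbb{K}[y_0,y_1]$. Let $\pi:X_{J,J'}\to\mathbb{P}^1$ be the restriction of the projection $\mathbb{P}^1\times_{\mathbb{K}}\mathbb{P}^n\to\mathbb{P}^1$. Then $\pi$ is a flat family. Moreover, the fiber of $\pi$ over $[1:0]$ is $\operatorname{Proj}(\mathbb{K}[\mathbf{x}]/J)$ and the fiber over $[0:1]$ is $\operatorname{Proj}(\mathbb{K}[\mathbf{x}]/J')$.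
   Context: $\mathbb{K}$ is an algebraically closed field of characteristic $0$, $\mathbb{K}[\mathbf{x}]=\mathbb{K}[x_0,\dots,x_n]$ with the standard grading and variables ordered $x_0<\dots<x_n$. $\mathbb{P}^n=\operatorname{Proj}\mathbb{K}[\mathbf{x}]$. Monomials are written $\mathbf{x}^{a}$, $a\in\mathbb{Z}_{\ge0}^{n+1}$; generalized monomials are $\mathbf{x}^a$ with $a\in\mathbb{Z}^{n+1}$, in the fraction field. The Hilbert polynomial of an ideal $I$ means that of $\mathbb{K}[\mathbf{x}]/I$. Elementary moves on generalized monomials: $\mathsf{e}^+_i(\mathbf{x}^a)=\frac{x_{i+1}}{x_i}\mathbf{x}^a$ for $i<n$ (increasing) and $\mathsf{e}^-_j(\mathbf{x}^a)=\frac{x_{j-1}}{x_j}\mathbf{x}^a$ for $j>0$ (decreasing). The Borel order $\ge_B$ on monomials of a given degree is the reflexive-transitive closure of the relations $\mathbf{x}^a>_B\mathbf{x}^b$ whenever $\mathbf{x}^a=\mathsf{e}^+_i(\mathbf{x}^b)$ for some $i$. A monomial ideal $J$ is strongly stable if $\mathbf{x}^a\ge_B\mathbf{x}^b$ and $\mathbf{x}^b\in J$ imply $\mathbf{x}^a\in J$. Let $p(t)$ be the Hilbert polynomial of a closed subscheme of $\mathbb{P}^n$. Its Gotzmann number $r$ is the number of summands in its unique expression $p(t)=\sum_{i=1}^r\binom{t+a_i-i+1}{a_i}$ with $a_1\ge\dots\ge a_r\ge0$. $\mathsf{S}^n_{p(t)}$ is the set of ideals $J=J^{\mathrm{sat}}_{\ge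 r}$ (truncations in degree $r$) where $J^{\mathrm{sat}}\subset\mathbb{K}[\mathbf{x}]$ is a saturated strongly stable ideal with Hilbert polynomial $p(t)$. For $J\in\mathsf{S}^n_{p(t)}$, $\mathfrak{J}$ denotes the set of monomials of degree $r$ in $J$, so $J=(\mathfrak{J})$. $J,J'\in\mathsf{S}^n_{p(t)}$ are Borel adjacent if (1) $\mathfrak{J}\setminus\mathfrak{J}'$ has a maximum $\mathbf{x}^a$ with respect to $\ge_B$ and $\mathfrak{J}'\setminus\mathfrak{J}$ has a maximum $\mathbf{x}^{a'}$ with respect to $\ge_B$ (the Borel maxima); and (2) there is a set $\mathcal{E}_{J,J'}$ consisting of the identity map and compositions of decreasing elementary moves (as maps on generalized monomials) such that $\mathfrak{J}\setminus\mathfrak{J}'=\{\mathsf{E}(\mathbf{x}^a):\mathsf{E}\in\mathcal{E}_{J,J'}\}$ and $\mathfrak{J}'\setminus\mathfrak{J}=\{\mathsf{E}(\mathbf{x}^{a'}):\mathsf{E}\in\mathcal{E}_{J,J'}\}$. *)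

theory Defs
  imports
    "HOL-Analysis.Abstract_Topology"
    "HOL-Library.Poly_Mapping"
    "HOL-Computational_Algebra.Polynomial"
    "HOL-Computational_Algebra.Fraction_Field"
    "HOL-Algebra.Free_Abelian_Groups"
    "HOL-Algebra.Generated_Groups"
    "HOL-Algebra.QuotRing"
    "HOL-Algebra.Module"
begin

section \<open>Polynomial rings\<close>

type_synonym expo = "nat \<Rightarrow>\<^sub>0 nat"
type_synonym gexpo = "nat \<Rightarrow>\<^sub>0 int"
type_synonym 'c mpoly = "expo \<Rightarrow>\<^sub>0 'c"

abbreviation xpow :: "expo \<Rightarrow> 'c::comm_ring_1 mpoly"
  where "xpow a \<equiv> Poly_Mapping.single a 1"

definition expo_deg :: "expo \<Rightarrow> nat"
  where "expo_deg a = (\<Sum>i\<in>Poly_Mapping.keys a. Poly_Mapping.lookup a i)"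

definition monomials :: "nat \<Rightarrow> expo set"
  where "monomials n = {a. Poly_Mapping.keys a \<subseteq> {..n}}"

text \<open>The polynomial ring in the variables of index \<open>0, \<dots>, n\<close> over the subring \<open>A\<close> of the
  type of coefficients.\<close>

definition poly_ring :: "'c::comm_ring_1 set \<Rightarrow> nat \<Rightarrow> 'c mpoly ring"
  where "poly_ring A n =
    \<lparr>carrier = {f. \<forall>a\<in>Poly_Mapping.keys f. a \<in> monomials n \<and> Poly_Mapping.lookup f a \<in> A},
     mult = (*), one = 1, zero = 0, add = (+)\<rparr>"

abbreviation Kx :: "nat \<Rightarrow> 'k::comm_ring_1 mpoly ring"
  where "Kx n \<equiv> poly_ring UNIV n"

text \<open>\<open>K[y\<^sub>0, y\<^sub>1][x\<^sub>0, \<dots>, x\<^sub>n]\<close> is taken literally: polynomials in \<open>x\<close> with coefficients in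
  \<open>K[y\<^sub>0, y\<^sub>1] = Kx 1\<close>.\<close>

abbreviation Kyx :: "nat \<Rightarrow> 'k::comm_ring_1 mpoly mpoly ring"
  where "Kyx n \<equiv> poly_ring (carrier (Kx 1)) n"

definition homogeneous :: "nat \<Rightarrow> 'c::comm_ring_1 mpoly \<Rightarrow> bool"
  where "homogeneous d f \<longleftrightarrow> (\<forall>a\<in>Poly_Mapping.keys f. expo_deg a = d)"

text \<open>The first component of the bidegree is the degree in \<open>y\<close>, the second the degree in \<open>x\<close>.\<close>

definition bihomogeneous :: "nat \<times> nat \<Rightarrow> 'k::comm_ring_1 mpoly mpoly \<Rightarrow> bool"
  where "bihomogeneous de F \<longleftrightarrow>
    homogeneous (snd de) F \<and>
    (\<forall>a\<in>Poly_Mapping.keys F. homogeneous (fst de) (Poly_Mapping.lookup F a))"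


section \<open>Hilbert polynomials, saturation, strongly stable ideals\<close>

text \<open>\<open>dim\<^sub>K (K[x]/I)\<^sub>d\<close> for a homogeneous ideal \<open>I\<close>, as \<open>dim K[x]\<^sub>d - dim I\<^sub>d\<close>.\<close>

definition hilbert_function :: "nat \<Rightarrow> 'k::field mpoly set \<Rightarrow> nat \<Rightarrow> nat"
  where "hilbert_function n I d =
    (let K_dim = vector_space.dim (\<lambda>(c::'k) f. Poly_Mapping.single 0 c * f)
     in K_dim {f \<in> carrier (Kx n). homogeneous d f} - K_dim {f \<in> I. homogeneous d f})"

definition is_hilbert_polynomial :: "nat \<Rightarrow> 'k::field mpoly set \<Rightarrow> rat poly \<Rightarrow> bool"
  where "is_hilbert_polynomial n I p \<longleftrightarrow>
    (\<exists>d\<^sub>0. \<forall>d\<ge>d\<^sub>0. poly p (of_nat d) = of_nat (hilbert_function n I d))"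

text \<open>The list \<open>as = [a\<^sub>1, \<dots>, a\<^sub>r]\<close> is indexed from \<open>0\<close>, so the summand with index \<open>k\<close> is the one with
  \<open>i = k + 1\<close> in \<open>\<Sum>\<^sub>i binom(t + a\<^sub>i - i + 1, a\<^sub>i)\<close>.\<close>

definition is_gotzmann_number :: "rat poly \<Rightarrow> nat \<Rightarrow> bool"
  where "is_gotzmann_number p r \<longleftrightarrow>
    (\<exists>as::nat list. length as = r \<and> sorted_wrt (\<ge>) as \<and>
      (\<forall>t. poly p t = (\<Sum>k<r. (t + of_nat (as ! k) - of_nat k) gchoose (as ! k))))"

definition saturated :: "nat \<Rightarrow> 'k::field mpoly set \<Rightarrow> bool"
  where "saturated n I \<longleftrightarrow>
    (\<forall>f\<in>carrier (Kx n).
      (\<exists>k. \<forall>a\<in>monomials n. expo_deg a = k \<longrightarrow> xpow a * f \<in> I) \<longrightarrow> f \<in> I)"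

definition monomial_ideal :: "nat \<Rightarrow> 'k::field mpoly set \<Rightarrow> bool"
  where "monomial_ideal n J \<longleftrightarrow> (\<exists>A\<subseteq>monomials n. J = genideal (Kx n) (xpow ` A))"

text \<open>Generalized monomials are given by their exponents in \<open>\<int>\<^sup>n\<^sup>+\<^sup>1\<close>; \<open>gen\<close> views a monomial as a
  generalized one.\<close>

definition gen :: "expo \<Rightarrow> gexpo"
  where "gen = Poly_Mapping.map int"

definition e_inc :: "nat \<Rightarrow> gexpo \<Rightarrow> gexpo"
  where "e_inc i u = u + Poly_Mapping.single (i + 1) 1 - Poly_Mapping.single i 1"

definition e_dec :: "nat \<Rightarrow> gexpo \<Rightarrow> gexpo"
  where "e_dec j u = u + Poly_Mapping.single (j - 1) 1 - Poly_Mapping.single j 1"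

text \<open>In \<open>borel_step n b a\<close> the second monomial is the larger one.\<close>

definition borel_step :: "nat \<Rightarrow> expo \<Rightarrow> expo \<Rightarrow> bool"
  where "borel_step n b a \<longleftrightarrow>
    a \<in> monomials n \<and> b \<in> monomials n \<and> (\<exists>i<n. gen a = e_inc i (gen b))"

definition borel_ge :: "nat \<Rightarrow> expo \<Rightarrow> expo \<Rightarrow> bool"
  where "borel_ge n a b \<longleftrightarrow> (borel_step n)\<^sup>*\<^sup>* b a"

definition is_borel_max :: "nat \<Rightarrow> expo set \<Rightarrow> expo \<Rightarrow> bool"
  where "is_borel_max n A a \<longleftrightarrow> a \<in> A \<and> (\<forall>b\<in>A. borel_ge n a b)"

definition strongly_stable :: "nat \<Rightarrow> 'k::field mpoly set \<Rightarrow> bool"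
  where "strongly_stable n J \<longleftrightarrow>
    monomial_ideal n J \<and>
    (\<forall>a\<in>monomials n. \<forall>b\<in>monomials n. borel_ge n a b \<and> xpow b \<in> J \<longrightarrow> xpow a \<in> J)"

definition truncation :: "nat \<Rightarrow> 'k::field mpoly set \<Rightarrow> 'k mpoly set"
  where "truncation r I = {f \<in> I. \<forall>a\<in>Poly_Mapping.keys f. r \<le> expo_deg a}"

definition stable_truncations :: "nat \<Rightarrow> rat poly \<Rightarrow> nat \<Rightarrow> 'k::field mpoly set set"
  where "stable_truncations n p r =
    {truncation r Jsat | Jsat.
      strongly_stable n Jsat \<and> saturated n Jsat \<and> is_hilbert_polynomial n Jsat p}"

definition deg_monomials :: "nat \<Rightarrow> nat \<Rightarrow> 'k::field mpoly set \<Rightarrow> expo set"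
  where "deg_monomials n r J = {a \<in> monomials n. expo_deg a = r \<and> xpow a \<in> J}"


section \<open>Borel adjacency\<close>

inductive_set dec_compositions :: "nat \<Rightarrow> (gexpo \<Rightarrow> gexpo) set" for n where
  identity: "id \<in> dec_compositions n"
| compose: "E \<in> dec_compositions n \<Longrightarrow> 0 < j \<Longrightarrow> j \<le> n \<Longrightarrow> e_dec j \<circ> E \<in> dec_compositions n"

definition associated_moves ::
    "nat \<Rightarrow> nat \<Rightarrow> 'k::field mpoly set \<Rightarrow> 'k mpoly set \<Rightarrow> expo \<Rightarrow> expo \<Rightarrow> (gexpo \<Rightarrow> gexpo) set \<Rightarrow> bool"
  where "associated_moves n r J J' a a' \<E> \<longleftrightarrow>
    id \<in> \<E> \<and> \<E> \<subseteq> dec_compositions n \<and>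
    gen ` (deg_monomials n r J - deg_monomials n r J') = {E (gen a) | E. E \<in> \<E>} \<and>
    gen ` (deg_monomials n r J' - deg_monomials n r J) = {E (gen a') | E. E \<in> \<E>}"

definition borel_adjacent :: "nat \<Rightarrow> nat \<Rightarrow> 'k::field mpoly set \<Rightarrow> 'k mpoly set \<Rightarrow> bool"
  where "borel_adjacent n r J J' \<longleftrightarrow>
    (\<exists>a a' \<E>.
      is_borel_max n (deg_monomials n r J - deg_monomials n r J') a \<and>
      is_borel_max n (deg_monomials n r J' - deg_monomials n r J) a' \<and>
      associated_moves n r J J' a a' \<E>)"

definition deformation_ideal ::
    "nat \<Rightarrow> nat \<Rightarrow> 'k::field mpoly set \<Rightarrow> 'k mpoly set \<Rightarrow> expo \<Rightarrow> expo \<Rightarrow> (gexpo \<Rightarrow> gexpo) set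
      \<Rightarrow> 'k mpoly mpoly set"
  where "deformation_ideal n r J J' a a' \<E> =
    genideal (Kyx n)
      (xpow ` (deg_monomials n r J \<inter> deg_monomials n r J') \<union>
       {Poly_Mapping.single c (xpow (Poly_Mapping.single 0 1)) +
        Poly_Mapping.single c' (xpow (Poly_Mapping.single 1 1)) | c c' E.
          E \<in> \<E> \<and> gen c = E (gen a) \<and> gen c' = E (gen a')})"


section \<open>Flat modules\<close>

text \<open>\<open>M \<otimes>\<^sub>R N\<close> is the quotient of the free abelian group on \<open>M \<times> N\<close> by the subgroup of relations
  generated below.\<close>

definition tensor_relations ::
    "('a, 'x) ring_scheme \<Rightarrow> ('a, 'm, 'y) module_scheme \<Rightarrow> ('a, 'n, 'z) module_scheme
      \<Rightarrow> ('m \<times> 'n \<Rightarrow>\<^sub>0 int) set"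
  where "tensor_relations R M N =
    generate (free_Abelian_group (carrier M \<times> carrier N))
      ({frag_of (u \<oplus>\<^bsub>M\<^esub> u', v) - frag_of (u, v) - frag_of (u', v) | u u' v.
          u \<in> carrier M \<and> u' \<in> carrier M \<and> v \<in> carrier N} \<union>
       {frag_of (u, v \<oplus>\<^bsub>N\<^esub> v') - frag_of (u, v) - frag_of (u, v') | u v v'.
          u \<in> carrier M \<and> v \<in> carrier N \<and> v' \<in> carrier N} \<union>
       {frag_of (c \<odot>\<^bsub>M\<^esub> u, v) - frag_of (u, c \<odot>\<^bsub>N\<^esub> v) | c u v.
          c \<in> carrier R \<and> u \<in> carrier M \<and> v \<in> carrier N})"

definition linear_maps ::
    "('a, 'x) ring_scheme \<Rightarrow> ('a, 'm, 'y) module_scheme \<Rightarrow> ('a, 'n, 'z) module_scheme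
      \<Rightarrow> ('m \<Rightarrow> 'n) set"
  where "linear_maps R M N =
    {f \<in> hom (add_monoid M) (add_monoid N).
      \<forall>c\<in>carrier R. \<forall>u\<in>carrier M. f (c \<odot>\<^bsub>M\<^esub> u) = c \<odot>\<^bsub>N\<^esub> f u}"

text \<open>\<open>M\<close> is flat if \<open>id \<otimes> f : M \<otimes> N' \<rightarrow> M \<otimes> N\<close> is injective for every injective linear map
  \<open>f : N' \<rightarrow> N\<close>. Since HOL cannot quantify over types inside a formula, the element types of \<open>N'\<close> and
  \<open>N\<close> are parameters; a theorem that leaves them as type variables covers modules of every type.\<close>

definition flat_module ::
    "'u itself \<Rightarrow> 'v itself \<Rightarrow> ('a, 'x) ring_scheme \<Rightarrow> ('a, 'm, 'y) module_scheme \<Rightarrow> bool"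
  where "flat_module TU TV R M \<longleftrightarrow>
    module R M \<and>
    (\<forall>(N' :: ('a, 'u) module) (N :: ('a, 'v) module) f.
      module R N' \<and> module R N \<and> f \<in> linear_maps R N' N \<and> inj_on f (carrier N') \<longrightarrow>
      (\<forall>t \<in> carrier (free_Abelian_group (carrier M \<times> carrier N')).
        frag_extend (\<lambda>(u, v). frag_of (u, f v)) t \<in> tensor_relations R M N \<longrightarrow>
        t \<in> tensor_relations R M N'))"

definition restrict_scalars :: "('a \<Rightarrow> 'b) \<Rightarrow> ('b, 'y) ring_scheme \<Rightarrow> ('a, 'b) module"
  where "restrict_scalars \<phi> B =
    \<lparr>carrier = carrier B, mult = mult B, one = one B, zero = zero B, add = add B,
     smult = (\<lambda>c b. \<phi> c \<otimes>\<^bsub>B\<^esub> b)\<rparr>"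


section \<open>Products of projective spaces and their closed subschemes\<close>

text \<open>\<open>P\<^sup>n\<close> and \<open>P\<^sup>1 \<times> P\<^sup>n\<close> are handled alike: a (bi)graded coordinate ring, its graded pieces, and the
  sets of variables which generate the irrelevant ideals. Points are the homogeneous primes that
  contain no irrelevant ideal; as these schemes are integral, their local rings are subrings of
  the fraction field of the coordinate ring.\<close>

record ('a, 'd) proj_space =
  coord_ring :: "'a ring"
  piece :: "'d \<Rightarrow> 'a set"
  irrelevant :: "'a set set"

definition proj_n :: "nat \<Rightarrow> ('k::field mpoly, nat) proj_space"
  where "proj_n n =
    \<lparr>coord_ring = Kx n,
     piece = (\<lambda>d. {f \<in> carrier (Kx n). homogeneous d f}),
     irrelevant = {{xpow (Poly_Mapping.single i 1) | i. i \<le> n}}\<rparr>"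

definition embed_y :: "'k::field mpoly \<Rightarrow> 'k mpoly mpoly"
  where "embed_y = Poly_Mapping.single 0"

definition embed_x :: "'k::field mpoly \<Rightarrow> 'k mpoly mpoly"
  where "embed_x = Poly_Mapping.map (Poly_Mapping.single 0)"

definition proj_1_n :: "nat \<Rightarrow> ('k::field mpoly mpoly, nat \<times> nat) proj_space"
  where "proj_1_n n =
    \<lparr>coord_ring = Kyx n,
     piece = (\<lambda>de. {F \<in> carrier (Kyx n). bihomogeneous de F}),
     irrelevant =
       {{embed_y (xpow (Poly_Mapping.single i 1)) | i. i \<le> 1},
        {embed_x (xpow (Poly_Mapping.single i 1)) | i. i \<le> n}}\<rparr>"

definition homogeneous_ideal :: "('a, 'd) proj_space \<Rightarrow> 'a set \<Rightarrow> bool"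
  where "homogeneous_ideal S I \<longleftrightarrow>
    ideal I (coord_ring S) \<and> I = genideal (coord_ring S) {f \<in> I. \<exists>d. f \<in> piece S d}"

definition points :: "('a, 'd) proj_space \<Rightarrow> 'a set set"
  where "points S =
    {P. primeideal P (coord_ring S) \<and> homogeneous_ideal S P \<and> (\<forall>V\<in>irrelevant S. \<not> V \<subseteq> P)}"

definition zariski :: "('a, 'd) proj_space \<Rightarrow> 'a set topology"
  where "zariski S = topology_generated_by {{P \<in> points S. f \<notin> P} | f. \<exists>d. f \<in> piece S d}"

definition local_ring :: "('a::idom, 'd) proj_space \<Rightarrow> 'a set \<Rightarrow> 'a fract ring"
  where "local_ring S P =
    \<lparr>carrier = {Fract f g | f g d. f \<in> piece S d \<and> g \<in> piece S d \<and> g \<notin> P},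
     mult = (*), one = 1, zero = 0, add = (+)\<rparr>"

text \<open>A closed subscheme is given by its set of points and the stalks of its ideal sheaf.\<close>

record (overloaded) 'a subscheme =
  support :: "'a set set"
  ideal_stalk :: "'a set \<Rightarrow> 'a fract set"

text \<open>The closed subscheme defined by a (bi)homogeneous ideal; in \<open>proj_n n\<close> it is
  \<open>Proj (K[x]/I)\<close>.\<close>

definition zero_scheme :: "('a::idom, 'd) proj_space \<Rightarrow> 'a set \<Rightarrow> 'a subscheme"
  where "zero_scheme S I =
    \<lparr>support = {P \<in> points S. I \<subseteq> P},
     ideal_stalk = (\<lambda>P. {Fract f g | f g d. f \<in> I \<and> f \<in> piece S d \<and> g \<in> piece S d \<and> g \<notin> P})\<rparr>"

definition structure_stalk ::
    "('a::idom, 'd) proj_space \<Rightarrow> 'a subscheme \<Rightarrow> 'a set \<Rightarrow> 'a fract set ring"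
  where "structure_stalk S Z P = local_ring S P Quot ideal_stalk Z P"

text \<open>An injective ring homomorphism \<open>h\<close> between coordinate rings (here \<open>embed_y\<close>, \<open>embed_x\<close>) induces
  a map on points and a map \<open>f/g \<mapsto> h(f)/h(g)\<close> on local rings.\<close>

definition contract :: "('a, 'd) proj_space \<Rightarrow> ('a \<Rightarrow> 'b) \<Rightarrow> 'b set \<Rightarrow> 'a set"
  where "contract S h P = {f \<in> carrier (coord_ring S). h f \<in> P}"

definition fract_map :: "('a::idom \<Rightarrow> 'b::idom) \<Rightarrow> 'a fract \<Rightarrow> 'b fract"
  where "fract_map h q = (THE u. \<exists>f g. g \<noteq> 0 \<and> q = Fract f g \<and> u = Fract (h f) (h g))"

abbreviation pr1 :: "'k::field mpoly mpoly set \<Rightarrow> 'k mpoly set"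
  where "pr1 \<equiv> contract (proj_n 1) embed_y"

abbreviation pr2 :: "nat \<Rightarrow> 'k::field mpoly mpoly set \<Rightarrow> 'k mpoly set"
  where "pr2 n \<equiv> contract (proj_n n) embed_x"

text \<open>Flatness of \<open>\<pi> : X \<rightarrow> P\<^sup>1\<close>: at every point \<open>P\<close> of \<open>X\<close> the local ring of \<open>X\<close> is flat over that of
  \<open>P\<^sup>1\<close> at \<open>\<pi>(P)\<close>.\<close>

definition flat_over_P1 ::
    "'u itself \<Rightarrow> 'v itself \<Rightarrow> nat \<Rightarrow> 'k::field mpoly mpoly subscheme \<Rightarrow> bool"
  where "flat_over_P1 TU TV n X \<longleftrightarrow>
    (\<forall>P\<in>support X.
      flat_module TU TV (local_ring (proj_n 1) (pr1 P))
        (restrict_scalars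
          (\<lambda>q. ideal_stalk X P +>\<^bsub>local_ring (proj_1_n n) P\<^esub> fract_map embed_y q)
          (structure_stalk (proj_1_n n) X P)))"

text \<open>The scheme-theoretic fibre over \<open>p\<close> lives on \<open>\<pi>\<^sup>-\<^sup>1(p)\<close> and has the stalks
  \<open>O\<^bsub>X,P\<^esub> \<otimes> \<kappa>(p) = O\<^bsub>X,P\<^esub> / m\<^sub>p O\<^bsub>X,P\<^esub>\<close>; the maximal ideal \<open>m\<^sub>p\<close> is the ideal stalk at \<open>p\<close> of the closed
  subscheme defined by the prime \<open>p\<close> itself.\<close>

definition fibre :: "nat \<Rightarrow> 'k::field mpoly mpoly subscheme \<Rightarrow> 'k mpoly set \<Rightarrow> 'k mpoly mpoly subscheme"
  where "fibre n X p =
    \<lparr>support = {P \<in> support X. pr1 P = p},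
     ideal_stalk = (\<lambda>P. genideal (local_ring (proj_1_n n) P)
       (ideal_stalk X P \<union> fract_map embed_y ` ideal_stalk (zero_scheme (proj_n 1) p) p))\<rparr>"

text \<open>The point \<open>[c\<^sub>0 : c\<^sub>1]\<close> of \<open>P\<^sup>1\<close>, as the homogeneous prime ideal \<open>(c\<^sub>1 y\<^sub>0 - c\<^sub>0 y\<^sub>1)\<close>.\<close>

definition point_P1 :: "'k::field \<Rightarrow> 'k \<Rightarrow> 'k mpoly set"
  where "point_P1 c\<^sub>0 c\<^sub>1 =
    genideal (Kx 1)
      {Poly_Mapping.single (Poly_Mapping.single 0 1) c\<^sub>1 -
       Poly_Mapping.single (Poly_Mapping.single 1 1) c\<^sub>0}"

text \<open>The second projection restricts to an isomorphism of schemes from \<open>Z \<subseteq> P\<^sup>1 \<times> P\<^sup>n\<close> onto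
  \<open>W \<subseteq> P\<^sup>n\<close>: a homeomorphism that induces isomorphisms on all stalks. For \<open>Z\<close> in a fibre
  \<open>{p} \<times> P\<^sup>n\<close> over a rational point, this says that \<open>Z\<close> equals \<open>W\<close> as a subscheme of \<open>P\<^sup>n\<close>.\<close>

definition pr2_isomorphism ::
    "nat \<Rightarrow> 'k::field mpoly mpoly subscheme \<Rightarrow> 'k mpoly subscheme \<Rightarrow> bool"
  where "pr2_isomorphism n Z W \<longleftrightarrow>
    homeomorphic_map (subtopology (zariski (proj_1_n n)) (support Z))
      (subtopology (zariski (proj_n n)) (support W)) (pr2 n) \<and>
    (\<forall>P\<in>support Z.
      \<exists>h \<in> ring_iso (structure_stalk (proj_n n) W (pr2 n P)) (structure_stalk (proj_1_n n) Z P).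
        \<forall>q \<in> carrier (local_ring (proj_n n) (pr2 n P)).
          h (ideal_stalk W (pr2 n P) +>\<^bsub>local_ring (proj_n n) (pr2 n P)\<^esub> q) =
          ideal_stalk Z P +>\<^bsub>local_ring (proj_1_n n) P\<^esub> fract_map embed_x q)"

end

theory Submission
  imports Defs "HOL-Library.Product_Plus"
begin

text \<open>Why the family is flat. Over the chart \<open>y\<^sub>0 \<noteq> 0\<close> the generator
  \<open>y\<^sub>0 E(x\<^sup>a) + y\<^sub>1 E(x\<^sup>a')\<close> says that \<open>E(x\<^sup>a)\<close> may be rewritten to
  \<open>- (y\<^sub>1 / y\<^sub>0) E(x\<^sup>a')\<close>. Every rewriting step translates the exponent by the fixed vector
  \<open>a' - a\<close>, so the result of a step is determined by the monomial and rewriting terminates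
  (\<open>rewrite_induct\<close>). The normal forms are combinations of the monomials outside \<open>J\<close>, which therefore
  span the coordinate ring over the base (\<open>normal_form\<close>). They are also independent, provided that
  rewriting is compatible with the monomials of degree \<open>r\<close> that \<open>J\<close> and \<open>J'\<close> share: for every
  monomial \<open>b\<close>, \<open>b E(x\<^sup>a)\<close> must be a multiple of such a monomial if and only if
  \<open>b E(x\<^sup>a')\<close> is one (\<open>multiples_transfer\<close>). Then the coordinate with respect to a monomial
  outside \<open>J\<close> is a linear form that vanishes on the whole ideal (\<open>coord_form_ideal\<close>), the quotient has
  coordinates in finitely generated free modules, and this is enough for flatness (\<open>flat_criterion\<close>,
  \<open>flat_at\<close>). Exchanging \<open>J\<close> and \<open>J'\<close> gives the chart \<open>y\<^sub>1 \<noteq> 0\<close>.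

  Compatibility rests on one fact: \<open>E(x\<^sup>a)\<close> and \<open>E(x\<^sup>a')\<close> have the same least variable. Given
  this, each exchange in the Eliahou--Kervaire decomposition of \<open>b E(x\<^sup>a)\<close>, which trades the least variable
  of the right factor for a larger one of \<open>b\<close>, can be performed on \<open>b E(x\<^sup>a')\<close> as well.
  The least variables agree because, for every \<open>k\<close>, \<open>J\<close> and \<open>J'\<close> contain equally many monomials of
  degree \<open>r\<close> in \<open>x\<^sub>k, \<dots>, x\<^sub>n\<close>; hence the Borel maximum of one difference avoids the
  variables before \<open>x\<^sub>k\<close> exactly if the other one does (\<open>adjacent_borel_pair\<close>). That these numbers
  depend on the Hilbert polynomial alone, and that the truncations are generated in degree \<open>r\<close>, is
  Gotzmann's regularity theorem, which for strongly stable sets follows by an induction over the number of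
  variables (\<open>gotzmann_strongly_stable\<close>).

  The fibre over \<open>y\<^sub>1 = 0\<close> is computed by specialization, \<open>y\<^sub>0 = 1\<close> and \<open>y\<^sub>1 = 0\<close>.
  It turns the generators of the family into the monomials of degree \<open>r\<close> in \<open>J\<close>, and changes a form
  of the chart only by a multiple of \<open>y\<^sub>1\<close>. Hence points of the fibre are the points of \<open>P\<^sup>n\<close> that contain
  \<open>J\<close>, with the same topology (\<open>homeomorphic_fibre\<close>), and the stalks agree
  (\<open>fibre_stalk_iso\<close>).\<close>

section \<open>Exponents\<close>

definition evar :: "nat \<Rightarrow> expo"
  where "evar i = Poly_Mapping.single i 1"

lemma lookup_evar: "Poly_Mapping.lookup (evar i) j = (if i = j then 1 else 0)"
  by (simp add: evar_def lookup_single when_def)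

lemma keys_evar [simp]: "Poly_Mapping.keys (evar i) = {i}"
  by (simp add: evar_def)

definition monomials_from :: "nat \<Rightarrow> nat \<Rightarrow> expo set"
  where "monomials_from k n = {m. Poly_Mapping.keys m \<subseteq> {k..n}}"

lemma monomials_eq_from: "monomials n = monomials_from 0 n"
  by (auto simp: monomials_def monomials_from_def)

lemma keys_add_expo: "Poly_Mapping.keys (a + b) = Poly_Mapping.keys a \<union> Poly_Mapping.keys (b::expo)"
  by (auto simp: in_keys_iff lookup_add)

lemma expo_deg_eq_sum:
  assumes "finite S" "Poly_Mapping.keys m \<subseteq> S"
  shows "expo_deg m = (\<Sum>i\<in>S. Poly_Mapping.lookup m i)"
  unfolding expo_deg_def using assms by (intro sum.mono_neutral_left) (auto simp: in_keys_iff)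

lemma expo_deg_add [simp]: "expo_deg (a + b) = expo_deg a + expo_deg b"
proof -
  let ?S = "Poly_Mapping.keys a \<union> Poly_Mapping.keys b"
  have "expo_deg (a + b) = (\<Sum>i\<in>?S. Poly_Mapping.lookup a i + Poly_Mapping.lookup b i)"
    by (subst expo_deg_eq_sum[of ?S]) (auto simp: keys_add_expo lookup_add)
  also have "\<dots> = expo_deg a + expo_deg b"
    by (simp add: sum.distrib expo_deg_eq_sum[of ?S a] expo_deg_eq_sum[of ?S b])
  finally show ?thesis .
qed

lemma expo_deg_zero [simp]: "expo_deg 0 = 0"
  by (simp add: expo_deg_def)

lemma expo_deg_single [simp]: "expo_deg (Poly_Mapping.single i c) = c"
  by (subst expo_deg_eq_sum[of "{i}"]) auto

lemma expo_deg_evar [simp]: "expo_deg (evar i) = 1"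
  by (simp add: evar_def)

lemma expo_deg_eq_0_iff: "expo_deg m = 0 \<longleftrightarrow> m = 0"
proof
  assume "expo_deg m = 0"
  then have "Poly_Mapping.lookup m i = 0" for i
    by (metis expo_deg_def finite_keys in_keys_iff sum_eq_0_iff)
  then show "m = 0" by (intro poly_mapping_eqI) simp
qed simp

lemma lookup_le_expo_deg: "Poly_Mapping.lookup m i \<le> expo_deg m"
proof (cases "i \<in> Poly_Mapping.keys m")
  case True
  then show ?thesis unfolding expo_deg_def by (intro member_le_sum) auto
qed (simp add: in_keys_iff)

lemma expo_split_var:
  assumes "0 < Poly_Mapping.lookup m i"
  shows "\<exists>m'. m = m' + evar i"
proof
  show "m = (m - evar i) + evar i"
    by (rule poly_mapping_eqI) (use assms in \<open>auto simp: lookup_add lookup_minus lookup_evar\<close>)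
qed

lemma expo_split_var_deg:
  assumes "0 < expo_deg m"
  shows "\<exists>i m'. m = m' + evar i"
proof -
  have "Poly_Mapping.keys m \<noteq> {}" using assms by (auto simp: expo_deg_def)
  then obtain i where "i \<in> Poly_Mapping.keys m" by blast
  then have "0 < Poly_Mapping.lookup m i" by (simp add: in_keys_iff)
  then show ?thesis using expo_split_var by blast
qed

lemma monomials_from_add [simp]:
  "a + b \<in> monomials_from k n \<longleftrightarrow> a \<in> monomials_from k n \<and> b \<in> monomials_from k n"
  by (auto simp: monomials_from_def keys_add_expo)

lemma monomials_from_zero [simp]: "0 \<in> monomials_from k n"
  by (simp add: monomials_from_def)

lemma monomials_from_evar [simp]: "evar i \<in> monomials_from k n \<longleftrightarrow> k \<le> i \<and> i \<le> n"
  by (auto simp: monomials_from_def)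

lemma monomials_from_mono: "k \<le> j \<Longrightarrow> monomials_from j n \<subseteq> monomials_from k n"
  by (fastforce simp: monomials_from_def)

lemma monomials_from_Suc:
  "m \<in> monomials_from (Suc k) n \<longleftrightarrow> m \<in> monomials_from k n \<and> Poly_Mapping.lookup m k = 0"
proof
  assume m: "m \<in> monomials_from (Suc k) n"
  then have "k \<notin> Poly_Mapping.keys m" by (auto simp: monomials_from_def)
  then show "m \<in> monomials_from k n \<and> Poly_Mapping.lookup m k = 0"
    using m monomials_from_mono[of k "Suc k" n] by (auto simp: in_keys_iff)
next
  assume m: "m \<in> monomials_from k n \<and> Poly_Mapping.lookup m k = 0"
  have "i \<in> {Suc k..n}" if "i \<in> Poly_Mapping.keys m" for i
  proof -
    have "i \<noteq> k" using m that by (auto simp: in_keys_iff)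
    moreover have "i \<in> {k..n}" using m that by (auto simp: monomials_from_def)
    ultimately show ?thesis by auto
  qed
  then show "m \<in> monomials_from (Suc k) n" unfolding monomials_from_def by blast
qed

lemma finite_bounded_support: "finite V \<Longrightarrow> finite {m::expo. Poly_Mapping.keys m \<subseteq> V \<and> expo_deg m = s}"
proof -
  assume V: "finite V"
  let ?X = "{m::expo. Poly_Mapping.keys m \<subseteq> V \<and> expo_deg m = s}"
  have "Poly_Mapping.lookup ` ?X \<subseteq> {f. \<forall>i. (i \<in> V \<longrightarrow> f i \<in> {..s}) \<and> (i \<notin> V \<longrightarrow> f i = 0)}"
    using lookup_le_expo_deg by (auto simp: in_keys_iff)
  moreover have "finite {f. \<forall>i. (i \<in> V \<longrightarrow> f i \<in> {..s}) \<and> (i \<notin> V \<longrightarrow> f i = (0::nat))}"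
    by (rule finite_set_of_finite_funs) (use V in auto)
  ultimately have "finite (Poly_Mapping.lookup ` ?X)" by (rule finite_subset)
  then show "finite ?X"
    by (rule finite_imageD) (auto simp: inj_on_def)
qed

lemma finite_monomials_deg [simp]: "finite {m \<in> monomials_from k n. expo_deg m = s}"
  using finite_bounded_support[of "{k..n}" s] by (simp add: monomials_from_def)

lemma finite_monomials_deg_conj [simp]: "finite {m \<in> monomials_from k n. expo_deg m = s \<and> P m}"
  by (rule finite_subset[OF _ finite_monomials_deg[of k n s]]) auto

text \<open>Dickson's lemma. Split off one variable \<open>v\<close>: the slices of \<open>A\<close> by the exponent of \<open>v\<close> have
  a finite basis together; only finitely many slices lie below the exponents that this basis needs,
  and each of these has a finite basis of its own.\<close>

lemma dickson:
  assumes "finite V" "A \<subseteq> {m::expo. Poly_Mapping.keys m \<subseteq> V}"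
  shows "\<exists>F\<subseteq>A. finite F \<and> (\<forall>m\<in>A. \<exists>g\<in>F. \<exists>c. m = g + c)"
  using assms
proof (induction V arbitrary: A rule: finite_induct)
  case empty
  then have "A \<subseteq> {0}" by auto
  then have "finite A" by (auto intro: finite_subset)
  moreover have "\<exists>g\<in>A. \<exists>c. m = g + c" if "m \<in> A" for m
    using that by (intro bexI[of _ m] exI[of _ 0]) auto
  ultimately show ?case by (intro exI[of _ A]) auto
next
  case (insert v V)
  let ?M = "{m::expo. Poly_Mapping.keys m \<subseteq> V}"
  define sl where "sl j = {m\<in>?M. Poly_Mapping.single v j + m \<in> A}" for j
  have slice: "\<exists>j m'. m' \<in> sl j \<and> m = Poly_Mapping.single v j + m'" if "m \<in> A" for m
  proof -
    let ?j = "Poly_Mapping.lookup m v"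
    let ?m = "m - Poly_Mapping.single v ?j"
    have eq: "m = Poly_Mapping.single v ?j + ?m"
      by (rule poly_mapping_eqI) (auto simp: lookup_add lookup_minus lookup_single when_def)
    have "Poly_Mapping.keys ?m \<subseteq> V"
    proof
      fix i assume "i \<in> Poly_Mapping.keys ?m"
      then have "i \<noteq> v" "i \<in> Poly_Mapping.keys m"
        by (auto simp: in_keys_iff lookup_minus lookup_single when_def split: if_splits)
      then show "i \<in> V" using that insert.prems by auto
    qed
    then show ?thesis using eq that unfolding sl_def by (metis (mono_tags, lifting) mem_Collect_eq)
  qed
  have "\<exists>F\<subseteq>(\<Union>j. sl j). finite F \<and> (\<forall>m\<in>(\<Union>j. sl j). \<exists>g\<in>F. \<exists>c. m = g + c)"
    by (rule insert.IH) (auto simp: sl_def)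
  then obtain F where F: "F \<subseteq> (\<Union>j. sl j)" "finite F" "\<forall>m\<in>(\<Union>j. sl j). \<exists>g\<in>F. \<exists>c. m = g + c"
    by (elim exE conjE) (rule that)
  have "\<forall>f\<in>F. \<exists>j. f \<in> sl j" using F(1) by auto
  then obtain jf where jf: "\<And>f. f \<in> F \<Longrightarrow> f \<in> sl (jf f)" by metis
  define N where "N = (\<Sum>f\<in>F. jf f)"
  have jfN: "jf f \<le> N" if "f \<in> F" for f
    unfolding N_def using F(2) that by (intro member_le_sum) auto
  have "\<exists>G\<subseteq>sl j. finite G \<and> (\<forall>m\<in>sl j. \<exists>g\<in>G. \<exists>c. m = g + c)" for j
    by (rule insert.IH) (auto simp: sl_def)
  then have "\<forall>j. \<exists>G. G \<subseteq> sl j \<and> finite G \<and> (\<forall>m\<in>sl j. \<exists>g\<in>G. \<exists>c. m = g + c)"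
    by blast
  then obtain G where G': "\<forall>j. G j \<subseteq> sl j \<and> finite (G j) \<and> (\<forall>m\<in>sl j. \<exists>g\<in>G j. \<exists>c. m = g + c)"
    by (rule choice[THEN exE])
  then have G: "\<And>j. G j \<subseteq> sl j" "\<And>j. finite (G j)"
      "\<And>j m. m \<in> sl j \<Longrightarrow> \<exists>g\<in>G j. \<exists>c. m = g + c"
    by auto
  let ?R = "(\<lambda>f. Poly_Mapping.single v (jf f) + f) ` F \<union>
            (\<Union>j<N. (\<lambda>g. Poly_Mapping.single v j + g) ` G j)"
  have "?R \<subseteq> A" using jf G(1) unfolding sl_def by fastforce
  moreover have "finite ?R" using F(2) G(2) by auto
  moreover have "\<exists>g\<in>?R. \<exists>c. m = g + c" if m: "m \<in> A" for m
  proof -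
    obtain j m' where jm: "m' \<in> sl j" "m = Poly_Mapping.single v j + m'" using slice[OF m] by blast
    show ?thesis
    proof (cases "j < N")
      case True
      obtain g c where "g \<in> G j" "m' = g + c" using G(3) jm(1) by blast
      then have "m = (Poly_Mapping.single v j + g) + c" using jm(2) by (simp add: add.assoc)
      then show ?thesis using True \<open>g \<in> G j\<close> by blast
    next
      case False
      obtain g c where g: "g \<in> F" "m' = g + c" using F(3) jm(1) by (meson UN_I UNIV_I)
      have "j = jf g + (j - jf g)" using jfN[OF g(1)] False by simp
      then have "Poly_Mapping.single v j = Poly_Mapping.single v (jf g) + Poly_Mapping.single v (j - jf g)"
        by (metis single_add)
      then have "m = (Poly_Mapping.single v (jf g) + g) + (Poly_Mapping.single v (j - jf g) + c)"
        using jm(2) g(2) by (simp add: ac_simps)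
      then show ?thesis using g(1) by blast
    qed
  qed
  ultimately show ?case by (intro exI[of _ ?R] conjI ballI)
qed

section \<open>Strongly stable sets and Gotzmann's regularity theorem\<close>

definition stable_from :: "nat \<Rightarrow> nat \<Rightarrow> expo set \<Rightarrow> bool"
  where "stable_from k n A \<longleftrightarrow>
    (\<forall>m\<in>monomials_from k n. \<forall>i. k \<le> i \<longrightarrow> i \<le> n \<longrightarrow> m \<in> A \<longrightarrow> m + evar i \<in> A) \<and>
    (\<forall>m\<in>monomials_from k n. \<forall>i j. k \<le> i \<longrightarrow> i < j \<longrightarrow> j \<le> n \<longrightarrow> m + evar i \<in> A \<longrightarrow> m + evar j \<in> A)"

definition saturated_from :: "nat \<Rightarrow> nat \<Rightarrow> expo set \<Rightarrow> bool"
  where "saturated_from k n A \<longleftrightarrow>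
    (\<forall>m\<in>monomials_from k n. (\<forall>i. k \<le> i \<longrightarrow> i \<le> n \<longrightarrow> m + evar i \<in> A) \<longrightarrow> m \<in> A)"

definition hf :: "nat \<Rightarrow> nat \<Rightarrow> expo set \<Rightarrow> nat \<Rightarrow> nat"
  where "hf k n A s = card {m \<in> monomials_from k n. expo_deg m = s \<and> m \<notin> A}"

lemma stable_add:
  assumes "stable_from k n A" "c \<in> monomials_from k n" "m \<in> A" "m \<in> monomials_from k n"
  shows "m + c \<in> A"
  using assms(2)
proof (induction "expo_deg c" arbitrary: c)
  case 0
  then show ?case using assms(3) by (simp add: expo_deg_eq_0_iff)
next
  case (Suc d)
  then obtain i c' where c: "c = c' + evar i" using expo_split_var_deg[of c] by force
  then have "m + c' \<in> A" using Suc by simp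
  then show ?case using assms(1,4) Suc.prems c unfolding stable_from_def
    by (metis add.assoc monomials_from_add monomials_from_evar)
qed

text \<open>If \<open>x\<^sub>k m\<close> lies in a strongly stable set, so does \<open>x\<^sub>i m\<close> for every later variable; hence
  saturation with respect to all variables amounts to saturation with respect to the first one.\<close>

lemma sat_first_var:
  assumes "stable_from k n A" "saturated_from k n A" "m \<in> monomials_from k n" "m + evar k \<in> A"
  shows "m \<in> A"
  using assms unfolding stable_from_def saturated_from_def by (metis le_neq_implies_less order_refl)

text \<open>If \<open>x\<^sub>k\<close> is a nonzerodivisor modulo \<open>A\<close>, the Hilbert function of \<open>A\<close> is the summation of the
  one of its restriction to the variables after \<open>x\<^sub>k\<close>.\<close>

lemma hf_Suc:
  assumes st: "stable_from k n A" and sat: "saturated_from k n A" and kn: "k \<le> n"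
  shows "hf k n A (Suc s) = hf k n A s + hf (Suc k) n A (Suc s)"
proof -
  let ?X = "{m \<in> monomials_from k n. expo_deg m = Suc s \<and> m \<notin> A}"
  let ?Y = "{m \<in> monomials_from k n. expo_deg m = s \<and> m \<notin> A}"
  let ?Z = "{m \<in> monomials_from (Suc k) n. expo_deg m = Suc s \<and> m \<notin> A}"
  have "?X = (\<lambda>m. m + evar k) ` ?Y \<union> ?Z"
  proof (intro equalityI subsetI)
    fix m assume m: "m \<in> ?X"
    show "m \<in> (\<lambda>m. m + evar k) ` ?Y \<union> ?Z"
    proof (cases "Poly_Mapping.lookup m k = 0")
      case True
      then show ?thesis using m by (simp add: monomials_from_Suc)
    next
      case False
      then obtain m' where m': "m = m' + evar k" using expo_split_var[of m k] by blast
      have "m' \<in> ?Y" using m m' st kn unfolding stable_from_def by auto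
      then show ?thesis using m' by blast
    qed
  next
    fix m assume "m \<in> (\<lambda>m. m + evar k) ` ?Y \<union> ?Z"
    then show "m \<in> ?X"
      using kn sat_first_var[OF st sat] by (auto simp: monomials_from_Suc)
  qed
  moreover have "(\<lambda>m. m + evar k) ` ?Y \<inter> ?Z = {}"
    by (auto simp: monomials_from_Suc lookup_add lookup_evar)
  moreover have "card ((\<lambda>m. m + evar k) ` ?Y) = card ?Y"
    by (rule card_image) (auto simp: inj_on_def)
  ultimately show ?thesis unfolding hf_def by (simp add: card_Un_disjoint)
qed

lemma hf_0: "hf k n A 0 = hf j n A 0"
proof -
  have "{m \<in> monomials_from k n. expo_deg m = 0 \<and> m \<notin> A} = {0} - A" for k
    by (auto simp: expo_deg_eq_0_iff)
  then show ?thesis unfolding hf_def by simp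
qed

text \<open>The saturation of the restriction of \<open>A\<close> to the variables from \<open>k\<close> on. When no variables are left,
  there are no monomials of positive degree and the saturation is the unit ideal, as it should be for the
  induction over the variables.\<close>

definition saturation_from :: "nat \<Rightarrow> nat \<Rightarrow> expo set \<Rightarrow> expo set"
  where "saturation_from k n A =
    {m\<in>monomials_from k n. \<exists>T. \<forall>c\<in>monomials_from k n. expo_deg c = T \<longrightarrow> m + c \<in> A}"

lemma expo_split_deg:
  assumes "T \<le> expo_deg c"
  obtains c1 c2 where "c = c1 + c2" "expo_deg c1 = T"
proof -
  have "\<exists>c1 c2. c = c1 + c2 \<and> expo_deg c1 = T"
    using assms
  proof (induction "expo_deg c - T" arbitrary: c)
    case 0
    then show ?case by (intro exI[of _ c] exI[of _ 0]) auto
  next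
    case (Suc d)
    then obtain i c' where c: "c = c' + evar i" using expo_split_var_deg[of c] by force
    then have "\<exists>c1 c2. c' = c1 + c2 \<and> expo_deg c1 = T" using Suc by auto
    then show ?case using c by (metis add.assoc)
  qed
  then show ?thesis using that by blast
qed

lemma saturation_uniform:
  assumes st: "stable_from k n A" and T: "\<forall>c\<in>monomials_from k n. expo_deg c = T \<longrightarrow> m + c \<in> A"
    and m: "m \<in> monomials_from k n" and c: "c \<in> monomials_from k n" "T \<le> expo_deg c"
  shows "m + c \<in> A"
proof -
  obtain c1 c2 where cc: "c = c1 + c2" "expo_deg c1 = T" using expo_split_deg[OF c(2)] .
  then have "m + c1 \<in> A" using T c by simp
  then show ?thesis using stable_add[OF st, of c2 "m + c1"] cc c m by (simp add: add.assoc)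
qed

lemma stable_saturation:
  assumes st: "stable_from k n A"
  shows "stable_from k n (saturation_from k n A)"
  unfolding stable_from_def
proof (intro conjI ballI allI impI)
  fix m i assume *: "m \<in> monomials_from k n" "k \<le> i" "i \<le> n" "m \<in> saturation_from k n A"
  then obtain T where "\<forall>c\<in>monomials_from k n. expo_deg c = T \<longrightarrow> m + c \<in> A"
    unfolding saturation_from_def by blast
  then have "\<forall>c\<in>monomials_from k n. expo_deg c = T \<longrightarrow> (m + evar i) + c \<in> A"
    using saturation_uniform[OF st, of T m] * by (simp add: add.assoc)
  then show "m + evar i \<in> saturation_from k n A" using * unfolding saturation_from_def by auto
next
  fix m i j assume *: "m \<in> monomials_from k n" "k \<le> i" "i < j" "j \<le> n" "m + evar i \<in> saturation_from k n A"
  then obtain T where T: "\<forall>c\<in>monomials_from k n. expo_deg c = T \<longrightarrow> (m + evar i) + c \<in> A"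
    unfolding saturation_from_def by blast
  have "m + evar j + c \<in> A" if "c \<in> monomials_from k n" "expo_deg c = T" for c
  proof -
    have "(m + c) + evar i \<in> A" using T that by (simp add: ac_simps)
    then have "(m + c) + evar j \<in> A"
      using st * that unfolding stable_from_def by (metis monomials_from_add)
    then show ?thesis by (simp add: ac_simps)
  qed
  then show "m + evar j \<in> saturation_from k n A" using * unfolding saturation_from_def by auto
qed

lemma saturated_saturation:
  assumes st: "stable_from k n A"
  shows "saturated_from k n (saturation_from k n A)"
  unfolding saturated_from_def
proof (intro ballI impI)
  fix m assume m: "m \<in> monomials_from k n" and *: "\<forall>i. k \<le> i \<longrightarrow> i \<le> n \<longrightarrow> m + evar i \<in> saturation_from k n A"
  have "\<forall>i\<in>{k..n}. \<exists>T. \<forall>c\<in>monomials_from k n. expo_deg c = T \<longrightarrow> (m + evar i) + c \<in> A"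
    using * unfolding saturation_from_def by auto
  then obtain T where T: "\<And>i. i \<in> {k..n} \<Longrightarrow> \<forall>c\<in>monomials_from k n. expo_deg c = T i \<longrightarrow> (m + evar i) + c \<in> A"
    by metis
  define N where "N = (\<Sum>i\<in>{k..n}. T i)"
  have "m + c \<in> A" if c: "c \<in> monomials_from k n" "expo_deg c = Suc N" for c
  proof -
    obtain i c' where c': "c = c' + evar i" using expo_split_var_deg[of c] c by force
    then have i: "i \<in> {k..n}" using c by simp
    then have "T i \<le> N" unfolding N_def by (intro member_le_sum) auto
    then have "(m + evar i) + c' \<in> A"
      using saturation_uniform[OF st T[OF i]] c c' m by simp
    then show ?thesis using c' by (simp add: ac_simps)
  qed
  then show "m \<in> saturation_from k n A" using m unfolding saturation_from_def by blast
qed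

lemma saturation_superset:
  assumes "m \<in> A" "m \<in> monomials_from k n"
  shows "m \<in> saturation_from k n A"
proof -
  have "\<forall>c\<in>monomials_from k n. expo_deg c = 0 \<longrightarrow> m + c \<in> A"
    using assms by (auto simp: expo_deg_eq_0_iff)
  then show ?thesis using assms(2) unfolding saturation_from_def by blast
qed

text \<open>The saturation is finitely generated by Dickson's lemma, so one exponent serves all its elements.\<close>

lemma saturation_eventually:
  assumes st: "stable_from k n A"
  obtains N where "\<And>m. m \<in> saturation_from k n A \<Longrightarrow> N \<le> expo_deg m \<Longrightarrow> m \<in> A"
proof -
  let ?C = "saturation_from k n A"
  have "?C \<subseteq> {m. Poly_Mapping.keys m \<subseteq> {k..n}}"
    by (auto simp: saturation_from_def monomials_from_def)
  then obtain F where F: "F \<subseteq> ?C" "finite F" "\<forall>m\<in>?C. \<exists>g\<in>F. \<exists>c. m = g + c"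
    using dickson[of "{k..n}" ?C] by auto
  have "\<forall>g\<in>F. \<exists>T. \<forall>c\<in>monomials_from k n. expo_deg c = T \<longrightarrow> g + c \<in> A"
    using F(1) unfolding saturation_from_def by auto
  then obtain T where T: "\<And>g. g \<in> F \<Longrightarrow> \<forall>c\<in>monomials_from k n. expo_deg c = T g \<longrightarrow> g + c \<in> A"
    by metis
  show ?thesis
  proof
    fix m assume m: "m \<in> ?C" "(\<Sum>g\<in>F. T g + expo_deg g) \<le> expo_deg m"
    obtain g c where g: "g \<in> F" "m = g + c" using F m(1) by blast
    have "T g + expo_deg g \<le> (\<Sum>g\<in>F. T g + expo_deg g)"
      using member_le_sum[of g F "\<lambda>g. T g + expo_deg g"] g F(2) by auto
    then have "T g \<le> expo_deg c" using m(2) g(2) by simp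
    moreover have "g \<in> monomials_from k n" "c \<in> monomials_from k n"
      using m(1) g unfolding saturation_from_def by auto
    ultimately show "m \<in> A" using saturation_uniform[OF st T[OF g(1)]] g(2) by simp
  qed
qed

text \<open>The Hilbert polynomial with the Gotzmann representation \<open>as\<close>.\<close>

definition gotz :: "nat list \<Rightarrow> rat \<Rightarrow> rat"
  where "gotz as t = (\<Sum>k<length as. (t + of_nat (as ! k) - of_nat k) gchoose (as ! k))"

text \<open>The Gotzmann representation of the first difference of \<^const>\<open>gotz\<close>: the summands of degree \<open>0\<close>
  disappear and every other one drops its degree by one.\<close>

definition dec_list :: "nat list \<Rightarrow> nat list"
  where "dec_list as = map (\<lambda>a. a - 1) (takeWhile (\<lambda>a. 0 < a) as)"

text \<open>The Hilbert function of the saturated lexicographic ideal with the Hilbert polynomial \<open>gotz as\<close>: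
  in degree \<open>s\<close> only the summands with \<open>k \<le> s\<close> contribute.\<close>

definition lex_hf :: "nat list \<Rightarrow> nat \<Rightarrow> nat"
  where "lex_hf as s = (\<Sum>k<min (length as) (Suc s). (s + as ! k - k) choose (as ! k))"

text \<open>The part of \<^const>\<open>lex_hf\<close> that comes from the nonzero entries of the list.\<close>

definition lex_hf_pos :: "nat list \<Rightarrow> nat \<Rightarrow> nat"
  where "lex_hf_pos as s = (\<Sum>k<min (length (dec_list as)) (Suc s). (s + as ! k - k) choose (as ! k))"

lemma gotz_summand:
  assumes "k \<le> s"
  shows "((of_nat s::rat) + of_nat a - of_nat k) gchoose a = of_nat ((s + a - k) choose a)"
proof -
  have "(of_nat s::rat) + of_nat a - of_nat k = of_nat (s + a - k)"
    using assms by (simp add: of_nat_diff)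
  then show ?thesis by (simp only: binomial_gbinomial)
qed

lemma length_dec_list_le: "length (dec_list as) \<le> length as"
  by (simp add: dec_list_def length_takeWhile_le)

lemma dec_list_pos:
  assumes "k < length (dec_list as)"
  shows "as ! k = Suc (dec_list as ! k)"
proof -
  let ?w = "takeWhile (\<lambda>a. 0 < a) as"
  have "k < length ?w" using assms by (simp add: dec_list_def)
  then have "?w ! k = as ! k" "?w ! k \<in> set ?w" "dec_list as ! k = ?w ! k - 1"
    by (simp add: takeWhile_nth, rule nth_mem, simp_all add: dec_list_def)
  then show ?thesis using set_takeWhileD[of "?w ! k" "\<lambda>a. 0 < a" as] by auto
qed

lemma dec_list_zero:
  assumes "sorted_wrt (\<ge>) as" "length (dec_list as) \<le> k" "k < length as"
  shows "as ! k = 0"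
proof -
  let ?r = "length (dec_list as)"
  have r: "?r = length (takeWhile (\<lambda>a. 0 < a) as)" by (simp add: dec_list_def)
  then have "\<not> 0 < as ! ?r" using assms(2,3) nth_length_takeWhile[of "\<lambda>a. 0 < a" as] by simp
  moreover have "as ! k \<le> as ! ?r"
    using assms sorted_wrt_nth_less[OF assms(1), of ?r k] by (cases "?r = k") auto
  ultimately show ?thesis by simp
qed

lemma sorted_dec_list:
  assumes "sorted_wrt (\<ge>) as"
  shows "sorted_wrt (\<ge>) (dec_list as)"
proof (subst sorted_wrt_iff_nth_less, intro allI impI)
  fix i j assume ij: "i < j" "j < length (dec_list as)"
  have "as ! j \<le> as ! i"
    using sorted_wrt_nth_less[OF assms ij(1)] ij(2) length_dec_list_le[of as] by simp
  then show "dec_list as ! j \<le> dec_list as ! i" using dec_list_pos[of i as] dec_list_pos[of j as] ij by simp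
qed

lemma gotz_split:
  assumes "sorted_wrt (\<ge>) as"
  shows "gotz as t = (\<Sum>k<length (dec_list as). (t + of_nat (as ! k) - of_nat k) gchoose (as ! k))
     + of_nat (length as - length (dec_list as))"
proof -
  let ?r = "length as" and ?r' = "length (dec_list as)"
  let ?g = "\<lambda>k. (t + of_nat (as ! k) - of_nat k) gchoose (as ! k)"
  have "{..<?r} = {..<?r'} \<union> {?r'..<?r}" using length_dec_list_le[of as] by auto
  then have "gotz as t = sum ?g ({..<?r'} \<union> {?r'..<?r})" by (simp only: gotz_def)
  also have "\<dots> = sum ?g {..<?r'} + sum ?g {?r'..<?r}" by (rule sum.union_disjoint) auto
  finally have "gotz as t = sum ?g {..<?r'} + sum ?g {?r'..<?r}" .
  moreover have "sum ?g {?r'..<?r} = (\<Sum>k\<in>{?r'..<?r}. 1)"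
    using dec_list_zero[OF assms] by (intro sum.cong) auto
  ultimately show ?thesis by simp
qed

lemma gotz_diff:
  assumes "sorted_wrt (\<ge>) as"
  shows "gotz as (t + 1) - gotz as t = gotz (dec_list as) (t + 1)"
proof -
  let ?r' = "length (dec_list as)"
  have "gotz as (t + 1) - gotz as t =
      (\<Sum>k<?r'. ((t + 1 + of_nat (as ! k) - of_nat k) gchoose (as ! k)) - ((t + of_nat (as ! k) - of_nat k) gchoose (as ! k)))"
    by (simp add: gotz_split[OF assms] sum_subtractf)
  also have "\<dots> = (\<Sum>k<?r'. (t + 1 + of_nat (dec_list as ! k) - of_nat k) gchoose (dec_list as ! k))"
  proof (intro sum.cong refl)
    fix k assume "k \<in> {..<?r'}"
    then have eq: "as ! k = Suc (dec_list as ! k)" using dec_list_pos by simp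
    let ?x = "t + of_nat (as ! k) - of_nat k"
    have "(?x + 1) gchoose (as ! k) = (?x gchoose (dec_list as ! k)) + (?x gchoose (as ! k))"
      unfolding eq by (rule gbinomial_Suc_Suc)
    moreover have "?x + 1 = t + 1 + of_nat (as ! k) - of_nat k" by simp
    moreover have "?x = t + 1 + of_nat (dec_list as ! k) - of_nat k" unfolding eq by simp
    ultimately show "((t + 1 + of_nat (as ! k) - of_nat k) gchoose (as ! k)) - ((t + of_nat (as ! k) - of_nat k) gchoose (as ! k))
      = (t + 1 + of_nat (dec_list as ! k) - of_nat k) gchoose (dec_list as ! k)"
      by (metis add_diff_cancel_right')
  qed
  finally show ?thesis unfolding gotz_def .
qed

lemma gotz_pos_split:
  assumes "sorted_wrt (\<ge>) as" "length (dec_list as) \<le> Suc s"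
  shows "gotz as (of_nat s) = of_nat (lex_hf_pos as s) + of_nat (length as - length (dec_list as))"
proof -
  have "(\<Sum>k<length (dec_list as). ((of_nat s::rat) + of_nat (as ! k) - of_nat k) gchoose (as ! k))
      = of_nat (lex_hf_pos as s)"
    unfolding lex_hf_pos_def of_nat_sum using assms(2)
    by (intro sum.cong) (auto simp: min_absorb1 intro!: gotz_summand)
  then show ?thesis using gotz_split[OF assms(1)] by simp
qed

lemma gotz_eq_lex_hf:
  assumes "length as \<le> Suc s"
  shows "gotz as (of_nat s) = of_nat (lex_hf as s)"
  unfolding lex_hf_def gotz_def of_nat_sum using assms
  by (intro sum.cong) (auto simp: min_absorb1 intro!: gotz_summand)

lemma lex_hf_split:
  assumes "sorted_wrt (\<ge>) as"
  shows "lex_hf as s = lex_hf_pos as s + (min (length as) (Suc s) - length (dec_list as))"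
proof -
  let ?m = "min (length as) (Suc s)" and ?m' = "min (length (dec_list as)) (Suc s)"
  let ?g = "\<lambda>k. (s + as ! k - k) choose (as ! k)"
  have "{..<?m} = {..<?m'} \<union> {?m'..<?m}" using length_dec_list_le[of as] by auto
  then have "lex_hf as s = sum ?g ({..<?m'} \<union> {?m'..<?m})" by (simp only: lex_hf_def)
  also have "\<dots> = sum ?g {..<?m'} + sum ?g {?m'..<?m}" by (rule sum.union_disjoint) auto
  finally have "lex_hf as s = sum ?g {..<?m'} + sum ?g {?m'..<?m}" .
  moreover have "sum ?g {?m'..<?m} = (\<Sum>k\<in>{?m'..<?m}. 1)"
    using dec_list_zero[OF assms] by (intro sum.cong) auto
  moreover have "?m - ?m' = ?m - length (dec_list as)" by (auto simp: min_def)
  ultimately show ?thesis unfolding lex_hf_pos_def by simp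
qed

lemma lex_hf_pos_0: "lex_hf_pos as 0 = lex_hf (dec_list as) 0"
proof -
  have *: "min x (Suc 0) = (if x = 0 then 0 else 1)" for x by auto
  show ?thesis unfolding lex_hf_pos_def lex_hf_def * by simp
qed

lemma lex_hf_pos_Suc: "lex_hf_pos as (Suc s) = lex_hf_pos as s + lex_hf (dec_list as) (Suc s)"
proof -
  let ?r = "length (dec_list as)"
  let ?g = "\<lambda>s k. (s + as ! k - k) choose (as ! k)"
  let ?h = "\<lambda>k. (Suc s + dec_list as ! k - k) choose (dec_list as ! k)"
  have step: "?g (Suc s) k = ?g s k + ?h k" if "k < ?r" "k \<le> s" for k
  proof -
    have "Suc s + as ! k - k = Suc (s + as ! k - k)" "s + as ! k - k = Suc s + dec_list as ! k - k"
      using that dec_list_pos[OF that(1)] by auto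
    then show ?thesis using dec_list_pos[OF that(1)] by (simp add: add.commute)
  qed
  have common: "(\<Sum>k<min ?r (Suc s). ?g (Suc s) k) = (\<Sum>k<min ?r (Suc s). ?g s k) + (\<Sum>k<min ?r (Suc s). ?h k)"
    unfolding sum.distrib[symmetric] by (rule sum.cong[OF refl], rule step) auto
  show ?thesis
  proof (cases "?r \<le> Suc s")
    case True
    then show ?thesis using common unfolding lex_hf_pos_def lex_hf_def by (simp add: min_absorb1)
  next
    case False
    then have "min ?r (Suc s) = Suc s" "min ?r (Suc (Suc s)) = Suc (Suc s)" by auto
    then show ?thesis using common unfolding lex_hf_pos_def lex_hf_def by simp
  qed
qed

text \<open>All summands are positive in large degrees, so only the empty list represents the zero polynomial. This
  starts the induction below, where no variables are left.\<close>

lemma gotz_eventually_zero: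
  assumes "\<forall>s\<ge>N. gotz as (of_nat s) = 0"
  shows "as = []"
proof (rule ccontr)
  assume "as \<noteq> []"
  let ?s = "max N (length as)"
  have "gotz as (of_nat ?s) = of_nat (lex_hf as ?s)" by (rule gotz_eq_lex_hf) simp
  then have "lex_hf as ?s = 0" using assms[rule_format, of ?s] by simp
  moreover have "(?s + as ! 0 - 0) choose (as ! 0) \<le> lex_hf as ?s"
    unfolding lex_hf_def using \<open>as \<noteq> []\<close>
    by (intro member_le_sum[of 0 _ "\<lambda>k. (?s + as ! k - k) choose (as ! k)"]) auto
  moreover have "0 < (?s + as ! 0 - 0) choose (as ! 0)" by (simp add: zero_less_binomial)
  ultimately show False by linarith
qed

text \<open>Gotzmann's regularity theorem for strongly stable sets: generation in degrees up to
  \<open>r = length as\<close>, and the Hilbert functions of all restrictions to final segments of the variables agree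
  with their polynomials from degree \<open>r\<close> on. The lower bound by the lexicographic Hilbert function has to be
  proved along with it.

  Let \<open>C\<close> be the saturation of the restriction of \<open>A\<close> to the variables after \<open>x\<^sub>k\<close>; by induction the
  statement holds for it with \<open>dec_list as\<close>, of length \<open>r'\<close>. Let \<open>l u\<close> be the number of monomials of degree
  \<open>u\<close> in \<open>C\<close> but not in \<open>A\<close>. Summing \<open>hf_Suc\<close> expresses the Hilbert function of \<open>A\<close> as
  \<open>lex_hf_pos as s + D s + S s\<close>, where \<open>D\<close> accumulates the excess of the Hilbert function of \<open>C\<close> over its
  lower bound and \<open>S\<close> accumulates \<open>l\<close>. Comparison in a large degree shows that \<open>D\<close> and \<open>S\<close> end up with
  the total \<open>r - r'\<close>, the number of zeros in \<open>as\<close>. As \<open>C\<close> is generated in degrees up to \<open>r'\<close>, once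
  \<open>l\<close> vanishes in a degree from \<open>r'\<close> on it stays zero. So \<open>l\<close> is nonzero in a consecutive range of
  degrees starting at \<open>r'\<close>, which by the total has length at most \<open>r - r'\<close>: from degree \<open>r\<close> on, \<open>A\<close> and
  \<open>C\<close> agree.\<close>

lemma gotzmann_strongly_stable:
  assumes "k \<le> Suc n" "stable_from k n A" "saturated_from k n A" "sorted_wrt (\<ge>) as"
    "\<exists>N. \<forall>s\<ge>N. of_nat (hf k n A s) = gotz as (of_nat s)"
  shows "(\<forall>s. lex_hf as s \<le> hf k n A s) \<and>
    (\<forall>s\<ge>length as. \<forall>m\<in>monomials_from k n. m \<in> A \<longrightarrow> expo_deg m = Suc s \<longrightarrow>
       (\<exists>m' i. m' \<in> A \<and> m = m' + evar i)) \<and>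
    (\<forall>j\<ge>k. j \<le> Suc n \<longrightarrow> (\<forall>s\<ge>length as. of_nat (hf j n A s) = gotz ((dec_list ^^ (j - k)) as) (of_nat s)))"
  using assms
proof (induction k arbitrary: A as rule: inc_induct)
  case base
  have M: "monomials_from (Suc n) n = {0}" by (auto simp: monomials_from_def)
  have "0 \<in> A" using base.prems(2) by (simp add: saturated_from_def)
  then have h: "hf (Suc n) n A s = 0" for s unfolding hf_def M by auto
  then have "as = []" using base.prems(4) gotz_eventually_zero by fastforce
  then show ?case using h M by (auto simp: lex_hf_def gotz_def)
next
  case (step k)
  then have kn: "k \<le> n" by simp
  note st = step.prems(1) and sat = step.prems(2) and so = step.prems(3)
  let ?bs = "dec_list as" and ?r = "length as" and ?r' = "length (dec_list as)"
  let ?C = "saturation_from (Suc k) n A"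
  let ?h = "hf k n A" and ?hB = "hf (Suc k) n A" and ?hC = "hf (Suc k) n ?C"
  have stB: "stable_from (Suc k) n A"
    using st monomials_from_mono[of k "Suc k" n] unfolding stable_from_def by (meson Suc_leD in_mono order_refl le_SucI Suc_le_eq less_imp_le)
  define l where "l s = card {m \<in> monomials_from (Suc k) n. expo_deg m = s \<and> m \<in> ?C \<and> m \<notin> A}" for s
  have hBC: "?hB s = ?hC s + l s" for s
  proof -
    have "{m \<in> monomials_from (Suc k) n. expo_deg m = s \<and> m \<notin> A} =
        {m \<in> monomials_from (Suc k) n. expo_deg m = s \<and> m \<notin> ?C} \<union>
        {m \<in> monomials_from (Suc k) n. expo_deg m = s \<and> m \<in> ?C \<and> m \<notin> A}"
      using saturation_superset by blast
    then show ?thesis unfolding hf_def l_def by (subst card_Un_disjoint[symmetric]) auto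
  qed
  have l0_iff: "l s = 0 \<longleftrightarrow> (\<forall>m\<in>?C. expo_deg m = s \<longrightarrow> m \<in> A)" for s
    unfolding l_def by (subst card_0_eq) (auto simp: saturation_from_def)
  obtain N1 where "\<And>m. m \<in> ?C \<Longrightarrow> N1 \<le> expo_deg m \<Longrightarrow> m \<in> A"
    using saturation_eventually[OF stB] by blast
  then have l_ev: "l s = 0" if "N1 \<le> s" for s using that l0_iff by auto
  obtain N0 where N0: "\<And>s. N0 \<le> s \<Longrightarrow> of_nat (?h s) = gotz as (of_nat s)" using step.prems(4) by blast
  have hSuc: "?h (Suc s) = ?h s + ?hB (Suc s)" for s by (rule hf_Suc[OF st sat kn])
  have evC: "of_nat (?hC s) = gotz ?bs (of_nat s)" if s: "Suc (max N0 N1) \<le> s" for s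
  proof -
    obtain u where u: "s = Suc u" "N0 \<le> u" "N1 \<le> u" using s by (cases s) auto
    have "(of_nat (?hB s) :: rat) = of_nat (?h (Suc u)) - of_nat (?h u)" using hSuc[of u] u(1) by simp
    also have "\<dots> = gotz as (of_nat u + 1) - gotz as (of_nat u)"
      using N0[of u] N0[of "Suc u"] u by (simp add: add.commute)
    also have "\<dots> = gotz ?bs (of_nat s)" using gotz_diff[OF so, of "of_nat u"] u by (simp add: add.commute)
    finally show ?thesis using hBC[of s] l_ev[of s] u by simp
  qed
  have IH: "\<And>s. lex_hf ?bs s \<le> ?hC s"
    "\<And>s m. ?r' \<le> s \<Longrightarrow> m \<in> ?C \<Longrightarrow> expo_deg m = Suc s \<Longrightarrow> \<exists>m' i. m' \<in> ?C \<and> m = m' + evar i"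
    "\<And>j s. Suc k \<le> j \<Longrightarrow> j \<le> Suc n \<Longrightarrow> ?r' \<le> s \<Longrightarrow>
       of_nat (hf j n ?C s) = gotz ((dec_list ^^ (j - Suc k)) ?bs) (of_nat s)"
    using step.IH[OF stable_saturation[OF stB] saturated_saturation[OF stB] sorted_dec_list[OF so]] evC
    unfolding saturation_from_def by blast+
  define S where "S s = (\<Sum>u\<le>s. l u)" for s
  define D where "D s = (\<Sum>u\<le>s. ?hC u - lex_hf ?bs u)" for s
  have h_eq: "?h s = lex_hf_pos as s + D s + S s" for s
  proof (induction s)
    case 0
    have "?h 0 = ?hB 0" by (rule hf_0)
    then show ?case using hBC[of 0] IH(1)[of 0] by (simp add: S_def D_def lex_hf_pos_0)
  next
    case (Suc s)
    then show ?case using hSuc[of s] hBC[of "Suc s"] IH(1)[of "Suc s"]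
      by (simp add: S_def D_def lex_hf_pos_Suc)
  qed
  \<comment> \<open>From degree \<open>r'\<close> on, the Hilbert function of \<open>C\<close> attains its lower bound.\<close>
  have D_Suc: "D (Suc s) = D s" if "?r' \<le> Suc s" for s
  proof -
    have "of_nat (?hC (Suc s)) = (of_nat (lex_hf ?bs (Suc s)) :: rat)"
      using IH(3)[of "Suc k" "Suc s"] gotz_eq_lex_hf[of ?bs "Suc s"] that kn by simp
    then show ?thesis by (simp add: D_def)
  qed
  have D_const: "D s = D ?r'" if "?r' \<le> s" for s
    using that by (induction s rule: dec_induct) (auto simp: D_Suc)
  have S_mono: "S s \<le> S t" if "s \<le> t" for s t
    unfolding S_def using that by (intro sum_mono2) auto
  \<comment> \<open>A degree in which everything has become stationary.\<close>
  define Z where "Z = Suc (N0 + N1 + ?r)"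
  have "(of_nat (?h Z)::rat) = of_nat (lex_hf_pos as Z) + of_nat (?r - ?r')"
    using N0[of Z] gotz_pos_split[OF so, of Z] length_dec_list_le[of as] by (simp add: Z_def)
  then have "(of_nat (?h Z)::rat) = of_nat (lex_hf_pos as Z + (?r - ?r'))" by simp
  then have "?h Z = lex_hf_pos as Z + (?r - ?r')" by (simp only: of_nat_eq_iff)
  then have total: "D ?r' + S Z = ?r - ?r'"
    using h_eq[of Z] D_const[of Z] length_dec_list_le[of as] by (simp add: Z_def)
  have S_Z: "S s \<le> S Z" for s
  proof (cases "s \<le> Z")
    case False
    have "S s = S Z"
      unfolding S_def using False l_ev by (intro sum.mono_neutral_right) (auto simp: Z_def)
    then show ?thesis by simp
  qed (rule S_mono)
  \<comment> \<open>An element of \<open>C\<close> of degree beyond \<open>r'\<close> is a multiple of one of the previous degree.\<close>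
  have l_Suc: "l (Suc u) = 0" if "?r' \<le> u" "l u = 0" for u
    unfolding l0_iff
  proof (intro ballI impI)
    fix m assume m: "m \<in> ?C" "expo_deg m = Suc u"
    then obtain m' i where m': "m' \<in> ?C" "m = m' + evar i" using IH(2)[OF \<open>?r' \<le> u\<close> m] by blast
    then have "m' \<in> A" using that(2) m(2) l0_iff by simp
    moreover have "m' \<in> monomials_from (Suc k) n" "evar i \<in> monomials_from (Suc k) n"
      using m(1) m'(2) unfolding saturation_from_def by auto
    ultimately show "m \<in> A" using stable_add[OF stB, of "evar i" m'] m'(2) by simp
  qed
  have l_stays: "l v = 0" if "?r' \<le> u" "l u = 0" "u \<le> v" for u v
    using that(3) by (induction v rule: dec_induct) (use that l_Suc in auto)
  have l_run: "Suc s - ?r' \<le> S s" if "l s \<noteq> 0" for s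
  proof -
    have "(\<Sum>u\<in>{?r'..s}. 1) \<le> (\<Sum>u\<in>{?r'..s}. l u)"
      using l_stays[of _ s] that by (intro sum_mono) (auto simp: Suc_le_eq)
    also have "\<dots> \<le> S s" unfolding S_def by (intro sum_mono2) auto
    finally show ?thesis by simp
  qed
  have S_done: "S s = S Z" if "?r' \<le> s" "l s = 0" for s
  proof (cases "s \<le> Z")
    case True
    have "S Z = S s"
      unfolding S_def using True l_stays[OF that] by (intro sum.mono_neutral_right) (auto simp: not_le)
    then show ?thesis by simp
  next
    case False
    then show ?thesis using S_Z[of s] S_mono[of Z s] by simp
  qed
  have l_r: "l s = 0" if "?r \<le> s" for s
  proof (rule ccontr)
    assume "l s \<noteq> 0"
    then have "Suc s - ?r' \<le> ?r - ?r'" using l_run[of s] S_Z[of s] total by simp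
    then show False using that length_dec_list_le[of as] by simp
  qed
  have lower: "lex_hf as s \<le> ?h s" for s
  proof (cases "?r' \<le> s")
    case True
    have "min ?r (Suc s) - ?r' \<le> D s + S s"
    proof (cases "l s = 0")
      case True
      then show ?thesis using S_done[OF \<open>?r' \<le> s\<close>] total D_const[OF \<open>?r' \<le> s\<close>] by simp
    next
      case False
      then show ?thesis using l_run[of s] by simp
    qed
    then show ?thesis using h_eq[of s] lex_hf_split[OF so, of s] by simp
  next
    case False
    then show ?thesis using h_eq[of s] lex_hf_split[OF so, of s] by simp
  qed
  have gen: "\<exists>m' i. m' \<in> A \<and> m = m' + evar i"
    if "?r \<le> s" "m \<in> monomials_from k n" "m \<in> A" "expo_deg m = Suc s" for m s
  proof (cases "Poly_Mapping.lookup m k = 0")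
    case True
    then have mB: "m \<in> monomials_from (Suc k) n" using that by (simp add: monomials_from_Suc)
    then have "m \<in> ?C" using saturation_superset that by blast
    moreover have "?r' \<le> s" using that(1) length_dec_list_le[of as] by simp
    ultimately obtain m' i where m': "m' \<in> ?C" "m = m' + evar i"
      using IH(2) \<open>expo_deg m = Suc s\<close> by blast
    then have "m' \<in> A" using l_r[of "expo_deg m'"] l0_iff that l_r by auto
    then show ?thesis using m'(2) by blast
  next
    case False
    then obtain m' where m': "m = m' + evar k" using expo_split_var[of m k] by blast
    then have "m' \<in> A" using sat_first_var[OF st sat] that by auto
    then show ?thesis using m' by blast
  qed
  have hj: "of_nat (hf j n A s) = gotz ((dec_list ^^ (j - k)) as) (of_nat s)"
    if "k \<le> j" "j \<le> Suc n" "?r \<le> s" for j s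
  proof (cases "j = k")
    case True
    have rs: "?r' \<le> s" using that(3) length_dec_list_le[of as] by simp
    have "?h s = lex_hf_pos as s + (?r - ?r')"
      using h_eq[of s] D_const[OF rs] S_done[OF rs l_r[OF that(3)]] total by simp
    then show ?thesis using True gotz_pos_split[OF so, of s] rs by simp
  next
    case False
    then have jk: "Suc k \<le> j" using that by simp
    have "m \<in> A \<longleftrightarrow> m \<in> ?C" if "m \<in> monomials_from j n" "expo_deg m = s" for m
    proof -
      have "m \<in> monomials_from (Suc k) n" using that(1) jk monomials_from_mono by blast
      then show ?thesis using saturation_superset l_r[OF \<open>?r \<le> s\<close>] l0_iff that(2) by blast
    qed
    then have "hf j n A s = hf j n ?C s" unfolding hf_def by (intro arg_cong[where f = card]) blast
    moreover have "(dec_list ^^ (j - k)) as = (dec_list ^^ (j - Suc k)) ?bs"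
    proof -
      have "j - k = Suc (j - Suc k)" using jk by simp
      then show ?thesis by (simp only: funpow_Suc_right comp_apply)
    qed
    ultimately show ?thesis using IH(3)[OF jk that(2)] that(3) length_dec_list_le[of as] by simp
  qed
  show ?case using lower gen hj by blast
qed

section \<open>Combinatorics of a pair of adjacent sets\<close>

definition move_closed :: "nat \<Rightarrow> expo set \<Rightarrow> bool"
  where "move_closed n D \<longleftrightarrow> (\<forall>m i j. i < j \<longrightarrow> j \<le> n \<longrightarrow> m + evar i \<in> D \<longrightarrow> m + evar j \<in> D)"

definition multiples :: "expo set \<Rightarrow> expo set"
  where "multiples D = {b + m | b m. m \<in> D}"

lemma multiplesI: "m \<in> D \<Longrightarrow> b + m \<in> multiples D"
  unfolding multiples_def by blast

lemma multiples_add: "m \<in> multiples D \<Longrightarrow> b + m \<in> multiples D"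
  unfolding multiples_def by (auto simp: add.assoc[symmetric]) blast

lemma move_closed_Int: "move_closed n D \<Longrightarrow> move_closed n D' \<Longrightarrow> move_closed n (D \<inter> D')"
  unfolding move_closed_def by blast

lemma exists_lookup_less:
  assumes "expo_deg m \<le> expo_deg m'" "m \<noteq> m'"
  shows "\<exists>i. Poly_Mapping.lookup m i < Poly_Mapping.lookup m' i"
proof (rule ccontr)
  assume "\<not> ?thesis"
  then have le: "\<And>i. Poly_Mapping.lookup m' i \<le> Poly_Mapping.lookup m i" by (simp add: not_less)
  have "m = m' + (m - m')"
    by (rule poly_mapping_eqI) (simp add: lookup_add lookup_minus le)
  moreover from this have "expo_deg (m - m') = 0" using assms(1) by (metis add_le_same_cancel1 expo_deg_add le_zero_eq)
  ultimately show False using assms(2) by (simp add: expo_deg_eq_0_iff)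
qed

text \<open>If every variable of \<open>b\<close> precedes every variable of \<open>m\<close>, then \<open>m\<close> is the largest divisor of
  its degree of \<open>b + m\<close> in the Borel order: any other one is turned into \<open>m\<close> by trading smaller
  variables for larger ones.\<close>

lemma star_divisor_mem:
  assumes D: "move_closed n D" and m: "m \<in> monomials n"
    and star: "\<And>i j. i \<in> Poly_Mapping.keys b \<Longrightarrow> j \<in> Poly_Mapping.keys m \<Longrightarrow> i \<le> j"
    and deg: "\<And>d. d \<in> D \<Longrightarrow> expo_deg d = expo_deg m"
    and mem: "b + m = b' + m'" "m' \<in> D"
  shows "m \<in> D"
  using mem
proof (induction "expo_deg (m' - m)" arbitrary: b' m' rule: less_induct)
  case less
  show ?case
  proof (cases "m = m'")
    case False
    then obtain i where i: "Poly_Mapping.lookup m i < Poly_Mapping.lookup m' i"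
      using exists_lookup_less[of m m'] deg[OF less.prems(2)] by auto
    obtain j where j: "Poly_Mapping.lookup m' j < Poly_Mapping.lookup m j"
      using exists_lookup_less[of m' m] deg[OF less.prems(2)] False by auto
    have sum: "Poly_Mapping.lookup b l + Poly_Mapping.lookup m l = Poly_Mapping.lookup b' l + Poly_Mapping.lookup m' l" for l
      using less.prems(1) by (metis lookup_add)
    have "i \<in> Poly_Mapping.keys b" "j \<in> Poly_Mapping.keys m"
      using sum[of i] i j by (auto simp: in_keys_iff)
    then have "i < j" "j \<le> n" using star[of i j] i j m by (auto simp: le_less monomials_def)
    obtain m1 where m1: "m' = m1 + evar i" using expo_split_var[of m' i] i by auto
    obtain b1 where b1: "b' = b1 + evar j" using expo_split_var[of b' j] sum[of j] j by auto
    have in_D: "m1 + evar j \<in> D" using D less.prems(2) m1 \<open>i < j\<close> \<open>j \<le> n\<close> unfolding move_closed_def by blast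
    have eq: "b + m = (b1 + evar i) + (m1 + evar j)" using less.prems(1) m1 b1 by (simp add: ac_simps)
    have "m' - m = ((m1 + evar j) - m) + evar i"
      using i j \<open>i < j\<close> unfolding m1
      by (intro poly_mapping_eqI) (auto simp: lookup_add lookup_minus lookup_evar)
    then have "expo_deg (m1 + evar j - m) < expo_deg (m' - m)" by simp
    then show ?thesis using less.hyps eq in_D by blast
  qed (use less.prems in simp)
qed

text \<open>What the flatness proof uses of Borel adjacency. \<open>Q\<close> pairs \<open>E(x\<^sup>a)\<close> with \<open>E(x\<^sup>a')\<close> for the
  moves \<open>E\<close>; all pairs differ by the same vector, and \<open>same_min\<close> says that the two members of a pair have
  the same least variable.\<close>

locale borel_pair =
  fixes n r :: nat and D0 D1 :: "expo set" and a0 a1 :: expo and Q :: "(expo \<times> expo) set"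
  assumes D0: "D0 \<subseteq> monomials n" "\<And>m. m \<in> D0 \<Longrightarrow> expo_deg m = r" "move_closed n D0"
    and D1: "D1 \<subseteq> monomials n" "\<And>m. m \<in> D1 \<Longrightarrow> expo_deg m = r" "move_closed n D1"
    and fst_Q: "fst ` Q = D0 - D1" and snd_Q: "snd ` Q = D1 - D0"
    and shift: "\<And>c c'. (c, c') \<in> Q \<Longrightarrow> c + a1 = c' + a0"
    and a_neq: "a0 \<noteq> a1"
    and same_min: "\<And>c c' k. (c, c') \<in> Q \<Longrightarrow> c \<in> monomials_from k n \<longleftrightarrow> c' \<in> monomials_from k n"
begin

lemma swap: "borel_pair n r D1 D0 a1 a0 (prod.swap ` Q)"
proof
  show "fst ` prod.swap ` Q = D1 - D0" "snd ` prod.swap ` Q = D0 - D1"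
    using fst_Q snd_Q by (auto simp: image_image)
qed (use D0 D1 shift a_neq same_min in auto)

lemma Q_mem:
  assumes "(c, c') \<in> Q"
  shows "c \<in> D0" "c \<notin> D1" "c' \<in> D1" "c' \<notin> D0"
  using assms fst_Q snd_Q by force+

lemma Q_left: assumes "c \<in> D0" "c \<notin> D1" "c + a1 = c' + a0" shows "(c, c') \<in> Q"
proof -
  obtain c'' where "(c, c'') \<in> Q" using assms fst_Q by force
  then show ?thesis using shift[of c c''] assms(3) by simp
qed

lemma Q_right: assumes "c' \<in> D1" "c' \<notin> D0" "c + a1 = c' + a0" shows "(c, c') \<in> Q"
proof -
  obtain c'' where "(c'', c') \<in> Q" using assms snd_Q by force
  moreover from this have "c'' + a1 = c + a1" using shift[of c'' c'] assms(3) by simp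
  ultimately show ?thesis by simp
qed

lemma Q_deg: assumes "(c, c') \<in> Q" shows "expo_deg c = r" "expo_deg c' = r"
  using Q_mem[OF assms] D0 D1 by auto

abbreviation "D \<equiv> D0 \<inter> D1"

text \<open>The Eliahou--Kervaire rewriting of \<open>b + c\<close>: while \<open>b\<close> contains a variable \<open>i\<close> beyond the least
  variable \<open>\<mu>\<close> of \<open>c\<close>, exchange the two. As \<open>c\<close> and \<open>c'\<close> have the same least variable, the exchange
  can be made on both sides at once, and the two results are again paired or both lie in \<open>D\<close>. The
  exchanges lower the weighted degree of \<open>b\<close>. When none is left, \<open>star_divisor_mem\<close> shows that \<open>b + c\<close>
  is not a multiple of \<open>D\<close>, for otherwise \<open>c\<close> would lie in \<open>D\<close>.\<close>

lemma multiples_transfer_left: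
  assumes "(c, c') \<in> Q" "b + c \<in> multiples D" "b \<in> monomials n"
  shows "b + c' \<in> multiples D"
  using assms
proof (induction "\<Sum>i\<in>{..n}. i * Poly_Mapping.lookup b i" arbitrary: b c c' rule: less_induct)
  case less
  note Qc = Q_mem[OF less.prems(1)]
  have cc: "c \<in> monomials n" "c' \<in> monomials n" using Qc D0 D1 by auto
  have "c \<noteq> c'" using Qc by auto
  have "c \<noteq> 0"
  proof
    assume "c = 0"
    then have "r = 0" using Q_deg[OF less.prems(1)] by simp
    then show False using Q_deg[OF less.prems(1)] \<open>c \<noteq> c'\<close> by (simp add: expo_deg_eq_0_iff)
  qed
  then have ne: "Poly_Mapping.keys c \<noteq> {}" by simp
  define \<mu> where "\<mu> = Min (Poly_Mapping.keys c)"
  have mu: "\<mu> \<in> Poly_Mapping.keys c" "\<And>j. j \<in> Poly_Mapping.keys c \<Longrightarrow> \<mu> \<le> j"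
    using ne by (auto simp: \<mu>_def)
  have "c \<in> monomials_from \<mu> n" "c \<notin> monomials_from (Suc \<mu>) n"
    using mu cc by (auto simp: monomials_from_def monomials_def)
  then have "c' \<in> monomials_from \<mu> n" "c' \<notin> monomials_from (Suc \<mu>) n"
    using same_min[OF less.prems(1)] by auto
  then have mu': "0 < Poly_Mapping.lookup c' \<mu>" by (simp add: monomials_from_Suc)
  show ?case
  proof (cases "\<exists>i\<in>Poly_Mapping.keys b. \<mu> < i")
    case False
    have "\<exists>b' m'. b + c = b' + m' \<and> m' \<in> D" using less.prems(2) unfolding multiples_def by blast
    then have "c \<in> D"
      using star_divisor_mem[OF move_closed_Int[OF D0(3) D1(3)] cc(1), of b] False mu(2) D0(2) Q_deg[OF less.prems(1)]
      by (metis IntD1 le_trans not_le)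
    then show ?thesis using Qc by simp
  next
    case True
    then obtain i where i: "i \<in> Poly_Mapping.keys b" "\<mu> < i" by blast
    then have "i \<le> n" using less.prems(3) by (auto simp: monomials_def)
    obtain b1 where b1: "b = b1 + evar i" using expo_split_var[of b i] i by (auto simp: in_keys_iff)
    obtain c1 where c1: "c = c1 + evar \<mu>" using expo_split_var[of c \<mu>] mu(1) by (auto simp: in_keys_iff)
    obtain c1' where c1': "c' = c1' + evar \<mu>" using expo_split_var[of c' \<mu>] mu' by blast
    let ?b = "b1 + evar \<mu>" and ?c = "c1 + evar i" and ?c' = "c1' + evar i"
    have eq: "b + c = ?b + ?c" "b + c' = ?b + ?c'" using b1 c1 c1' by (simp_all add: ac_simps)
    have c_in: "?c \<in> D0" "?c' \<in> D1"
      using Qc D0(3) D1(3) c1 c1' i \<open>i \<le> n\<close> unfolding move_closed_def by blast+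
    have sh: "?c + a1 = ?c' + a0"
    proof -
      have "?c + a1 + evar \<mu> = ?c' + a0 + evar \<mu>"
        using shift[OF less.prems(1)] c1 c1' by (metis (no_types, lifting) add.assoc add.commute)
      then show ?thesis by simp
    qed
    show ?thesis
    proof (cases "?c \<in> D1")
      case True
      have "?c' \<in> D0"
        using Q_right[OF c_in(2) _ sh] Q_mem True by blast
      then show ?thesis using c_in eq(2) multiplesI[of ?c' D ?b] by simp
    next
      case False
      then have Q: "(?c, ?c') \<in> Q" using Q_left c_in sh by blast
      have "(\<Sum>l\<in>{..n}. l * Poly_Mapping.lookup ?b l) < (\<Sum>l\<in>{..n}. l * Poly_Mapping.lookup b l)"
      proof -
        have *: "(\<Sum>l\<in>{..n}. l * Poly_Mapping.lookup (b1 + evar v) l) = (\<Sum>l\<in>{..n}. l * Poly_Mapping.lookup b1 l) + v"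
          if "v \<le> n" for v
        proof -
          have "(\<Sum>l\<in>{..n}. l * Poly_Mapping.lookup (b1 + evar v) l)
             = (\<Sum>l\<in>{..n}. l * Poly_Mapping.lookup b1 l + (if l = v then v else 0))"
            by (intro sum.cong) (auto simp: lookup_add lookup_evar)
          then show ?thesis using that by (simp add: sum.distrib)
        qed
        show ?thesis unfolding b1 using *[of \<mu>] *[of i] i(2) \<open>i \<le> n\<close> by simp
      qed
      moreover have "?b \<in> monomials n" using less.prems(3) b1 i \<open>i \<le> n\<close> by (simp add: monomials_eq_from)
      ultimately show ?thesis using less.hyps Q less.prems(2) eq by metis
    qed
  qed
qed

lemma multiples_transfer:
  assumes "(c, c') \<in> Q" "b \<in> monomials n"
  shows "b + c \<in> multiples D \<longleftrightarrow> b + c' \<in> multiples D"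
proof -
  interpret sw: borel_pair n r D1 D0 a1 a0 "prod.swap ` Q" by (rule swap)
  have "(c', c) \<in> prod.swap ` Q" using assms(1) by force
  then show ?thesis
    using multiples_transfer_left[OF assms(1)] sw.multiples_transfer_left[of c' c b] assms(2)
    by (metis Int_commute)
qed

text \<open>The relation that \<open>Q\<close> imposes, read as a rewriting rule on the monomials that do not vanish modulo \<open>D\<close>.\<close>

definition rewrite_step :: "expo \<Rightarrow> expo \<Rightarrow> bool"
  where "rewrite_step g g' \<longleftrightarrow> (\<exists>b c c'. (c, c') \<in> Q \<and> b \<in> monomials n \<and> g = b + c \<and> g' = b + c' \<and> g \<notin> multiples D)"

lemma rewrite_step_shift: "rewrite_step g g' \<Longrightarrow> g + a1 = g' + a0"
  unfolding rewrite_step_def using shift by (metis add.assoc)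

lemma rewrite_step_unique: "rewrite_step g g' \<Longrightarrow> rewrite_step g g'' \<Longrightarrow> g' = g''"
  using rewrite_step_shift by (metis add_right_imp_eq)

lemma rewrite_step_deg: "rewrite_step g g' \<Longrightarrow> expo_deg g' = expo_deg g"
  unfolding rewrite_step_def using Q_deg by auto

lemma rewrite_step_not_multiples: "rewrite_step g g' \<Longrightarrow> g \<notin> multiples D \<and> g' \<notin> multiples D"
  unfolding rewrite_step_def using multiples_transfer by auto

lemma rewrite_step_multiple: "rewrite_step g g' \<Longrightarrow> g \<in> multiples D0"
  unfolding rewrite_step_def using Q_mem multiplesI by blast

lemma rewrite_step_monomials: "rewrite_step g g' \<Longrightarrow> g \<in> monomials n \<and> g' \<in> monomials n"
proof -
  assume "rewrite_step g g'"
  then obtain b c c' where *: "(c, c') \<in> Q" "b \<in> monomials n" "g = b + c" "g' = b + c'"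
    unfolding rewrite_step_def by blast
  then have "c \<in> monomials n" "c' \<in> monomials n" using Q_mem[OF *(1)] D0(1) D1(1) by auto
  then show ?thesis using * by (simp add: monomials_eq_from)
qed

lemma rewrite_step_pow:
  assumes "(rewrite_step ^^ k) g h"
  shows "Poly_Mapping.lookup g i + k * Poly_Mapping.lookup a1 i = Poly_Mapping.lookup h i + k * Poly_Mapping.lookup a0 i"
    "expo_deg h = expo_deg g"
  using assms
proof (induction k arbitrary: h)
  case (Suc k)
  {
    case 1
    then obtain h' where h': "(rewrite_step ^^ k) g h'" "rewrite_step h' h" by auto
    have "Poly_Mapping.lookup h' i + Poly_Mapping.lookup a1 i = Poly_Mapping.lookup h i + Poly_Mapping.lookup a0 i"
      using rewrite_step_shift[OF h'(2)] by (metis lookup_add)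
    then show ?case using Suc(1)[OF h'(1)] by simp
  next
    case 2
    then obtain h' where h': "(rewrite_step ^^ k) g h'" "rewrite_step h' h" by auto
    then show ?case using Suc(2) rewrite_step_deg by metis
  }
qed auto

lemma shift_var: obtains i where "Poly_Mapping.lookup a0 i \<noteq> Poly_Mapping.lookup a1 i"
  using a_neq by (metis poly_mapping_eqI)

text \<open>A chain of rewriting steps translates by a fixed nonzero vector inside the finitely many
  monomials of a degree, so its length is bounded by the degree.\<close>

lemma rewrite_pow_bound:
  assumes "(rewrite_step ^^ k) g h"
  shows "k \<le> expo_deg g"
proof -
  obtain i where i: "Poly_Mapping.lookup a0 i \<noteq> Poly_Mapping.lookup a1 i" by (rule shift_var)
  note e = rewrite_step_pow[OF assms]
  have le: "Poly_Mapping.lookup g i \<le> expo_deg g" "Poly_Mapping.lookup h i \<le> expo_deg g"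
    using lookup_le_expo_deg[of g i] lookup_le_expo_deg[of h i] e(2) by auto
  show ?thesis
  proof (cases "Poly_Mapping.lookup a0 i < Poly_Mapping.lookup a1 i")
    case True
    then obtain d where d: "Poly_Mapping.lookup a1 i = Poly_Mapping.lookup a0 i + Suc d"
      by (metis add_Suc_right less_imp_Suc_add)
    then have "k * Suc d \<le> Poly_Mapping.lookup h i" using e(1)[of i] by (simp add: algebra_simps)
    then show ?thesis using le by simp
  next
    case False
    then obtain d where d: "Poly_Mapping.lookup a0 i = Poly_Mapping.lookup a1 i + Suc d"
      using i by (metis add_Suc_right less_imp_Suc_add linorder_neqE_nat)
    then have "k * Suc d \<le> Poly_Mapping.lookup g i" using e(1)[of i] by (simp add: algebra_simps)
    then show ?thesis using le by simp
  qed
qed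

text \<open>Rewriting terminates: some variable occurs with different exponents in \<open>a0\<close> and \<open>a1\<close>, and each step moves
  its exponent in the same direction, between zero and the degree.\<close>

lemma rewrite_induct [consumes 1, case_names step]:
  assumes "g \<in> monomials n"
    and "\<And>g. g \<in> monomials n \<Longrightarrow> (\<And>g'. rewrite_step g g' \<Longrightarrow> P g') \<Longrightarrow> P g"
  shows "P g"
proof -
  obtain i where i: "Poly_Mapping.lookup a0 i \<noteq> Poly_Mapping.lookup a1 i" by (rule shift_var)
  define w where "w g = (if Poly_Mapping.lookup a0 i < Poly_Mapping.lookup a1 i
     then expo_deg g - Poly_Mapping.lookup g i else Poly_Mapping.lookup g i)" for g
  have w: "w g' < w g" if "rewrite_step g g'" for g g'
  proof -
    have "Poly_Mapping.lookup g i + Poly_Mapping.lookup a1 i = Poly_Mapping.lookup g' i + Poly_Mapping.lookup a0 i"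
      using rewrite_step_shift[OF that] by (metis lookup_add)
    then show ?thesis
      using i lookup_le_expo_deg[of g i] lookup_le_expo_deg[of g' i] rewrite_step_deg[OF that]
      unfolding w_def by (cases "Poly_Mapping.lookup a0 i < Poly_Mapping.lookup a1 i") (simp; linarith)+
  qed
  show ?thesis using assms(1)
  proof (induction "w g" arbitrary: g rule: less_induct)
    case less
    then show ?case using assms(2) w rewrite_step_monomials by blast
  qed
qed

end

text \<open>Degrees and exponents are compared with the numeral \<open>1\<close> throughout.\<close>

declare One_nat_def [simp del]

section \<open>Rings carried by a subset of a type\<close>

text \<open>All rings that occur consist of elements of a type with a ring structure and inherit its operations.
  Ideals and quotients are described in terms of these operations, so that calculations take place in the type.\<close>

definition is_subring :: "'a::comm_ring_1 set \<Rightarrow> bool"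
  where "is_subring C \<longleftrightarrow> 1 \<in> C \<and> (\<forall>x\<in>C. \<forall>y\<in>C. x + y \<in> C \<and> x * y \<in> C) \<and> (\<forall>x\<in>C. - x \<in> C)"

definition ring_of :: "'a::comm_ring_1 set \<Rightarrow> 'a ring"
  where "ring_of C = \<lparr>carrier = C, mult = (*), one = 1, zero = 0, add = (+)\<rparr>"

lemma ring_of_simps [simp]:
  "carrier (ring_of C) = C" "mult (ring_of C) = (*)" "one (ring_of C) = 1" "zero (ring_of C) = 0" "add (ring_of C) = (+)"
  by (simp_all add: ring_of_def)

lemma subring_closed:
  assumes "is_subring C"
  shows "0 \<in> C" "1 \<in> C" "x \<in> C \<Longrightarrow> y \<in> C \<Longrightarrow> x + y \<in> C" "x \<in> C \<Longrightarrow> y \<in> C \<Longrightarrow> x * y \<in> C"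
    "x \<in> C \<Longrightarrow> - x \<in> C" "x \<in> C \<Longrightarrow> y \<in> C \<Longrightarrow> x - y \<in> C"
  using assms unfolding is_subring_def
  by (metis add.right_inverse, blast, blast, blast, blast, metis diff_conv_add_uminus)

lemma cring_ring_of:
  assumes "is_subring C"
  shows "cring (ring_of C)"
proof (rule cringI)
  show "abelian_group (ring_of C)"
  proof (rule abelian_groupI)
    fix x assume "x \<in> carrier (ring_of C)"
    then show "\<exists>y\<in>carrier (ring_of C). y \<oplus>\<^bsub>ring_of C\<^esub> x = \<zero>\<^bsub>ring_of C\<^esub>"
      using subring_closed[OF assms] by (intro bexI[of _ "- x"]) auto
  qed (use subring_closed[OF assms] in \<open>auto simp: ac_simps\<close>)
  show "comm_monoid (ring_of C)"
    by (rule comm_monoidI) (use subring_closed[OF assms] in \<open>auto simp: ac_simps\<close>)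
qed (auto simp: algebra_simps)

lemma a_inv_ring_of:
  assumes "is_subring C" "x \<in> C"
  shows "\<ominus>\<^bsub>ring_of C\<^esub> x = - x"
proof -
  interpret cring "ring_of C" by (rule cring_ring_of) fact
  show ?thesis
    by (rule minus_equality) (use subring_closed[OF assms(1)] assms(2) in auto)
qed

lemma ideal_ring_of_iff:
  assumes "is_subring C"
  shows "ideal I (ring_of C) \<longleftrightarrow>
    I \<subseteq> C \<and> 0 \<in> I \<and> (\<forall>x\<in>I. \<forall>y\<in>I. x + y \<in> I) \<and> (\<forall>c\<in>C. \<forall>x\<in>I. c * x \<in> I)" (is "_ \<longleftrightarrow> ?R")
proof
  assume "ideal I (ring_of C)"
  then interpret ideal I "ring_of C" .
  show ?R
    using a_subset additive_subgroup.zero_closed[OF additive_subgroup_axioms]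
      additive_subgroup.a_closed[OF additive_subgroup_axioms] I_l_closed by auto
next
  interpret R: cring "ring_of C" by (rule cring_ring_of) fact
  assume R: ?R
  show "ideal I (ring_of C)"
  proof (rule idealI)
    show "subgroup I (add_monoid (ring_of C))"
    proof (unfold_locales)
      fix x assume x: "x \<in> I"
      then have "inv\<^bsub>add_monoid (ring_of C)\<^esub> x = - x"
        using a_inv_ring_of[OF assms, of x] R by (auto simp: a_inv_def)
      moreover have "(- 1) * x \<in> I" using R x subring_closed[OF assms] by blast
      ultimately show "inv\<^bsub>add_monoid (ring_of C)\<^esub> x \<in> I" by simp
    qed (use R in auto)
    show "x \<otimes>\<^bsub>ring_of C\<^esub> a \<in> I" "a \<otimes>\<^bsub>ring_of C\<^esub> x \<in> I"
      if "a \<in> I" "x \<in> carrier (ring_of C)" for a x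
    proof -
      have "x * a \<in> I" using R that by auto
      then show "x \<otimes>\<^bsub>ring_of C\<^esub> a \<in> I" "a \<otimes>\<^bsub>ring_of C\<^esub> x \<in> I" by (simp_all add: mult.commute)
    qed
  qed (rule R.ring_axioms)
qed

lemma ideal_closed:
  assumes "is_subring C" "ideal I (ring_of C)"
  shows "0 \<in> I" "x \<in> I \<Longrightarrow> y \<in> I \<Longrightarrow> x + y \<in> I" "x \<in> I \<Longrightarrow> c \<in> C \<Longrightarrow> c * x \<in> I"
    "x \<in> I \<Longrightarrow> c \<in> C \<Longrightarrow> x * c \<in> I" "x \<in> I \<Longrightarrow> - x \<in> I" "x \<in> I \<Longrightarrow> y \<in> I \<Longrightarrow> x - y \<in> I" "I \<subseteq> C"
proof -
  note * = assms(2)[unfolded ideal_ring_of_iff[OF assms(1)]]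
  show "0 \<in> I" "x \<in> I \<Longrightarrow> y \<in> I \<Longrightarrow> x + y \<in> I" "x \<in> I \<Longrightarrow> c \<in> C \<Longrightarrow> c * x \<in> I"
    "x \<in> I \<Longrightarrow> c \<in> C \<Longrightarrow> x * c \<in> I" "I \<subseteq> C"
    using * by (auto simp: mult.commute)
  have m: "- x \<in> I" if "x \<in> I" for x
  proof -
    have "(- 1) * x \<in> I" using * that subring_closed[OF assms(1)] by blast
    then show ?thesis by simp
  qed
  then show "x \<in> I \<Longrightarrow> - x \<in> I" .
  show "x \<in> I \<Longrightarrow> y \<in> I \<Longrightarrow> x - y \<in> I" using * m by (metis diff_conv_add_uminus)
qed

lemma ideal_sum_closed:
  assumes "is_subring C" "ideal I (ring_of C)" "\<And>a. a \<in> A \<Longrightarrow> f a \<in> I"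
  shows "sum f A \<in> I"
  using assms(3) by (induction A rule: infinite_finite_induct) (auto simp: ideal_closed[OF assms(1,2)])

lemma genideal_least:
  assumes "is_subring C" "ideal I (ring_of C)" "S \<subseteq> I"
  shows "genideal (ring_of C) S \<subseteq> I"
  using assms(2,3) unfolding genideal_def by auto

lemma genideal_ring_of:
  assumes "is_subring C" "S \<subseteq> C"
  shows "ideal (genideal (ring_of C) S) (ring_of C)" "S \<subseteq> genideal (ring_of C) S"
proof -
  interpret cring "ring_of C" by (rule cring_ring_of) fact
  show "ideal (genideal (ring_of C) S) (ring_of C)" "S \<subseteq> genideal (ring_of C) S"
    using genideal_ideal[of S] genideal_self[of S] assms(2) by auto
qed

lemma primeideal_ring_of_iff:
  assumes "is_subring C"
  shows "primeideal I (ring_of C) \<longleftrightarrow>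
    ideal I (ring_of C) \<and> 1 \<notin> I \<and> (\<forall>x\<in>C. \<forall>y\<in>C. x * y \<in> I \<longrightarrow> x \<in> I \<or> y \<in> I)" (is "_ \<longleftrightarrow> ?R")
proof
  assume "primeideal I (ring_of C)"
  then interpret primeideal I "ring_of C" .
  show ?R using is_ideal I_prime I_notcarr one_imp_carrier by auto
next
  assume ?R
  then show "primeideal I (ring_of C)"
    using cring_ring_of[OF assms] subring_closed(2)[OF assms] by (intro primeidealI) auto
qed

lemma coset_ring_of: "I +>\<^bsub>ring_of C\<^esub> x = (\<lambda>i. i + x) ` I"
  unfolding a_r_coset_def r_coset_def by (auto simp: ring_of_def)

lemma coset_eq_iff:
  assumes "is_subring C" "ideal I (ring_of C)" "x \<in> C" "y \<in> C"
  shows "I +>\<^bsub>ring_of C\<^esub> x = I +>\<^bsub>ring_of C\<^esub> y \<longleftrightarrow> x - y \<in> I"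
proof
  assume "I +>\<^bsub>ring_of C\<^esub> x = I +>\<^bsub>ring_of C\<^esub> y"
  moreover have "x \<in> I +>\<^bsub>ring_of C\<^esub> x"
    unfolding coset_ring_of using ideal_closed(1)[OF assms(1,2)] by force
  ultimately obtain i where "i \<in> I" "x = i + y" unfolding coset_ring_of by auto
  then show "x - y \<in> I" by simp
next
  assume *: "x - y \<in> I"
  have "(\<lambda>i. i + u) ` I \<subseteq> (\<lambda>i. i + v) ` I" if uv: "u - v \<in> I" for u v
  proof
    fix z assume "z \<in> (\<lambda>i. i + u) ` I"
    then obtain i where i: "i \<in> I" "z = i + u" by auto
    then have "z = (i + (u - v)) + v" by simp
    then show "z \<in> (\<lambda>i. i + v) ` I" using ideal_closed(2)[OF assms(1,2) i(1) uv] by blast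
  qed
  moreover have "y - x \<in> I" using ideal_closed(5)[OF assms(1,2) *] by simp
  ultimately show "I +>\<^bsub>ring_of C\<^esub> x = I +>\<^bsub>ring_of C\<^esub> y"
    unfolding coset_ring_of using * by blast
qed

section \<open>Polynomials as finite sums of terms\<close>

lemma poly_mapping_eq_sum: "f = (\<Sum>a\<in>Poly_Mapping.keys f. Poly_Mapping.single a (Poly_Mapping.lookup f a))"
proof (rule poly_mapping_eqI)
  fix k
  show "Poly_Mapping.lookup f k = Poly_Mapping.lookup (\<Sum>a\<in>Poly_Mapping.keys f. Poly_Mapping.single a (Poly_Mapping.lookup f a)) k"
  proof (cases "k \<in> Poly_Mapping.keys f")
    case True
    then show ?thesis by (simp add: lookup_sum lookup_single when_def)
  next
    case False
    then show ?thesis by (simp add: lookup_sum lookup_single when_def in_keys_iff)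
  qed
qed

lemma poly_mapping_mult_eq_sum:
  fixes f g :: "'c::comm_ring_1 mpoly"
  shows "f * g = (\<Sum>a\<in>Poly_Mapping.keys f. \<Sum>b\<in>Poly_Mapping.keys g.
    Poly_Mapping.single (a + b) (Poly_Mapping.lookup f a * Poly_Mapping.lookup g b))"
  by (subst poly_mapping_eq_sum[of f], subst poly_mapping_eq_sum[of g])
     (simp add: sum_product mult_single)

lemma sum_mem:
  assumes "(0::'a::comm_monoid_add) \<in> X" "\<And>x y. x \<in> X \<Longrightarrow> y \<in> X \<Longrightarrow> x + y \<in> X" "\<And>a. a \<in> A \<Longrightarrow> f a \<in> X"
  shows "sum f A \<in> X"
  using assms(3) by (induction A rule: infinite_finite_induct) (auto simp: assms(1,2))

abbreviation poly_carrier :: "'c::comm_ring_1 set \<Rightarrow> nat \<Rightarrow> 'c mpoly set"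
  where "poly_carrier A n \<equiv> {f. \<forall>a\<in>Poly_Mapping.keys f. a \<in> monomials n \<and> Poly_Mapping.lookup f a \<in> A}"

lemma poly_ring_eq: "poly_ring A n = ring_of (poly_carrier A n)"
  by (simp add: poly_ring_def ring_of_def)

lemma monomials_add [simp]: "a + b \<in> monomials n \<longleftrightarrow> a \<in> monomials n \<and> b \<in> monomials n"
  by (simp add: monomials_eq_from)

lemma monomials_zero [simp]: "0 \<in> monomials n"
  by (simp add: monomials_eq_from)

lemma poly_carrier_add:
  assumes "is_subring A" "f \<in> poly_carrier A n" "g \<in> poly_carrier A n"
  shows "f + g \<in> poly_carrier A n"
proof -
  have *: "Poly_Mapping.lookup h a \<in> A" if "h \<in> poly_carrier A n" for h a
    using that subring_closed(1)[OF assms(1)] by (cases "a \<in> Poly_Mapping.keys h") (auto simp: in_keys_iff)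
  then show ?thesis
    using assms keys_add[of f g] subring_closed(3)[OF assms(1)] by (auto simp: lookup_add)
qed

lemma subring_poly_carrier:
  assumes "is_subring A"
  shows "is_subring (poly_carrier A n)"
  unfolding is_subring_def
proof (intro conjI ballI)
  note A = subring_closed[OF assms]
  have z: "0 \<in> poly_carrier A n" by simp
  show "1 \<in> poly_carrier A n" using A by (auto simp: lookup_one when_def)
  fix f g assume f: "f \<in> poly_carrier A n" and g: "g \<in> poly_carrier A n"
  show "f + g \<in> poly_carrier A n" by (rule poly_carrier_add) fact+
  show "f * g \<in> poly_carrier A n"
    unfolding poly_mapping_mult_eq_sum[of f g]
  proof (rule sum_mem[OF z poly_carrier_add[OF assms]], assumption, assumption,
      rule sum_mem[OF z poly_carrier_add[OF assms]], assumption, assumption)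
    fix a b assume "a \<in> Poly_Mapping.keys f" "b \<in> Poly_Mapping.keys g"
    then have "a + b \<in> monomials n" "Poly_Mapping.lookup f a * Poly_Mapping.lookup g b \<in> A"
      using f g A by auto
    then show "Poly_Mapping.single (a + b) (Poly_Mapping.lookup f a * Poly_Mapping.lookup g b) \<in> poly_carrier A n"
      by (auto split: if_splits)
  qed
next
  fix f assume f: "f \<in> poly_carrier A n"
  have "Poly_Mapping.keys (- f) = Poly_Mapping.keys f" by (auto simp: in_keys_iff)
  then show "- f \<in> poly_carrier A n" using f subring_closed(5)[OF assms] by auto
qed

lemma is_subring_UNIV [simp]: "is_subring UNIV"
  by (simp add: is_subring_def)

definition CX :: "nat \<Rightarrow> 'c::comm_ring_1 mpoly set"
  where "CX n = {f. Poly_Mapping.keys f \<subseteq> monomials n}"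

definition CYX :: "nat \<Rightarrow> 'c::comm_ring_1 mpoly mpoly set"
  where "CYX n = poly_carrier (CX 1) n"

lemma CX_eq: "poly_carrier UNIV n = CX n"
  by (auto simp: CX_def)

lemma Kx_eq: "Kx n = ring_of (CX n)"
  by (simp only: poly_ring_eq CX_eq)

lemma Kyx_eq: "Kyx n = ring_of (CYX n)"
  by (simp only: poly_ring_eq Kx_eq CYX_def ring_of_simps CX_eq)

lemma subring_CX [simp]: "is_subring (CX n)"
  using subring_poly_carrier[OF is_subring_UNIV, of n] by (simp only: CX_eq)

lemma subring_CYX [simp]: "is_subring (CYX n)"
  unfolding CYX_def by (rule subring_poly_carrier) simp

lemmas CX_closed = subring_closed[OF subring_CX]
lemmas CYX_closed = subring_closed[OF subring_CYX]

lemma single_CX [simp]: "a \<in> monomials n \<Longrightarrow> Poly_Mapping.single a c \<in> CX n"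
  by (simp add: CX_def)

lemma single_CYX [simp]: "a \<in> monomials n \<Longrightarrow> c \<in> CX 1 \<Longrightarrow> Poly_Mapping.single a c \<in> CYX n"
  by (simp add: CYX_def)

lemma CYX_coeff: "F \<in> CYX n \<Longrightarrow> Poly_Mapping.lookup F a \<in> CX 1"
  using CX_closed(1) by (cases "a \<in> Poly_Mapping.keys F") (auto simp: CYX_def in_keys_iff)

lemma CYX_key: "F \<in> CYX n \<Longrightarrow> a \<in> Poly_Mapping.keys F \<Longrightarrow> a \<in> monomials n"
  by (auto simp: CYX_def)

text \<open>Additive induction: a property of polynomials that is stable under sums need only be checked on
  the terms.\<close>

lemma CYX_induct [consumes 1, case_names zero single add]:
  assumes "F \<in> CYX n" "P 0"
    "\<And>a c. a \<in> monomials n \<Longrightarrow> c \<in> CX 1 \<Longrightarrow> P (Poly_Mapping.single a c)"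
    "\<And>F G. F \<in> CYX n \<Longrightarrow> G \<in> CYX n \<Longrightarrow> P F \<Longrightarrow> P G \<Longrightarrow> P (F + G)"
  shows "P F"
proof -
  have "(\<Sum>a\<in>Poly_Mapping.keys F. Poly_Mapping.single a (Poly_Mapping.lookup F a)) \<in> {F \<in> CYX n. P F}"
  proof (intro sum_mem)
    fix a assume "a \<in> Poly_Mapping.keys F"
    then have "a \<in> monomials n" "Poly_Mapping.lookup F a \<in> CX 1"
      using assms(1) CYX_coeff CYX_key by blast+
    then show "Poly_Mapping.single a (Poly_Mapping.lookup F a) \<in> {F \<in> CYX n. P F}" using assms(3) by simp
  qed (use assms(2,4) CYX_closed(1,3) in auto)
  then show ?thesis by (simp flip: poly_mapping_eq_sum)
qed

section \<open>Homogeneous elements\<close>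

lemma homogeneous_zero [simp]: "homogeneous d 0"
  by (simp add: homogeneous_def)

lemma homogeneous_add: "homogeneous d f \<Longrightarrow> homogeneous d g \<Longrightarrow> homogeneous d (f + g)"
  unfolding homogeneous_def using keys_add[of f g] by blast

lemma homogeneous_uminus: "homogeneous d f \<Longrightarrow> homogeneous d (- f)"
  unfolding homogeneous_def by (auto simp: in_keys_iff)

lemma homogeneous_single [simp]: "homogeneous d (Poly_Mapping.single a c) \<longleftrightarrow> c = 0 \<or> expo_deg a = d"
  by (auto simp: homogeneous_def)

lemma homogeneous_one [simp]: "homogeneous d 1 \<longleftrightarrow> d = 0"
  by (auto simp: homogeneous_def)

lemma homogeneous_mult:
  fixes f g :: "'c::comm_ring_1 mpoly"
  shows "homogeneous d f \<Longrightarrow> homogeneous e g \<Longrightarrow> homogeneous (d + e) (f * g)"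
  unfolding homogeneous_def using keys_mult[of f g] by fastforce

lemma bihomogeneous_zero [simp]: "bihomogeneous de 0"
  by (simp add: bihomogeneous_def)

lemma bihomogeneous_coeff: "bihomogeneous de F \<Longrightarrow> homogeneous (fst de) (Poly_Mapping.lookup F a)"
  unfolding bihomogeneous_def by (cases "a \<in> Poly_Mapping.keys F") (auto simp: in_keys_iff)

lemma bihomogeneous_add: "bihomogeneous de F \<Longrightarrow> bihomogeneous de G \<Longrightarrow> bihomogeneous de (F + G)"
  using bihomogeneous_coeff[of de F] bihomogeneous_coeff[of de G]
  unfolding bihomogeneous_def[of de "F + G"]
  by (auto simp: bihomogeneous_def lookup_add intro: homogeneous_add)

lemma bihomogeneous_uminus: "bihomogeneous de F \<Longrightarrow> bihomogeneous de (- F)"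
  using bihomogeneous_coeff[of de F] unfolding bihomogeneous_def[of de "- F"]
  by (auto simp: bihomogeneous_def intro: homogeneous_uminus)

lemma bihomogeneous_single:
  "homogeneous e c \<Longrightarrow> expo_deg a = d \<Longrightarrow> bihomogeneous (e, d) (Poly_Mapping.single a c)"
  by (auto simp: bihomogeneous_def lookup_single when_def)

lemma bihomogeneous_mult:
  assumes "bihomogeneous de F" "bihomogeneous de' G"
  shows "bihomogeneous (de + de') (F * G)"
proof -
  have "F * G \<in> {H. bihomogeneous (de + de') H}"
    unfolding poly_mapping_mult_eq_sum[of F G]
  proof (intro sum_mem)
    fix a b assume "a \<in> Poly_Mapping.keys F" "b \<in> Poly_Mapping.keys G"
    then have "expo_deg (a + b) = snd de + snd de'"
      "homogeneous (fst de + fst de') (Poly_Mapping.lookup F a * Poly_Mapping.lookup G b)"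
      using assms by (auto simp: bihomogeneous_def homogeneous_def[of "snd _"] intro: homogeneous_mult)
    then show "Poly_Mapping.single (a + b) (Poly_Mapping.lookup F a * Poly_Mapping.lookup G b) \<in> {H. bihomogeneous (de + de') H}"
      unfolding plus_prod_def mem_Collect_eq by (intro bihomogeneous_single)
  qed (auto intro: bihomogeneous_add)
  then show ?thesis by simp
qed

section \<open>Graded rings and their homogeneous localizations\<close>

text \<open>The common part of \<open>P\<^sup>n\<close> and \<open>P\<^sup>1 \<times> P\<^sup>n\<close>, which differ in their monoid of degrees: what the
  calculations with homogeneous fractions use.\<close>

locale graded_space =
  fixes S :: "('a::idom, 'd::comm_monoid_add) proj_space" and C :: "'a set"
  assumes coord: "coord_ring S = ring_of C" and C: "is_subring C"
    and piece_C: "piece S d \<subseteq> C"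
    and piece_zero: "0 \<in> piece S d"
    and piece_add: "f \<in> piece S d \<Longrightarrow> g \<in> piece S d \<Longrightarrow> f + g \<in> piece S d"
    and piece_uminus: "f \<in> piece S d \<Longrightarrow> - f \<in> piece S d"
    and piece_mult: "f \<in> piece S d \<Longrightarrow> g \<in> piece S e \<Longrightarrow> f * g \<in> piece S (d + e)"
    and piece_one: "1 \<in> piece S 0"
begin

abbreviation local_carrier :: "'a set \<Rightarrow> 'a fract set"
  where "local_carrier P \<equiv> {Fract f g | f g d. f \<in> piece S d \<and> g \<in> piece S d \<and> g \<notin> P}"

abbreviation stalk :: "'a set \<Rightarrow> 'a set \<Rightarrow> 'a fract set"
  where "stalk I P \<equiv> {Fract f g | f g d. f \<in> I \<and> f \<in> piece S d \<and> g \<in> piece S d \<and> g \<notin> P}"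

lemma local_ring_eq: "local_ring S P = ring_of (local_carrier P)"
  by (simp add: local_ring_def ring_of_def)

lemma local_carrierI: "f \<in> piece S d \<Longrightarrow> g \<in> piece S d \<Longrightarrow> g \<notin> P \<Longrightarrow> Fract f g \<in> local_carrier P"
  by blast

lemma stalkI: "f \<in> I \<Longrightarrow> f \<in> piece S d \<Longrightarrow> g \<in> piece S d \<Longrightarrow> g \<notin> P \<Longrightarrow> Fract f g \<in> stalk I P"
  by blast

lemma piece_diff: "f \<in> piece S d \<Longrightarrow> g \<in> piece S d \<Longrightarrow> f - g \<in> piece S d"
  using piece_add piece_uminus by (metis diff_conv_add_uminus)

lemma prime_closed:
  assumes "primeideal P (coord_ring S)"
  shows "1 \<notin> P" "0 \<in> P" "f \<in> piece S d \<Longrightarrow> g \<in> piece S e \<Longrightarrow> f \<notin> P \<Longrightarrow> g \<notin> P \<Longrightarrow> f * g \<notin> P"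
    "ideal P (ring_of C)" "f \<in> C \<Longrightarrow> g \<in> C \<Longrightarrow> f * g \<in> P \<Longrightarrow> f \<in> P \<or> g \<in> P"
proof -
  have *: "ideal P (ring_of C)" "1 \<notin> P" "\<And>x y. x \<in> C \<Longrightarrow> y \<in> C \<Longrightarrow> x * y \<in> P \<Longrightarrow> x \<in> P \<or> y \<in> P"
    using assms[unfolded coord primeideal_ring_of_iff[OF C]] by auto
  show "ideal P (ring_of C)" "1 \<notin> P" by fact+
  show "0 \<in> P" by (rule ideal_closed(1)[OF C *(1)])
  show "f \<in> C \<Longrightarrow> g \<in> C \<Longrightarrow> f * g \<in> P \<Longrightarrow> f \<in> P \<or> g \<in> P" by (rule *(3))
  assume "f \<in> piece S d" "g \<in> piece S e" "f \<notin> P" "g \<notin> P"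
  then show "f * g \<notin> P" using *(3)[of f g] piece_C by blast
qed

text \<open>Membership of a fraction in the stalk of \<open>I\<close> means that some representative of it has its numerator in
  \<open>I\<close>. For a given representative this becomes a homogeneous multiplier outside \<open>P\<close>.\<close>

lemma stalk_mem_iff:
  assumes P: "primeideal P (coord_ring S)" and I: "ideal I (ring_of C)"
    and fg: "f \<in> piece S d" "g \<in> piece S d" "g \<notin> P"
  shows "Fract f g \<in> stalk I P \<longleftrightarrow> (\<exists>e. \<exists>h\<in>piece S e. h \<notin> P \<and> h * f \<in> I)"
proof
  assume "Fract f g \<in> stalk I P"
  then obtain f' g' e where *: "Fract f g = Fract f' g'" "f' \<in> I" "g' \<in> piece S e" "g' \<notin> P" by auto
  have "g \<noteq> 0" "g' \<noteq> 0" using fg * prime_closed(2)[OF P] by auto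
  then have "f * g' = f' * g" using *(1) by (simp add: eq_fract)
  moreover have "f' * g \<in> I" using * fg piece_C ideal_closed(4)[OF C I] by blast
  ultimately show "\<exists>e. \<exists>h\<in>piece S e. h \<notin> P \<and> h * f \<in> I" using * by (metis mult.commute)
next
  assume "\<exists>e. \<exists>h\<in>piece S e. h \<notin> P \<and> h * f \<in> I"
  then obtain e h where h: "h \<in> piece S e" "h \<notin> P" "h * f \<in> I" by blast
  have "h \<noteq> 0" "g \<noteq> 0" using fg h prime_closed(2)[OF P] by auto
  then have "Fract f g = Fract (h * f) (h * g)" by (simp add: eq_fract)
  moreover have "h * g \<notin> P" using prime_closed(3)[OF P] h fg by blast
  ultimately show "Fract f g \<in> stalk I P" using h piece_mult fg by blast
qed

lemma local_subring:
  assumes P: "primeideal P (coord_ring S)"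
  shows "is_subring (local_carrier P)"
  unfolding is_subring_def
proof (intro conjI ballI)
  show "1 \<in> local_carrier P"
    using local_carrierI[OF piece_one piece_one prime_closed(1)[OF P]] by (simp only: One_fract_def)
  fix x assume "x \<in> local_carrier P"
  then obtain f g d where x: "x = Fract f g" "f \<in> piece S d" "g \<in> piece S d" "g \<notin> P" by auto
  show "- x \<in> local_carrier P" using local_carrierI[OF piece_uminus[OF x(2)] x(3,4)] x(1) by (simp only: minus_fract)
  fix y assume "y \<in> local_carrier P"
  then obtain f' g' d' where y: "y = Fract f' g'" "f' \<in> piece S d'" "g' \<in> piece S d'" "g' \<notin> P" by auto
  have nz: "g \<noteq> 0" "g' \<noteq> 0" using x y prime_closed(2)[OF P] by auto
  have gg: "g * g' \<in> piece S (d + d')" "g * g' \<notin> P" using x y piece_mult prime_closed(3)[OF P] by blast+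
  have "x + y = Fract (f * g' + f' * g) (g * g')" using x y nz by simp
  moreover have "f * g' + f' * g \<in> piece S (d + d')"
    using x y piece_mult[of f d g' d'] piece_mult[of f' d' g d] piece_add by (simp add: add.commute)
  ultimately show "x + y \<in> local_carrier P" by (simp only:) (rule local_carrierI[OF _ gg])
  have "x * y = Fract (f * f') (g * g')" using x y by simp
  then show "x * y \<in> local_carrier P" using local_carrierI[OF piece_mult[OF x(2) y(2)] gg] by (simp only:)
qed

lemma stalk_subset: "stalk I P \<subseteq> local_carrier P"
  by blast

lemma stalk_ideal:
  assumes P: "primeideal P (coord_ring S)" and I: "ideal I (ring_of C)"
  shows "ideal (stalk I P) (ring_of (local_carrier P))"
  unfolding ideal_ring_of_iff[OF local_subring[OF P]]
proof (intro conjI ballI)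
  note Ic = ideal_closed[OF C I]
  show "stalk I P \<subseteq> local_carrier P" by blast
  show "0 \<in> stalk I P"
    using stalkI[OF Ic(1) piece_zero piece_one prime_closed(1)[OF P]] by (simp only: Zero_fract_def)
  fix x c assume "x \<in> stalk I P"
  then obtain f g d where x: "x = Fract f g" "f \<in> I" "f \<in> piece S d" "g \<in> piece S d" "g \<notin> P" by auto
  {
    fix y assume "y \<in> stalk I P"
    then obtain f' g' d' where y: "y = Fract f' g'" "f' \<in> I" "f' \<in> piece S d'" "g' \<in> piece S d'" "g' \<notin> P" by auto
    have nz: "g \<noteq> 0" "g' \<noteq> 0" using x y prime_closed(2)[OF P] by auto
    have gg: "g * g' \<in> piece S (d + d')" "g * g' \<notin> P" using x y piece_mult prime_closed(3)[OF P] by blast+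
    have "x + y = Fract (f * g' + f' * g) (g * g')" using x y nz by simp
    moreover have "f * g' + f' * g \<in> piece S (d + d')"
      using x y piece_mult[of f d g' d'] piece_mult[of f' d' g d] piece_add by (simp add: add.commute)
    moreover have "f * g' + f' * g \<in> I" using Ic(2,4) x y piece_C by blast
    ultimately show "x + y \<in> stalk I P" by (simp only:) (rule stalkI[OF _ _ gg])
  }
  assume "c \<in> local_carrier P"
  then obtain f' g' d' where y: "c = Fract f' g'" "f' \<in> piece S d'" "g' \<in> piece S d'" "g' \<notin> P" by auto
  have "c * x = Fract (f' * f) (g' * g)" using x y by simp
  moreover have "g' * g \<in> piece S (d' + d)" "g' * g \<notin> P" "f' * f \<in> piece S (d' + d)"
    using x y piece_mult prime_closed(3)[OF P] by blast+
  moreover have "f' * f \<in> I" using Ic(3) x y piece_C by blast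
  ultimately show "c * x \<in> stalk I P" by (simp only:) (rule stalkI)
qed

end

lemma graded_proj_n: "graded_space (proj_n n) (CX n)"
  by unfold_locales
     (auto simp: proj_n_def Kx_eq CX_closed homogeneous_add homogeneous_uminus homogeneous_mult)

lemma graded_proj_1_n: "graded_space (proj_1_n n) (CYX n)"
proof unfold_locales
  show "1 \<in> piece (proj_1_n n) (0 :: nat \<times> nat)"
    using CYX_closed(2)[of n] bihomogeneous_single[of 0 1 0 0]
    by (auto simp: proj_1_n_def Kyx_eq zero_prod_def simp flip: single_one)
qed (auto simp: proj_1_n_def Kyx_eq CYX_closed bihomogeneous_add bihomogeneous_uminus bihomogeneous_mult)

section \<open>A flatness criterion\<close>

definition tensor_generators ::
    "('a, 'x) ring_scheme \<Rightarrow> ('a, 'm, 'y) module_scheme \<Rightarrow> ('a, 'n, 'z) module_scheme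
      \<Rightarrow> ('m \<times> 'n \<Rightarrow>\<^sub>0 int) set"
  where "tensor_generators R M N =
      ({frag_of (u \<oplus>\<^bsub>M\<^esub> u', v) - frag_of (u, v) - frag_of (u', v) | u u' v.
          u \<in> carrier M \<and> u' \<in> carrier M \<and> v \<in> carrier N} \<union>
       {frag_of (u, v \<oplus>\<^bsub>N\<^esub> v') - frag_of (u, v) - frag_of (u, v') | u v v'.
          u \<in> carrier M \<and> v \<in> carrier N \<and> v' \<in> carrier N} \<union>
       {frag_of (c \<odot>\<^bsub>M\<^esub> u, v) - frag_of (u, c \<odot>\<^bsub>N\<^esub> v) | c u v.
          c \<in> carrier R \<and> u \<in> carrier M \<and> v \<in> carrier N})"

lemma tensor_relations_eq:
  "tensor_relations R M N = generate (free_Abelian_group (carrier M \<times> carrier N)) (tensor_generators R M N)"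
  by (simp add: tensor_relations_def tensor_generators_def)

lemma keys_diff_frag_of:
  assumes "x \<in> S" "y \<in> S"
  shows "Poly_Mapping.keys (frag_of x - frag_of y) \<subseteq> S"
  using keys_diff[of "frag_of x" "frag_of y"] assms by auto

lemma keys_diff_frag_of3:
  assumes "x \<in> S" "y \<in> S" "z \<in> S"
  shows "Poly_Mapping.keys (frag_of x - frag_of y - frag_of z) \<subseteq> S"
  using keys_diff[of "frag_of x - frag_of y" "frag_of z"] keys_diff_frag_of[OF assms(1,2)] assms by auto

lemma tensor_generators_carrier:
  assumes "module R M" "module R N"
  shows "tensor_generators R M N \<subseteq> carrier (free_Abelian_group (carrier M \<times> carrier N))"
proof -
  interpret M: module R M by fact
  interpret N: module R N by fact
  show ?thesis unfolding tensor_generators_def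
    by (safe; unfold carrier_free_Abelian_group_iff; (rule keys_diff_frag_of3 | rule keys_diff_frag_of); simp)
qed

lemma tensor_relations_closed:
  assumes "module R M" "module R N"
  shows "0 \<in> tensor_relations R M N"
    "s \<in> tensor_relations R M N \<Longrightarrow> t \<in> tensor_relations R M N \<Longrightarrow> s + t \<in> tensor_relations R M N"
    "s \<in> tensor_relations R M N \<Longrightarrow> - s \<in> tensor_relations R M N"
    "s \<in> tensor_relations R M N \<Longrightarrow> t \<in> tensor_relations R M N \<Longrightarrow> s - t \<in> tensor_relations R M N"
    "tensor_generators R M N \<subseteq> tensor_relations R M N"
    "tensor_relations R M N \<subseteq> carrier (free_Abelian_group (carrier M \<times> carrier N))"
proof -
  let ?G = "free_Abelian_group (carrier M \<times> carrier N)"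
  interpret G: group ?G by simp
  have sub: "tensor_generators R M N \<subseteq> carrier ?G" by (rule tensor_generators_carrier) fact+
  show in_G: "tensor_relations R M N \<subseteq> carrier ?G"
    unfolding tensor_relations_eq by (rule G.generate_incl[OF sub])
  show "0 \<in> tensor_relations R M N"
    using generate.one[of ?G "tensor_generators R M N"] by (simp add: tensor_relations_eq)
  show plus: "s + t \<in> tensor_relations R M N"
    if "s \<in> tensor_relations R M N" "t \<in> tensor_relations R M N" for s t
    using generate.eng[of s ?G "tensor_generators R M N" t] that by (simp add: tensor_relations_eq)
  show minus: "- s \<in> tensor_relations R M N" if "s \<in> tensor_relations R M N" for s
  proof -
    have "inv\<^bsub>?G\<^esub> s \<in> tensor_relations R M N"
      using G.generate_m_inv_closed[OF sub] that by (simp add: tensor_relations_eq)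
    moreover have "s \<in> carrier ?G" using in_G that by blast
    ultimately show ?thesis by simp
  qed
  show "s - t \<in> tensor_relations R M N"
    if "s \<in> tensor_relations R M N" "t \<in> tensor_relations R M N"
    using plus[OF that(1) minus[OF that(2)]] by simp
  show "tensor_generators R M N \<subseteq> tensor_relations R M N"
    unfolding tensor_relations_eq by (auto intro: generate.incl)
qed

text \<open>A map that respects the finitely many instances of additivity and of linearity in the first
  argument that a given relation uses is enough to contract that relation to zero.\<close>

lemma tensor_relation_contract:
  assumes M: "module R M" and N: "module R N" and t: "t \<in> tensor_relations R M N"
  shows "\<exists>T1 T2. finite T1 \<and> T1 \<subseteq> carrier M \<times> carrier M \<and> finite T2 \<and> T2 \<subseteq> carrier R \<times> carrier M \<and>
    (\<forall>b h. b \<in> carrier M \<rightarrow> carrier R \<longrightarrow>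
      (\<forall>(u, u')\<in>T1. b (u \<oplus>\<^bsub>M\<^esub> u') = b u \<oplus>\<^bsub>R\<^esub> b u') \<longrightarrow>
      (\<forall>(c, u)\<in>T2. b (c \<odot>\<^bsub>M\<^esub> u) = c \<otimes>\<^bsub>R\<^esub> b u) \<longrightarrow>
      h \<in> hom (free_Abelian_group (carrier M \<times> carrier N)) (add_monoid N) \<longrightarrow>
      (\<forall>u\<in>carrier M. \<forall>v\<in>carrier N. h (frag_of (u, v)) = b u \<odot>\<^bsub>N\<^esub> v) \<longrightarrow> h t = \<zero>\<^bsub>N\<^esub>)"
    (is "?P t")
proof -
  let ?G = "free_Abelian_group (carrier M \<times> carrier N)"
  interpret M: module R M by fact
  interpret N: module R N by fact
  interpret G: group ?G by simp
  let ?ok = "\<lambda>T1 T2 b h. b \<in> carrier M \<rightarrow> carrier R \<and>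
      (\<forall>(u, u')\<in>T1. b (u \<oplus>\<^bsub>M\<^esub> u') = b u \<oplus>\<^bsub>R\<^esub> b u') \<and>
      (\<forall>(c, u)\<in>T2. b (c \<odot>\<^bsub>M\<^esub> u) = c \<otimes>\<^bsub>R\<^esub> b u) \<and>
      h \<in> hom ?G (add_monoid N) \<and>
      (\<forall>u\<in>carrier M. \<forall>v\<in>carrier N. h (frag_of (u, v)) = b u \<odot>\<^bsub>N\<^esub> v)"
  have hom: "h (x + y) = h x \<oplus>\<^bsub>N\<^esub> h y" "h 0 = \<zero>\<^bsub>N\<^esub>" "h (- x) = \<ominus>\<^bsub>N\<^esub> h x" "h (x - y) = h x \<ominus>\<^bsub>N\<^esub> h y"
    if "h \<in> hom ?G (add_monoid N)" "x \<in> carrier ?G" "y \<in> carrier ?G" for h x y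
  proof -
    interpret h: group_hom ?G "add_monoid N" h
      using that(1) N.a_group by (simp add: group_hom_def group_hom_axioms_def)
    show "h (x + y) = h x \<oplus>\<^bsub>N\<^esub> h y" using h.hom_mult[OF that(2,3)] by simp
    show "h 0 = \<zero>\<^bsub>N\<^esub>" using h.hom_one by simp
    have inv: "h (- z) = \<ominus>\<^bsub>N\<^esub> h z" if "z \<in> carrier ?G" for z
      using h.hom_inv[OF that] that by (simp add: a_inv_def)
    show "h (- x) = \<ominus>\<^bsub>N\<^esub> h x" by (rule inv[OF that(2)])
    have "- y \<in> carrier ?G" using that(3) by simp
    then have "h (x + - y) = h x \<oplus>\<^bsub>N\<^esub> h (- y)" using h.hom_mult[OF that(2), of "- y"] by simp
    then show "h (x - y) = h x \<ominus>\<^bsub>N\<^esub> h y" using inv[OF that(3)] by (simp add: a_minus_def)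
  qed
  have frag: "frag_of (u, v) \<in> carrier ?G" if "u \<in> carrier M" "v \<in> carrier N" for u v
    using that by simp
  have two: "h (frag_of x - frag_of y) = h (frag_of x) \<ominus>\<^bsub>N\<^esub> h (frag_of y)"
    "h (frag_of x - frag_of y - frag_of z) = h (frag_of x) \<ominus>\<^bsub>N\<^esub> h (frag_of y) \<ominus>\<^bsub>N\<^esub> h (frag_of z)"
    if "h \<in> hom ?G (add_monoid N)" "x \<in> carrier M \<times> carrier N" "y \<in> carrier M \<times> carrier N" "z \<in> carrier M \<times> carrier N" for h x y z
    using that hom(4)[OF that(1), of "frag_of x" "frag_of y"] hom(4)[OF that(1), of "frag_of x - frag_of y" "frag_of z"]
      keys_diff_frag_of[OF that(2,3)] by auto
  have gen: "\<exists>T1 T2. finite T1 \<and> T1 \<subseteq> carrier M \<times> carrier M \<and> finite T2 \<and> T2 \<subseteq> carrier R \<times> carrier M \<and>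
      (\<forall>b h. ?ok T1 T2 b h \<longrightarrow> h g = \<zero>\<^bsub>N\<^esub>)" if g: "g \<in> tensor_generators R M N" for g
  proof -
    consider
      (left) u u' v where "g = frag_of (u \<oplus>\<^bsub>M\<^esub> u', v) - frag_of (u, v) - frag_of (u', v)"
          "u \<in> carrier M" "u' \<in> carrier M" "v \<in> carrier N"
      | (right) u v v' where "g = frag_of (u, v \<oplus>\<^bsub>N\<^esub> v') - frag_of (u, v) - frag_of (u, v')"
          "u \<in> carrier M" "v \<in> carrier N" "v' \<in> carrier N"
      | (scal) c u v where "g = frag_of (c \<odot>\<^bsub>M\<^esub> u, v) - frag_of (u, c \<odot>\<^bsub>N\<^esub> v)"
          "c \<in> carrier R" "u \<in> carrier M" "v \<in> carrier N"
      using g unfolding tensor_generators_def by blast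
    then show ?thesis
    proof cases
      case left
      have "h g = \<zero>\<^bsub>N\<^esub>" if ok: "?ok {(u, u')} {} b h" for b h
      proof -
        have b: "b u \<in> carrier R" "b u' \<in> carrier R" using ok left by auto
        have "h g = (b u \<oplus>\<^bsub>R\<^esub> b u') \<odot>\<^bsub>N\<^esub> v \<ominus>\<^bsub>N\<^esub> b u \<odot>\<^bsub>N\<^esub> v \<ominus>\<^bsub>N\<^esub> b u' \<odot>\<^bsub>N\<^esub> v"
          using ok left by (simp add: two(2))
        also have "\<dots> = \<zero>\<^bsub>N\<^esub>"
          using b left by (simp add: N.smult_l_distr a_minus_def N.a_ac N.r_neg N.r_neg2 N.r_neg1 N.minus_add)
        finally show ?thesis .
      qed
      then show ?thesis using left by (intro exI[of _ "{(u, u')}"] exI[of _ "{}"]) auto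
    next
      case right
      have "h g = \<zero>\<^bsub>N\<^esub>" if ok: "?ok {} {} b h" for b h
      proof -
        have b: "b u \<in> carrier R" using ok right by auto
        have "h g = b u \<odot>\<^bsub>N\<^esub> (v \<oplus>\<^bsub>N\<^esub> v') \<ominus>\<^bsub>N\<^esub> b u \<odot>\<^bsub>N\<^esub> v \<ominus>\<^bsub>N\<^esub> b u \<odot>\<^bsub>N\<^esub> v'"
          using ok right by (simp add: two(2))
        also have "\<dots> = \<zero>\<^bsub>N\<^esub>"
          using b right by (simp add: N.smult_r_distr a_minus_def N.a_ac N.r_neg N.r_neg2 N.r_neg1 N.minus_add)
        finally show ?thesis .
      qed
      then show ?thesis by (intro exI[of _ "{}"]) auto
    next
      case scal
      have "h g = \<zero>\<^bsub>N\<^esub>" if ok: "?ok {} {(c, u)} b h" for b h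
      proof -
        have b: "b u \<in> carrier R" using ok scal by auto
        have "h g = (c \<otimes>\<^bsub>R\<^esub> b u) \<odot>\<^bsub>N\<^esub> v \<ominus>\<^bsub>N\<^esub> b u \<odot>\<^bsub>N\<^esub> (c \<odot>\<^bsub>N\<^esub> v)"
          using two(1)[of h "(c \<odot>\<^bsub>M\<^esub> u, v)" "(u, c \<odot>\<^bsub>N\<^esub> v)" "(u, v)"] ok scal by simp
        also have "\<dots> = \<zero>\<^bsub>N\<^esub>"
          using b scal by (simp add: N.smult_assoc1[symmetric] M.m_comm a_minus_def N.r_neg)
        finally show ?thesis .
      qed
      then show ?thesis using scal by (intro exI[of _ "{}"] exI[of _ "{(c, u)}"]) auto
    qed
  qed
  define ok where "ok T1 T2 b h \<longleftrightarrow> ?ok T1 T2 b h" for T1 T2 b h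
  define dead where "dead x T1 T2 \<longleftrightarrow> finite T1 \<and> T1 \<subseteq> carrier M \<times> carrier M \<and> finite T2 \<and>
    T2 \<subseteq> carrier R \<times> carrier M \<and> (\<forall>b h. ok T1 T2 b h \<longrightarrow> h x = \<zero>\<^bsub>N\<^esub>)" for x T1 T2
  have dead_gen: "\<exists>T1 T2. dead g T1 T2" if "g \<in> tensor_generators R M N" for g
    using gen[OF that] unfolding dead_def ok_def .
  have ok_hom: "h \<in> hom ?G (add_monoid N)" if "ok T1 T2 b h" for T1 T2 b h
    using that unfolding ok_def by blast
  have ok_Un: "ok T1 T2 b h" "ok U1 U2 b h" if "ok (T1 \<union> U1) (T2 \<union> U2) b h" for T1 T2 U1 U2 b h
    using that unfolding ok_def by blast+
  have sub: "tensor_generators R M N \<subseteq> carrier ?G" by (rule tensor_generators_carrier) fact+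
  have in_G: "x \<in> carrier ?G" if "x \<in> generate ?G (tensor_generators R M N)" for x
    using G.generate_incl[OF sub] that by blast
  have "\<exists>T1 T2. dead t T1 T2"
    using t unfolding tensor_relations_eq
  proof (induction t rule: generate.induct)
    case one
    have "dead \<one>\<^bsub>?G\<^esub> {} {}"
      unfolding dead_def using hom(2)[OF ok_hom, of _ _ _ _ 0 0] by simp
    then show ?case by blast
  next
    case (incl g)
    then show ?case by (rule dead_gen)
  next
    case (inv g)
    then obtain T1 T2 where T: "dead g T1 T2" using dead_gen by blast
    have g: "g \<in> carrier ?G" using inv sub by blast
    have "h (inv\<^bsub>?G\<^esub> g) = \<zero>\<^bsub>N\<^esub>" if ok: "ok T1 T2 b h" for b h
    proof -
      have "h g = \<zero>\<^bsub>N\<^esub>" using T ok unfolding dead_def by blast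
      then have "h (- g) = \<zero>\<^bsub>N\<^esub>" using hom(3)[OF ok_hom[OF ok] g g] by simp
      then show ?thesis using g by simp
    qed
    then have "dead (inv\<^bsub>?G\<^esub> g) T1 T2" using T unfolding dead_def by blast
    then show ?case by blast
  next
    case (eng x y)
    then obtain T1 T2 U1 U2 where T: "dead x T1 T2" and U: "dead y U1 U2" by blast
    have "h (x \<otimes>\<^bsub>?G\<^esub> y) = \<zero>\<^bsub>N\<^esub>" if ok: "ok (T1 \<union> U1) (T2 \<union> U2) b h" for b h
    proof -
      have "h x = \<zero>\<^bsub>N\<^esub>" "h y = \<zero>\<^bsub>N\<^esub>" using T U ok_Un[OF ok] unfolding dead_def by blast+
      then show ?thesis using hom(1)[OF ok_hom[OF ok] in_G[OF eng(1)] in_G[OF eng(2)]] by simp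
    qed
    moreover have "finite (T1 \<union> U1)" "T1 \<union> U1 \<subseteq> carrier M \<times> carrier M" "finite (T2 \<union> U2)"
      "T2 \<union> U2 \<subseteq> carrier R \<times> carrier M" using T U unfolding dead_def by auto
    ultimately have "dead (x \<otimes>\<^bsub>?G\<^esub> y) (T1 \<union> U1) (T2 \<union> U2)" unfolding dead_def by blast
    then show ?case by blast
  qed
  then obtain T1 T2 where "dead t T1 T2" by blast
  then show ?thesis unfolding dead_def ok_def by (intro exI[of _ T1] exI[of _ T2]) blast
qed

lemma frag_hom_exists:
  assumes L: "module R L" and g: "g \<in> A \<rightarrow> carrier R"
  shows "\<exists>h. h \<in> hom (free_Abelian_group (A \<times> carrier L)) (add_monoid L) \<and>
      (\<forall>u\<in>A. \<forall>v\<in>carrier L. h (frag_of (u, v)) = g u \<odot>\<^bsub>L\<^esub> v)"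
proof -
  interpret L: module R L by fact
  let ?k = "\<lambda>x. g (fst x) \<odot>\<^bsub>L\<^esub> snd x"
  have im: "?k ` (A \<times> carrier L) \<subseteq> carrier (add_monoid L)" using g by (auto dest: funcset_mem)
  obtain h where "h \<in> hom (free_Abelian_group (A \<times> carrier L)) (add_monoid L)"
      "\<And>x. x \<in> A \<times> carrier L \<Longrightarrow> h (frag_of x) = ?k x"
    using comm_group.free_Abelian_group_universal[OF L.a_comm_group im] by blast
  then show ?thesis by (intro exI[of _ h]) auto
qed

lemma frag_hom_diff:
  assumes "module R L" "k \<in> hom (free_Abelian_group S) (add_monoid L)" "Poly_Mapping.keys x \<subseteq> S" "Poly_Mapping.keys y \<subseteq> S"
  shows "k (x - y) = k x \<ominus>\<^bsub>L\<^esub> k y" "k 0 = \<zero>\<^bsub>L\<^esub>" "k x \<in> carrier L"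
proof -
  interpret L: module R L by fact
  interpret k: group_hom "free_Abelian_group S" "add_monoid L" k
    using assms(2) L.a_group by (simp add: group_hom_def group_hom_axioms_def)
  show "k 0 = \<zero>\<^bsub>L\<^esub>" using k.hom_one by simp
  show "k x \<in> carrier L" using k.hom_closed[of x] assms(3) by simp
  have "k (x + - y) = k x \<oplus>\<^bsub>L\<^esub> k (- y)" using k.hom_mult[of x "- y"] assms(3,4) by simp
  moreover have "k (- y) = \<ominus>\<^bsub>L\<^esub> k y" using k.hom_inv[of y] assms(4) by (simp add: a_inv_def)
  ultimately show "k (x - y) = k x \<ominus>\<^bsub>L\<^esub> k y" by (simp add: a_minus_def)
qed

text \<open>\<open>M\<close> is flat if every finite amount of linear algebra in \<open>M\<close> takes place in a finitely generated
  free module: finitely many elements have coordinates, with respect to finitely many vectors, that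
  obey any given finitely many instances of additivity and linearity. Indeed, if \<open>t\<close> dies in
  \<open>M \<otimes> N\<close>, choose coordinates for the elements of \<open>M\<close> in \<open>t\<close> that respect the relations which kill
  it. The coordinates of \<open>t\<close> then vanish in \<open>N\<close>, so they vanish in \<open>N'\<close>, and \<open>t\<close> is recovered from
  them.\<close>

lemma flat_criterion:
  fixes R :: "('a, 'x) ring_scheme" and M :: "('a, 'm, 'y) module_scheme"
  assumes M: "module R M"
    and crit: "\<And>U T1 T2. finite U \<Longrightarrow> U \<subseteq> carrier M \<Longrightarrow> finite T1 \<Longrightarrow> T1 \<subseteq> carrier M \<times> carrier M \<Longrightarrow>
      finite T2 \<Longrightarrow> T2 \<subseteq> carrier R \<times> carrier M \<Longrightarrow>
      \<exists>(B :: 'i set) b m. finite B \<and> (\<forall>j\<in>B. b j \<in> carrier M \<rightarrow> carrier R) \<and> m \<in> B \<rightarrow> carrier M \<and>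
        (\<forall>j\<in>B. \<forall>(u, u')\<in>T1. b j (u \<oplus>\<^bsub>M\<^esub> u') = b j u \<oplus>\<^bsub>R\<^esub> b j u') \<and>
        (\<forall>j\<in>B. \<forall>(c, u)\<in>T2. b j (c \<odot>\<^bsub>M\<^esub> u) = c \<otimes>\<^bsub>R\<^esub> b j u) \<and>
        (\<forall>u\<in>U. u = (\<Oplus>\<^bsub>M\<^esub>j\<in>B. b j u \<odot>\<^bsub>M\<^esub> m j))"
  shows "flat_module TYPE('u) TYPE('v) R M"
  unfolding flat_module_def
proof (intro conjI allI impI ballI M)
  fix N' :: "('a, 'u) module" and N :: "('a, 'v) module" and f t
  assume *: "module R N' \<and> module R N \<and> f \<in> linear_maps R N' N \<and> inj_on f (carrier N')"
    and t: "t \<in> carrier (free_Abelian_group (carrier M \<times> carrier N'))"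
    and ft: "frag_extend (\<lambda>(u, v). frag_of (u, f v)) t \<in> tensor_relations R M N"
  let ?F = "frag_extend (\<lambda>(u, v). frag_of (u, f v)) :: ('m \<times> 'u \<Rightarrow>\<^sub>0 int) \<Rightarrow> ('m \<times> 'v \<Rightarrow>\<^sub>0 int)"
  let ?G' = "free_Abelian_group (carrier M \<times> carrier N')" and ?G = "free_Abelian_group (carrier M \<times> carrier N)"
  interpret M: module R M by fact
  interpret N': module R N' using * by blast
  interpret N: module R N using * by blast
  have mN: "module R N" "module R N'" using * by auto
  have f_hom: "f \<in> hom (add_monoid N') (add_monoid N)"
    and f_smult: "\<And>c v. c \<in> carrier R \<Longrightarrow> v \<in> carrier N' \<Longrightarrow> f (c \<odot>\<^bsub>N'\<^esub> v) = c \<odot>\<^bsub>N\<^esub> f v"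
    and f_inj: "inj_on f (carrier N')"
    using * by (auto simp: linear_maps_def)
  interpret f: group_hom "add_monoid N'" "add_monoid N" f
    using f_hom N.a_group N'.a_group by (simp add: group_hom_def group_hom_axioms_def)
  have f_in: "f v \<in> carrier N" if "v \<in> carrier N'" for v using f.hom_closed that by simp
  have f_minus: "f (v \<ominus>\<^bsub>N'\<^esub> w) = f v \<ominus>\<^bsub>N\<^esub> f w" if "v \<in> carrier N'" "w \<in> carrier N'" for v w
    using f.hom_mult[of v "\<ominus>\<^bsub>N'\<^esub> w"] f.hom_inv[of w] that by (simp add: a_minus_def a_inv_def)
  obtain T1 T2 where T: "finite T1" "T1 \<subseteq> carrier M \<times> carrier M" "finite T2" "T2 \<subseteq> carrier R \<times> carrier M"
    and kill: "\<forall>b h. b \<in> carrier M \<rightarrow> carrier R \<longrightarrow>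
      (\<forall>(u, u')\<in>T1. b (u \<oplus>\<^bsub>M\<^esub> u') = b u \<oplus>\<^bsub>R\<^esub> b u') \<longrightarrow>
      (\<forall>(c, u)\<in>T2. b (c \<odot>\<^bsub>M\<^esub> u) = c \<otimes>\<^bsub>R\<^esub> b u) \<longrightarrow>
      h \<in> hom ?G (add_monoid N) \<longrightarrow>
      (\<forall>u\<in>carrier M. \<forall>v\<in>carrier N. h (frag_of (u, v)) = b u \<odot>\<^bsub>N\<^esub> v) \<longrightarrow> h (?F t) = \<zero>\<^bsub>N\<^esub>"
    using tensor_relation_contract[OF M mN(1) ft] by (elim exE conjE) (rule that)
  let ?U = "fst ` Poly_Mapping.keys t"
  have U: "finite ?U" "?U \<subseteq> carrier M" using t by auto
  obtain B :: "'i set" and b m where fin: "finite B" and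
      b1: "\<forall>j\<in>B. b j \<in> carrier M \<rightarrow> carrier R" and m: "m \<in> B \<rightarrow> carrier M" and
      b2: "\<forall>j\<in>B. \<forall>(u, u')\<in>T1. b j (u \<oplus>\<^bsub>M\<^esub> u') = b j u \<oplus>\<^bsub>R\<^esub> b j u'" and
      b3: "\<forall>j\<in>B. \<forall>(c, u)\<in>T2. b j (c \<odot>\<^bsub>M\<^esub> u) = c \<otimes>\<^bsub>R\<^esub> b j u" and
      b4: "\<forall>u\<in>?U. u = (\<Oplus>\<^bsub>M\<^esub>j\<in>B. b j u \<odot>\<^bsub>M\<^esub> m j)"
    using crit[OF U T] by (elim exE conjE) (rule that)
  note B = fin m and b = bspec[OF b1] bspec[OF b2] bspec[OF b3] bspec[OF b4]
  have bc: "b j u \<in> carrier R" if "j \<in> B" "u \<in> carrier M" for j u using b(1) that by auto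
  have mc: "m j \<in> carrier M" if "j \<in> B" for j using B(2) that by auto
  note exh = frag_hom_exists[OF _ b(1)]
  have "\<exists>h. \<forall>j\<in>B. h j \<in> hom ?G (add_monoid N) \<and>
      (\<forall>u\<in>carrier M. \<forall>v\<in>carrier N. h j (frag_of (u, v)) = b j u \<odot>\<^bsub>N\<^esub> v)"
    by (intro bchoice ballI exh[OF mN(1)])
  then obtain h where *: "\<forall>j\<in>B. h j \<in> hom ?G (add_monoid N) \<and>
      (\<forall>u\<in>carrier M. \<forall>v\<in>carrier N. h j (frag_of (u, v)) = b j u \<odot>\<^bsub>N\<^esub> v)" by (rule exE)
  have h: "h j \<in> hom ?G (add_monoid N)"
    "u \<in> carrier M \<Longrightarrow> v \<in> carrier N \<Longrightarrow> h j (frag_of (u, v)) = b j u \<odot>\<^bsub>N\<^esub> v" if "j \<in> B" for j u v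
    using * that by auto
  have "\<exists>h. \<forall>j\<in>B. h j \<in> hom ?G' (add_monoid N') \<and>
      (\<forall>u\<in>carrier M. \<forall>v\<in>carrier N'. h j (frag_of (u, v)) = b j u \<odot>\<^bsub>N'\<^esub> v)"
    by (intro bchoice ballI exh[OF mN(2)])
  then obtain h' where *: "\<forall>j\<in>B. h' j \<in> hom ?G' (add_monoid N') \<and>
      (\<forall>u\<in>carrier M. \<forall>v\<in>carrier N'. h' j (frag_of (u, v)) = b j u \<odot>\<^bsub>N'\<^esub> v)" by (rule exE)
  have h': "h' j \<in> hom ?G' (add_monoid N')"
    "u \<in> carrier M \<Longrightarrow> v \<in> carrier N' \<Longrightarrow> h' j (frag_of (u, v)) = b j u \<odot>\<^bsub>N'\<^esub> v" if "j \<in> B" for j u v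
    using * that by auto
  note hom_diff = frag_hom_diff
  \<comment> \<open>Taking coordinates commutes with \<open>f\<close>.\<close>
  have natural: "Poly_Mapping.keys (?F s) \<subseteq> carrier M \<times> carrier N \<and> Poly_Mapping.keys s \<subseteq> carrier M \<times> carrier N' \<and> f (h' j s) = h j (?F s)"
    if "Poly_Mapping.keys s \<subseteq> carrier M \<times> carrier N'" "j \<in> B" for s j
    using that(1)
  proof (induction s rule: frag_induction)
    case zero
    have "h' j 0 = \<zero>\<^bsub>N'\<^esub>" "h j 0 = \<zero>\<^bsub>N\<^esub>" using hom_diff(2)[OF _ h'(1)[OF that(2)], where x=0 and y=0] hom_diff(2)[OF _ h(1)[OF that(2)], where x=0 and y=0] mN by auto
    then show ?case using f.hom_one by simp
  next
    case (one x)
    then show ?case using h(2)[OF that(2)] h'(2)[OF that(2)] f_smult bc[OF that(2)] f_in by auto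
  next
    case (diff x y)
    then have k: "Poly_Mapping.keys x \<subseteq> carrier M \<times> carrier N'" "Poly_Mapping.keys y \<subseteq> carrier M \<times> carrier N'"
      "Poly_Mapping.keys (?F x) \<subseteq> carrier M \<times> carrier N" "Poly_Mapping.keys (?F y) \<subseteq> carrier M \<times> carrier N" by auto
    have "f (h' j (x - y)) = f (h' j x) \<ominus>\<^bsub>N\<^esub> f (h' j y)"
      using hom_diff(1)[OF mN(2) h'(1)[OF that(2)] k(1,2)] hom_diff(3)[OF mN(2) h'(1)[OF that(2)]] k f_minus by simp
    moreover have "h j (?F (x - y)) = h j (?F x) \<ominus>\<^bsub>N\<^esub> h j (?F y)"
      using hom_diff(1)[OF mN(1) h(1)[OF that(2)] k(3,4)] by (simp add: frag_extend_diff)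
    ultimately show ?case using diff keys_diff[of x y] keys_diff[of "?F x" "?F y"] by (auto simp: frag_extend_diff)
  qed
  have keys_t: "Poly_Mapping.keys t \<subseteq> carrier M \<times> carrier N'" using t by simp
  \<comment> \<open>Injectivity of \<open>f\<close> enters here, and only on coordinates.\<close>
  have h'_t: "h' j t = \<zero>\<^bsub>N'\<^esub>" if j: "j \<in> B" for j
  proof -
    have "h j (?F t) = \<zero>\<^bsub>N\<^esub>"
      using kill[THEN spec[of _ "b j"], THEN spec[of _ "h j"], THEN mp, THEN mp, THEN mp, THEN mp, THEN mp, OF b(1-3)[OF j] h(1)[OF j]]
        h(2)[OF j] by blast
    then have "f (h' j t) = \<zero>\<^bsub>N\<^esub>" using natural[OF keys_t j] by simp
    moreover have "f \<zero>\<^bsub>N'\<^esub> = \<zero>\<^bsub>N\<^esub>" using f.hom_one by simp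
    moreover have "h' j t \<in> carrier N'" using hom_diff(3)[OF mN(2) h'(1)[OF j] keys_t keys_t] .
    ultimately show ?thesis using f_inj by (metis N'.zero_closed inj_onD)
  qed
  let ?T = "tensor_relations R M N'"
  note Tc = tensor_relations_closed[OF M mN(2)]
  have left: "frag_of (u \<oplus>\<^bsub>M\<^esub> u', v) - frag_of (u, v) - frag_of (u', v) \<in> ?T"
    if "u \<in> carrier M" "u' \<in> carrier M" "v \<in> carrier N'" for u u' v
    by (rule subsetD[OF Tc(5)], unfold tensor_generators_def, rule UnI1, rule UnI1, rule CollectI, rule exI[of _ u], rule exI[of _ u'], rule exI[of _ v], intro conjI refl that)
  have right: "frag_of (u, v \<oplus>\<^bsub>N'\<^esub> v') - frag_of (u, v) - frag_of (u, v') \<in> ?T"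
    if "u \<in> carrier M" "v \<in> carrier N'" "v' \<in> carrier N'" for u v v'
    by (rule subsetD[OF Tc(5)], unfold tensor_generators_def, rule UnI1, rule UnI2, rule CollectI, rule exI[of _ u], rule exI[of _ v], rule exI[of _ v'], intro conjI refl that)
  have scal: "frag_of (c \<odot>\<^bsub>M\<^esub> u, v) - frag_of (u, c \<odot>\<^bsub>N'\<^esub> v) \<in> ?T"
    if "c \<in> carrier R" "u \<in> carrier M" "v \<in> carrier N'" for c u v
    by (rule subsetD[OF Tc(5)], unfold tensor_generators_def, rule UnI2, rule CollectI, rule exI[of _ c], rule exI[of _ u], rule exI[of _ v], intro conjI refl that)
  have zero_left: "frag_of (\<zero>\<^bsub>M\<^esub>, v) \<in> ?T" if "v \<in> carrier N'" for v
    using Tc(3)[OF left[of "\<zero>\<^bsub>M\<^esub>" "\<zero>\<^bsub>M\<^esub>" v]] that by simp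
  have zero_right: "frag_of (u, \<zero>\<^bsub>N'\<^esub>) \<in> ?T" if "u \<in> carrier M" for u
    using Tc(3)[OF right[of u "\<zero>\<^bsub>N'\<^esub>" "\<zero>\<^bsub>N'\<^esub>"]] that by simp
  have diff_right: "frag_of (u, v \<ominus>\<^bsub>N'\<^esub> w) - (frag_of (u, v) - frag_of (u, w)) \<in> ?T"
    if "u \<in> carrier M" "v \<in> carrier N'" "w \<in> carrier N'" for u v w
  proof -
    have "(v \<ominus>\<^bsub>N'\<^esub> w) \<oplus>\<^bsub>N'\<^esub> w = v" using that by (simp add: a_minus_def N'.a_assoc N'.l_neg)
    then have "frag_of (u, v) - frag_of (u, v \<ominus>\<^bsub>N'\<^esub> w) - frag_of (u, w) \<in> ?T"
      using right[of u "v \<ominus>\<^bsub>N'\<^esub> w" w] that by simp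
    from Tc(3)[OF this] show ?thesis by (simp add: algebra_simps)
  qed
  have fsum: "frag_of (finsum M g A, v) - (\<Sum>j\<in>A. frag_of (g j, v)) \<in> ?T"
    if "finite A" "g \<in> A \<rightarrow> carrier M" "v \<in> carrier N'" for g and A :: "'i set" and v
    using that
  proof (induction A rule: finite_induct)
    case (insert j A)
    then have g: "g j \<in> carrier M" "g \<in> A \<rightarrow> carrier M" by auto
    have "frag_of (g j \<oplus>\<^bsub>M\<^esub> finsum M g A, v) - frag_of (g j, v) - frag_of (finsum M g A, v) \<in> ?T"
      using left g insert by simp
    from Tc(2)[OF this insert.IH[OF g(2) insert.prems(2)]]
    have "frag_of (g j \<oplus>\<^bsub>M\<^esub> finsum M g A, v) - frag_of (g j, v) - (\<Sum>j\<in>A. frag_of (g j, v)) \<in> ?T" by simp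
    moreover have "finsum M g (insert j A) = g j \<oplus>\<^bsub>M\<^esub> finsum M g A" using insert g by simp
    moreover have "(\<Sum>j\<in>insert j A. frag_of (g j, v)) = frag_of (g j, v) + (\<Sum>j\<in>A. frag_of (g j, v))" using insert by simp
    ultimately show ?case by (simp add: algebra_simps)
  qed (use zero_left in simp)
  have sumT: "(\<Sum>j\<in>A. g j) \<in> ?T" if "\<And>j. j \<in> A \<Longrightarrow> g j \<in> ?T" for g and A :: "'i set"
    using sum_mem[of ?T A g] Tc(1,2) that by blast
  \<comment> \<open>Modulo the relations every tensor is the combination of the vectors \<open>m\<close> with its coordinates.\<close>
  have expand: "Poly_Mapping.keys s \<subseteq> carrier M \<times> carrier N' \<and> s - (\<Sum>j\<in>B. frag_of (m j, h' j s)) \<in> ?T"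
    if "Poly_Mapping.keys s \<subseteq> ?U \<times> carrier N'" for s
    using that
  proof (induction s rule: frag_induction)
    case zero
    have "h' j 0 = \<zero>\<^bsub>N'\<^esub>" if "j \<in> B" for j using hom_diff(2)[OF mN(2) h'(1)[OF that], where x=0 and y=0] by simp
    then have "(\<Sum>j\<in>B. frag_of (m j, h' j 0)) \<in> ?T" using zero_right mc by (intro sumT) simp
    from Tc(3)[OF this] show ?case by simp
  next
    case (one x)
    obtain u v where x: "x = (u, v)" "u \<in> ?U" "v \<in> carrier N'" using one by (cases x) auto
    then have u: "u \<in> carrier M" using U by blast
    have g: "(\<lambda>j. b j u \<odot>\<^bsub>M\<^esub> m j) \<in> B \<rightarrow> carrier M" using bc mc u by auto
    have "frag_of (u, v) - (\<Sum>j\<in>B. frag_of (b j u \<odot>\<^bsub>M\<^esub> m j, v)) \<in> ?T"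
      using fsum[OF B(1) g x(3)] b(4)[OF x(2)] by simp
    moreover have "(\<Sum>j\<in>B. frag_of (b j u \<odot>\<^bsub>M\<^esub> m j, v) - frag_of (m j, b j u \<odot>\<^bsub>N'\<^esub> v)) \<in> ?T"
      using scal bc mc u x(3) by (intro sumT) auto
    ultimately have "(frag_of (u, v) - (\<Sum>j\<in>B. frag_of (b j u \<odot>\<^bsub>M\<^esub> m j, v))) +
        (\<Sum>j\<in>B. frag_of (b j u \<odot>\<^bsub>M\<^esub> m j, v) - frag_of (m j, b j u \<odot>\<^bsub>N'\<^esub> v)) \<in> ?T" by (rule Tc(2))
    then have "frag_of (u, v) - (\<Sum>j\<in>B. frag_of (m j, b j u \<odot>\<^bsub>N'\<^esub> v)) \<in> ?T" by (simp add: sum_subtractf)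
    moreover have "(\<Sum>j\<in>B. frag_of (m j, h' j (frag_of x))) = (\<Sum>j\<in>B. frag_of (m j, b j u \<odot>\<^bsub>N'\<^esub> v))"
      using h'(2) u x by (intro sum.cong) auto
    ultimately show ?case using x u by simp
  next
    case (diff x y)
    then have k: "Poly_Mapping.keys x \<subseteq> carrier M \<times> carrier N'" "Poly_Mapping.keys y \<subseteq> carrier M \<times> carrier N'" by auto
    have "(\<Sum>j\<in>B. frag_of (m j, h' j (x - y)) - (frag_of (m j, h' j x) - frag_of (m j, h' j y))) \<in> ?T"
    proof (intro sumT)
      fix j assume j: "j \<in> B"
      have "h' j (x - y) = h' j x \<ominus>\<^bsub>N'\<^esub> h' j y" by (rule hom_diff(1)[OF mN(2) h'(1)[OF j] k])
      then show "frag_of (m j, h' j (x - y)) - (frag_of (m j, h' j x) - frag_of (m j, h' j y)) \<in> ?T"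
        using diff_right[OF mc[OF j]] hom_diff(3)[OF mN(2) h'(1)[OF j]] k by metis
    qed
    from Tc(4)[OF Tc(4)[OF conjunct2[OF diff(1)] conjunct2[OF diff(2)]] this]
    have "x - y - (\<Sum>j\<in>B. frag_of (m j, h' j (x - y))) \<in> ?T" by (simp add: sum_subtractf sum.distrib algebra_simps)
    then show ?case using k keys_diff[of x y] by blast
  qed
  have "Poly_Mapping.keys t \<subseteq> ?U \<times> carrier N'" using keys_t by force
  from conjunct2[OF expand[OF this]] have "t - (\<Sum>j\<in>B. frag_of (m j, h' j t)) \<in> ?T" .
  moreover have "(\<Sum>j\<in>B. frag_of (m j, h' j t)) \<in> ?T"
    using h'_t zero_right mc by (intro sumT) simp
  ultimately show "t \<in> ?T" using Tc(2) by fastforce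
qed

section \<open>The deformation ideal and its normal forms\<close>

text \<open>The chart \<open>u \<noteq> 0\<close> of the family. Both charts of \<open>P\<^sup>1\<close> are instances: \<open>i0\<close> is the index of the
  variable that is invertible on the chart, and \<open>D0\<close> generates the fibre over its origin \<open>v = 0\<close>.\<close>

locale deformation = borel_pair n r D0 D1 a0 a1 Q
  for n r :: nat and D0 D1 :: "expo set" and a0 a1 :: expo and Q :: "(expo \<times> expo) set" +
  fixes i0 i1 :: nat and I :: "'k::field mpoly mpoly set"
  assumes i01: "i0 \<noteq> i1" "i0 \<le> 1" "i1 \<le> 1"
    and I_eq: "I = genideal (Kyx n)
      (xpow ` (D0 \<inter> D1) \<union> {Poly_Mapping.single c (xpow (evar i0)) + Poly_Mapping.single c' (xpow (evar i1)) | c c'. (c, c') \<in> Q})"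
begin

abbreviation u :: "'k mpoly" where "u \<equiv> xpow (evar i0)"
abbreviation v :: "'k mpoly" where "v \<equiv> xpow (evar i1)"

lemma evar_y: "evar i0 \<in> monomials 1" "evar i1 \<in> monomials 1"
  using i01 by (simp_all add: monomials_eq_from)

lemma uv_CX: "u \<in> CX 1" "v \<in> CX 1"
  using evar_y by auto

lemma power_CX: "f \<in> CX 1 \<Longrightarrow> f ^ k \<in> CX 1"
  by (induction k) (auto simp: CX_closed)

lemma uk_CX [simp]: "u ^ k \<in> CX 1" "(- v) ^ k \<in> CX 1"
  using power_CX uv_CX CX_closed(5) by blast+

lemma homogeneous_power: "homogeneous 1 f \<Longrightarrow> homogeneous k (f ^ k)" for f :: "'k mpoly"
proof (induction k)
  case (Suc k)
  then show ?case using homogeneous_mult[of 1 f k "f ^ k"] by (simp add: plus_1_eq_Suc)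
qed simp

lemma uk_hom [simp]: "homogeneous k (u ^ k)" "homogeneous k ((- v) ^ k)"
  by (intro homogeneous_power homogeneous_uminus; simp)+

lemma gens_CYX:
  "xpow ` (D0 \<inter> D1) \<union> {Poly_Mapping.single c u + Poly_Mapping.single c' v | c c'. (c, c') \<in> Q} \<subseteq> (CYX n :: 'k mpoly mpoly set)"
proof -
  have "xpow m \<in> (CYX n :: 'k mpoly mpoly set)" if "m \<in> D0 \<inter> D1" for m
    using that D0(1) CX_closed(2) by (intro single_CYX) auto
  moreover have "Poly_Mapping.single c u + Poly_Mapping.single c' v \<in> (CYX n :: 'k mpoly mpoly set)" if "(c, c') \<in> Q" for c c'
    using Q_mem[OF that] D0(1) D1(1) uv_CX by (intro CYX_closed(3) single_CYX) auto
  ultimately show ?thesis by blast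
qed

lemma ideal_I: "ideal I (ring_of (CYX n))"
  unfolding I_eq Kyx_eq by (rule genideal_ring_of(1)[OF subring_CYX gens_CYX])

lemmas I_closed = ideal_closed[OF subring_CYX ideal_I]

lemma gen_mem: "m \<in> D0 \<inter> D1 \<Longrightarrow> xpow m \<in> I"
    "(c, c') \<in> Q \<Longrightarrow> Poly_Mapping.single c u + Poly_Mapping.single c' v \<in> I"
  using genideal_ring_of(2)[OF subring_CYX gens_CYX] unfolding I_eq Kyx_eq by blast+

text \<open>\<open>weight K \<beta> g\<close> is \<open>u\<^sup>K\<close> times the coefficient of \<open>\<beta>\<close> in the normal form of \<open>g\<close>: each rewriting
  step replaces \<open>g\<close> by \<open>- v / u\<close> times the next monomial. The bound \<open>K\<close> on the number of steps is
  taken at least as large as the degree, and then there are no longer chains by \<open>rewrite_pow_bound\<close>; the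
  factor \<open>u\<^sup>K\<close> clears all denominators.\<close>

definition weight :: "nat \<Rightarrow> expo \<Rightarrow> expo \<Rightarrow> 'k mpoly"
  where "weight K \<beta> g = (\<Sum>k\<le>K. if (rewrite_step ^^ k) g \<beta> then (- v) ^ k * u ^ (K - k) else 0)"

definition coord_form :: "nat \<Rightarrow> expo \<Rightarrow> 'k mpoly mpoly \<Rightarrow> 'k mpoly"
  where "coord_form K \<beta> F = (\<Sum>g\<in>Poly_Mapping.keys F. Poly_Mapping.lookup F g * weight K \<beta> g)"

lemma weight_CX: "weight K \<beta> g \<in> CX 1"
  unfolding weight_def by (intro sum_mem CX_closed(1,3)) (auto simp: CX_closed)

lemma weight_hom: "homogeneous K (weight K \<beta> g)"
proof -
  have "weight K \<beta> g \<in> {f. homogeneous K f}"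
    unfolding weight_def
  proof (intro sum_mem)
    fix k assume "k \<in> {..K}"
    then have "k + (K - k) = K" by simp
    moreover have "homogeneous (k + (K - k)) ((- v) ^ k * u ^ (K - k))"
      by (rule homogeneous_mult) simp_all
    ultimately have "homogeneous K ((- v) ^ k * u ^ (K - k))" by metis
    then show "(if (rewrite_step ^^ k) g \<beta> then (- v) ^ k * u ^ (K - k) else 0) \<in> {f. homogeneous K f}" by simp
  qed (auto intro: homogeneous_add)
  then show ?thesis by simp
qed

lemma pow_Suc_from: "(rewrite_step ^^ Suc k) g h \<Longrightarrow> \<exists>g'. rewrite_step g g' \<and> (rewrite_step ^^ k) g' h"
  by (rule relpowp_Suc_D2)

lemma pow_no_step:
  assumes "\<And>g'. \<not> rewrite_step g g'"
  shows "(rewrite_step ^^ k) g h \<longleftrightarrow> k = 0 \<and> g = h"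
proof (cases k)
  case (Suc l)
  then have "\<not> (rewrite_step ^^ k) g h" using assms pow_Suc_from[of l g h] by blast
  then show ?thesis using Suc by simp
qed simp

lemma multiples_D_D0: "g \<in> multiples D \<Longrightarrow> g \<in> multiples D0"
  unfolding multiples_def by blast

lemma weight_no_step:
  assumes "\<And>g'. \<not> rewrite_step g g'"
  shows "weight K \<beta> g = (if g = \<beta> then u ^ K else 0)"
proof -
  have "weight K \<beta> g = (\<Sum>k\<le>K. if k = 0 then (if g = \<beta> then u ^ K else 0) else 0)"
    unfolding weight_def pow_no_step[OF assms] by (intro sum.cong) auto
  then show ?thesis by simp
qed

lemma weight_multiple:
  assumes "\<beta> \<notin> multiples D0" "g \<in> multiples D"
  shows "weight K \<beta> g = 0"
proof -
  have "\<not> rewrite_step g g'" for g' using assms(2) rewrite_step_not_multiples by blast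
  moreover have "g \<noteq> \<beta>" using assms multiples_D_D0 by blast
  ultimately show ?thesis using weight_no_step by simp
qed

lemma weight_step:
  assumes \<beta>: "\<beta> \<notin> multiples D0" "expo_deg \<beta> \<le> K" and st: "rewrite_step g g'"
  shows "u * weight K \<beta> g + v * weight K \<beta> g' = 0"
proof -
  have Suc_iff: "(rewrite_step ^^ Suc k) g \<beta> \<longleftrightarrow> (rewrite_step ^^ k) g' \<beta>" for k
    using pow_Suc_from[of k g \<beta>] relpowp_Suc_I2[where P = rewrite_step, OF st] rewrite_step_unique[OF st] by blast
  have "g \<noteq> \<beta>" using rewrite_step_multiple[OF st] \<beta> by blast
  have K: "\<not> (rewrite_step ^^ K) g' \<beta>"
  proof
    assume "(rewrite_step ^^ K) g' \<beta>"
    then have "(rewrite_step ^^ Suc K) g \<beta>" using Suc_iff by blast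
    then have "Suc K \<le> expo_deg g" "expo_deg \<beta> = expo_deg g"
      using rewrite_pow_bound rewrite_step_pow(2) by blast+
    then show False using \<beta>(2) by simp
  qed
  let ?g = "\<lambda>k. if (rewrite_step ^^ k) g \<beta> then (- v) ^ k * u ^ (K - k) else 0"
  let ?h = "\<lambda>k. if (rewrite_step ^^ k) g' \<beta> then (- v) ^ k * u ^ (K - k) else 0"
  have "weight K \<beta> g = (\<Sum>k<K. ?g (Suc k))"
    using \<open>g \<noteq> \<beta>\<close> unfolding weight_def sum.atMost_shift by simp
  moreover have "weight K \<beta> g' = (\<Sum>k<K. ?h k)"
    using K unfolding weight_def lessThan_Suc_atMost[symmetric] sum.lessThan_Suc by simp
  moreover have "u * ?g (Suc k) = - v * ?h k" if "k < K" for k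
  proof -
    have "K - k = Suc (K - Suc k)" using that by simp
    then show ?thesis unfolding Suc_iff by (simp add: ac_simps)
  qed
  ultimately have "u * weight K \<beta> g = (\<Sum>k<K. - v * ?h k)"
    by (simp only: sum_distrib_left) (auto intro: sum.cong)
  then show ?thesis using \<open>weight K \<beta> g' = (\<Sum>k<K. ?h k)\<close> by (simp only: sum_distrib_left[symmetric]) simp
qed

lemma weight_relation:
  assumes \<beta>: "\<beta> \<notin> multiples D0" "expo_deg \<beta> \<le> K" and Q: "(c, c') \<in> Q" "b \<in> monomials n"
  shows "u * weight K \<beta> (b + c) + v * weight K \<beta> (b + c') = 0"
proof (cases "b + c \<in> multiples D")
  case True
  then have "b + c' \<in> multiples D" using multiples_transfer[OF Q] by blast
  then show ?thesis using True weight_multiple[OF \<beta>(1)] by simp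
next
  case False
  then have "rewrite_step (b + c) (b + c')" using Q unfolding rewrite_step_def by blast
  then show ?thesis by (rule weight_step[OF \<beta>])
qed

lemma coord_form_superset:
  assumes "finite S" "Poly_Mapping.keys F \<subseteq> S"
  shows "coord_form K \<beta> F = (\<Sum>g\<in>S. Poly_Mapping.lookup F g * weight K \<beta> g)"
  unfolding coord_form_def using assms by (intro sum.mono_neutral_left) (auto simp: in_keys_iff)

lemma coord_form_add: "coord_form K \<beta> (F + G) = coord_form K \<beta> F + coord_form K \<beta> G"
proof -
  let ?S = "Poly_Mapping.keys F \<union> Poly_Mapping.keys G"
  show ?thesis
    using keys_add[of F G]
    by (subst (1 2 3) coord_form_superset[of ?S]) (auto simp: lookup_add distrib_right sum.distrib)
qed

lemma coord_form_single: "coord_form K \<beta> (Poly_Mapping.single a c) = c * weight K \<beta> a"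
  by (subst coord_form_superset[of "{a}"]) auto

lemma coord_form_zero [simp]: "coord_form K \<beta> 0 = 0"
  by (simp add: coord_form_def)

lemma coord_form_sum: "coord_form K \<beta> (sum f A) = (\<Sum>a\<in>A. coord_form K \<beta> (f a))"
  by (induction A rule: infinite_finite_induct) (auto simp: coord_form_add)

lemma coord_form_smult: "coord_form K \<beta> (Poly_Mapping.single 0 c * F) = c * coord_form K \<beta> F"
proof -
  have "Poly_Mapping.single 0 c * F = (\<Sum>a\<in>Poly_Mapping.keys F. Poly_Mapping.single a (c * Poly_Mapping.lookup F a))"
    by (subst poly_mapping_eq_sum[of F]) (simp add: sum_distrib_left mult_single)
  then show ?thesis
    by (simp add: coord_form_sum coord_form_single) (simp add: coord_form_def sum_distrib_left mult.assoc)
qed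

lemma coord_form_uminus: "coord_form K \<beta> (- F) = - coord_form K \<beta> F"
  using coord_form_add[of K \<beta> F "- F"] by (simp add: add_eq_0_iff)

lemma coord_form_diff: "coord_form K \<beta> (F - G) = coord_form K \<beta> F - coord_form K \<beta> G"
  using coord_form_add[of K \<beta> F "- G"] by (simp add: coord_form_uminus)

lemma coord_form_CX: "F \<in> CYX n \<Longrightarrow> coord_form K \<beta> F \<in> CX 1"
  unfolding coord_form_def by (intro sum_mem CX_closed(1,3)) (auto simp: CX_closed CYX_coeff weight_CX)

lemma coord_form_hom:
  assumes "bihomogeneous (e, d) F"
  shows "homogeneous (e + K) (coord_form K \<beta> F)"
proof -
  have "coord_form K \<beta> F \<in> {f. homogeneous (e + K) f}"
    unfolding coord_form_def
    using homogeneous_mult[OF bihomogeneous_coeff[OF assms] weight_hom] homogeneous_add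
    by (intro sum_mem) auto
  then show ?thesis by simp
qed

text \<open>The coordinate of a standard monomial vanishes on the ideal. This is the point where the
  consistency of the rewriting, hence the equality of the least variables, enters.\<close>

lemma coord_form_ideal:
  assumes \<beta>: "\<beta> \<notin> multiples D0" "expo_deg \<beta> \<le> K" and F: "F \<in> I"
  shows "coord_form K \<beta> F = 0"
proof -
  let ?T = "{F \<in> CYX n. \<forall>b\<in>monomials n. coord_form K \<beta> (xpow b * F) = 0}"
  have T: "ideal ?T (ring_of (CYX n))"
    unfolding ideal_ring_of_iff[OF subring_CYX]
  proof (intro conjI ballI)
    fix x y assume "x \<in> ?T" "y \<in> ?T"
    then show "x + y \<in> ?T" by (auto simp: CYX_closed distrib_left coord_form_add)
  next
    fix c x :: "'k mpoly mpoly" assume c: "c \<in> CYX n" and x: "x \<in> ?T"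
    have "c * x \<in> ?T" using c
    proof (induction c rule: CYX_induct)
      case (single a c)
      have "xpow b * (Poly_Mapping.single a c * x) = Poly_Mapping.single 0 c * (xpow (b + a) * x)" for b
        by (simp add: mult.assoc[symmetric] mult_single)
      then have "coord_form K \<beta> (xpow b * (Poly_Mapping.single a c * x)) = c * coord_form K \<beta> (xpow (b + a) * x)" for b
        by (simp only: coord_form_smult)
      moreover have "Poly_Mapping.single a c * x \<in> CYX n" using x by (intro CYX_closed(4) single_CYX[OF single]) simp
      ultimately show ?case using x single by simp
    next
      case (add F G)
      then show ?case by (auto simp: CYX_closed distrib_left distrib_right coord_form_add)
    qed (simp add: CYX_closed)
    then show "c * x \<in> ?T" .
  qed (auto simp: CYX_closed)
  have "I \<subseteq> ?T"
    unfolding I_eq Kyx_eq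
  proof (rule genideal_least[OF subring_CYX T], intro Un_least subsetI)
    fix x :: "'k mpoly mpoly" assume "x \<in> xpow ` (D0 \<inter> D1)"
    then obtain m where m: "x = xpow m" "m \<in> D0 \<inter> D1" by blast
    have "coord_form K \<beta> (xpow b * x) = 0" for b
      using weight_multiple[OF \<beta>(1) multiplesI[OF m(2), of b], of K]
      by (simp add: m(1) mult_single coord_form_single)
    then show "x \<in> ?T" using gens_CYX m by blast
  next
    fix x assume "x \<in> {Poly_Mapping.single c u + Poly_Mapping.single c' v | c c'. (c, c') \<in> Q}"
    then obtain c c' where x: "x = Poly_Mapping.single c u + Poly_Mapping.single c' v" "(c, c') \<in> Q" by blast
    have "coord_form K \<beta> (xpow b * x) = 0" if "b \<in> monomials n" for b
      using weight_relation[OF \<beta> x(2) that]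
      by (simp add: x(1) mult_single distrib_left coord_form_add coord_form_single)
    moreover have "x \<in> CYX n" using gens_CYX x by blast
    ultimately show "x \<in> ?T" by blast
  qed
  then have "\<forall>b\<in>monomials n. coord_form K \<beta> (xpow b * F) = 0" using F by blast
  from bspec[OF this monomials_zero] show ?thesis by simp
qed

text \<open>The monomials outside the fibre ideal, which index the coordinates.\<close>

definition standard :: "nat \<Rightarrow> expo set"
  where "standard d = {\<beta>\<in>monomials n. expo_deg \<beta> = d \<and> \<beta> \<notin> multiples D0}"

lemma finite_standard: "finite (standard d)"
  unfolding standard_def monomials_eq_from by simp

text \<open>Membership in the extension of \<open>I\<close> to the chart \<open>u \<noteq> 0\<close>.\<close>

definition locally_in_I :: "'k mpoly mpoly \<Rightarrow> bool"
  where "locally_in_I F \<longleftrightarrow> F \<in> CYX n \<and> (\<exists>M. Poly_Mapping.single 0 (u ^ M) * F \<in> I)"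

lemma u_CYX [simp]: "Poly_Mapping.single 0 (u ^ M) \<in> CYX n"
  by simp

lemma locally_in_I_mult: "locally_in_I F \<Longrightarrow> c \<in> CYX n \<Longrightarrow> locally_in_I (c * F)"
  unfolding locally_in_I_def using I_closed(3)
  by (metis (no_types, lifting) CYX_closed(4) mult.left_commute)

lemma locally_in_I_add:
  assumes "locally_in_I F" "locally_in_I G"
  shows "locally_in_I (F + G)"
proof -
  obtain M M' where M: "Poly_Mapping.single 0 (u ^ M) * F \<in> I" "Poly_Mapping.single 0 (u ^ M') * G \<in> I"
    using assms unfolding locally_in_I_def by blast
  have mem: "Poly_Mapping.single 0 (u ^ M') * (Poly_Mapping.single 0 (u ^ M) * F) + Poly_Mapping.single 0 (u ^ M) * (Poly_Mapping.single 0 (u ^ M') * G) \<in> I" (is "?x \<in> I")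
    by (rule I_closed(2)[OF I_closed(3)[OF M(1) u_CYX] I_closed(3)[OF M(2) u_CYX]])
  have "?x = Poly_Mapping.single 0 (u ^ (M + M')) * (F + G)"
  proof -
    have "y * (x * F) + x * (y * G) = (x * y) * (F + G)" for x y by (simp add: algebra_simps)
    moreover have "(Poly_Mapping.single 0 (u ^ (M + M')) :: 'k mpoly mpoly) = Poly_Mapping.single 0 (u ^ M) * Poly_Mapping.single 0 (u ^ M')"
      by (simp add: mult_single power_add)
    ultimately show ?thesis by (simp only:)
  qed
  then have "Poly_Mapping.single 0 (u ^ (M + M')) * (F + G) \<in> I" using mem by simp
  then show ?thesis using assms CYX_closed(3) unfolding locally_in_I_def by blast
qed

lemma locally_in_I_I: "F \<in> I \<Longrightarrow> locally_in_I F"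
  unfolding locally_in_I_def using I_closed(7) by (intro conjI exI[of _ 0]) (auto simp: single_one)

lemma locally_in_I_cancel:
  assumes "locally_in_I (Poly_Mapping.single 0 u * F)" "F \<in> CYX n"
  shows "locally_in_I F"
proof -
  obtain M where "Poly_Mapping.single 0 (u ^ M) * (Poly_Mapping.single 0 u * F) \<in> I"
    using assms unfolding locally_in_I_def by blast
  then have "Poly_Mapping.single 0 (u ^ Suc M) * F \<in> I"
    by (simp add: mult.assoc[symmetric] mult_single power_Suc2 del: power_Suc)
  then show ?thesis using assms(2) unfolding locally_in_I_def by blast
qed

text \<open>Follow the rewriting of \<open>g\<close>. It ends in a multiple of \<open>D\<close>, which lies in \<open>I\<close>, or in a standard
  monomial; each step costs a factor \<open>u\<close>, which is invertible on the chart.\<close>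

lemma normal_form_monomial:
  assumes "g \<in> monomials n" "expo_deg g = K"
  shows "locally_in_I (Poly_Mapping.single g (u ^ K) - (\<Sum>\<beta>\<in>standard K. Poly_Mapping.single \<beta> (weight K \<beta> g)))"
  using assms(1) assms(2)
proof (induction g rule: rewrite_induct)
  case (step g)
  let ?S = "\<lambda>g. \<Sum>\<beta>\<in>standard K. Poly_Mapping.single \<beta> (weight K \<beta> g)"
  have S_CYX: "?S g \<in> CYX n" for g
    using weight_CX by (intro sum_mem CYX_closed(1,3)) (auto simp: standard_def)
  have g_CYX: "Poly_Mapping.single g (u ^ K) \<in> CYX n" using step by simp
  show ?case
  proof (cases "g \<in> multiples D")
    case True
    then obtain b m where g: "g = b + m" "m \<in> D" unfolding multiples_def by blast
    have "?S g = 0" using True weight_multiple by (intro sum.neutral) (auto simp: standard_def)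
    moreover have "Poly_Mapping.single b (u ^ K) * xpow m \<in> I"
      using gen_mem(1)[OF g(2)] step(1) g by (intro I_closed(3)) auto
    ultimately show ?thesis using g locally_in_I_I by (simp add: mult_single)
  next
    case False
    show ?thesis
    proof (cases "g \<in> multiples D0")
      case True
      then obtain b m where g: "g = b + m" "m \<in> D0" unfolding multiples_def by blast
      then have "m \<notin> D1" using False unfolding multiples_def by blast
      then obtain c' where Q: "(m, c') \<in> Q" using fst_Q g by force
      have b: "b \<in> monomials n" using step(1) g by simp
      let ?g' = "b + c'"
      have st: "rewrite_step g ?g'" unfolding rewrite_step_def using Q b g False by blast
      have IH: "locally_in_I (Poly_Mapping.single ?g' (u ^ K) - ?S ?g')"
        using step.IH[OF st] rewrite_step_deg[OF st] step.prems by simp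
      have "Poly_Mapping.single b (u ^ K) * (Poly_Mapping.single m u + Poly_Mapping.single c' v) \<in> I"
        using gen_mem(2)[OF Q] b by (intro I_closed(3)) auto
      then have "Poly_Mapping.single g (u ^ K * u) + Poly_Mapping.single ?g' (u ^ K * v) \<in> I"
        by (simp add: g distrib_left mult_single)
      then have 1: "locally_in_I (Poly_Mapping.single g (u ^ K * u) + Poly_Mapping.single ?g' (u ^ K * v))"
        by (rule locally_in_I_I)
      have 2: "locally_in_I (Poly_Mapping.single 0 (- v) * (Poly_Mapping.single ?g' (u ^ K) - ?S ?g'))"
        by (rule locally_in_I_mult[OF IH single_CYX[OF monomials_zero CX_closed(5)[OF uv_CX(2)]]])
      have sum0: "Poly_Mapping.single 0 u * ?S g + Poly_Mapping.single 0 v * ?S ?g' = 0"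
      proof -
        have "Poly_Mapping.single \<beta> (u * weight K \<beta> g) + Poly_Mapping.single \<beta> (v * weight K \<beta> ?g') = 0" if "\<beta> \<in> standard K" for \<beta>
          using weight_step[OF _ _ st, of \<beta> K] that by (simp add: standard_def flip: single_add)
        then show ?thesis by (simp add: sum_distrib_left mult_single flip: sum.distrib)
      qed
      have "Poly_Mapping.single 0 u * (Poly_Mapping.single g (u ^ K) - ?S g)
        = (Poly_Mapping.single g (u ^ K * u) + Poly_Mapping.single ?g' (u ^ K * v))
          + Poly_Mapping.single 0 (- v) * (Poly_Mapping.single ?g' (u ^ K) - ?S ?g')
          - (Poly_Mapping.single 0 u * ?S g + Poly_Mapping.single 0 v * ?S ?g')"
        by (simp add: right_diff_distrib mult_single mult.commute single_uminus)
      also have "\<dots> = (Poly_Mapping.single g (u ^ K * u) + Poly_Mapping.single ?g' (u ^ K * v))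
          + Poly_Mapping.single 0 (- v) * (Poly_Mapping.single ?g' (u ^ K) - ?S ?g')"
        by (simp only: sum0 diff_0_right)
      finally have "locally_in_I (Poly_Mapping.single 0 u * (Poly_Mapping.single g (u ^ K) - ?S g))"
        using locally_in_I_add[OF 1 2] by simp
      then show ?thesis using locally_in_I_cancel S_CYX g_CYX CYX_closed(6) by blast
    next
      case nD0: False
      then have no: "\<not> rewrite_step g g'" for g' using rewrite_step_multiple by blast
      have "g \<in> standard K" using step nD0 by (simp add: standard_def)
      have "?S g = (\<Sum>\<beta>\<in>standard K. if \<beta> = g then Poly_Mapping.single g (u ^ K) else 0)"
        by (intro sum.cong) (auto simp: weight_no_step[OF no])
      then have "?S g = Poly_Mapping.single g (u ^ K)"
        using \<open>g \<in> standard K\<close> finite_standard by simp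
      then show ?thesis using locally_in_I_I I_closed(1) by simp
    qed
  qed
qed

lemma normal_form:
  assumes F: "F \<in> CYX n" "bihomogeneous (e, K) F"
  shows "locally_in_I (Poly_Mapping.single 0 (u ^ K) * F - (\<Sum>\<beta>\<in>standard K. Poly_Mapping.single \<beta> (coord_form K \<beta> F)))"
proof -
  let ?N = "\<lambda>g. Poly_Mapping.single g (u ^ K) - (\<Sum>\<beta>\<in>standard K. Poly_Mapping.single \<beta> (weight K \<beta> g))"
  have single_sum: "Poly_Mapping.single \<beta> (sum f A) = (\<Sum>a\<in>A. Poly_Mapping.single \<beta> (f a))"
    for \<beta> :: expo and f :: "expo \<Rightarrow> 'k mpoly" and A
    by (induction A rule: infinite_finite_induct) (auto simp: single_add)
  have "(\<Sum>g\<in>Poly_Mapping.keys F. Poly_Mapping.single 0 (Poly_Mapping.lookup F g) * ?N g) \<in> {F. locally_in_I F}"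
  proof (intro sum_mem)
    fix g assume g: "g \<in> Poly_Mapping.keys F"
    then have "g \<in> monomials n" "expo_deg g = K" using F CYX_key by (auto simp: bihomogeneous_def homogeneous_def)
    then show "Poly_Mapping.single 0 (Poly_Mapping.lookup F g) * ?N g \<in> {F. locally_in_I F}"
      using normal_form_monomial locally_in_I_mult CYX_coeff[OF F(1)] by simp
  qed (use locally_in_I_add locally_in_I_I I_closed(1) in auto)
  moreover have "(\<Sum>g\<in>Poly_Mapping.keys F. Poly_Mapping.single 0 (Poly_Mapping.lookup F g) * ?N g) =
     Poly_Mapping.single 0 (u ^ K) * F - (\<Sum>\<beta>\<in>standard K. Poly_Mapping.single \<beta> (coord_form K \<beta> F))"
  proof -
    have 1: "Poly_Mapping.single 0 (u ^ K) * F = (\<Sum>g\<in>Poly_Mapping.keys F. Poly_Mapping.single g (Poly_Mapping.lookup F g * u ^ K))"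
      by (subst poly_mapping_eq_sum[of F]) (simp add: sum_distrib_left mult_single mult.commute)
    have 2: "(\<Sum>\<beta>\<in>standard K. Poly_Mapping.single \<beta> (coord_form K \<beta> F)) =
      (\<Sum>g\<in>Poly_Mapping.keys F. \<Sum>\<beta>\<in>standard K. Poly_Mapping.single \<beta> (Poly_Mapping.lookup F g * weight K \<beta> g))"
      unfolding coord_form_def single_sum by (rule sum.swap)
    show ?thesis unfolding 1 2
      by (simp add: right_diff_distrib sum_distrib_left mult_single sum_subtractf)
  qed
  ultimately show ?thesis by simp
qed

end

section \<open>Quotients as modules\<close>

definition subring_hom :: "'b::comm_ring_1 set \<Rightarrow> 'a::comm_ring_1 set \<Rightarrow> ('b \<Rightarrow> 'a) \<Rightarrow> bool"
  where "subring_hom A C h \<longleftrightarrow> (\<forall>x\<in>A. h x \<in> C) \<and> h 1 = 1 \<and>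
    (\<forall>x\<in>A. \<forall>y\<in>A. h (x + y) = h x + h y \<and> h (x * y) = h x * h y)"

context
  fixes C :: "'a::comm_ring_1 set" and I :: "'a set"
  assumes C: "is_subring C" and I: "ideal I (ring_of C)"
begin

lemma quot_simps:
  "carrier (ring_of C Quot I) = {I +>\<^bsub>ring_of C\<^esub> x | x. x \<in> C}"
  "x \<in> C \<Longrightarrow> y \<in> C \<Longrightarrow> mult (ring_of C Quot I) (I +>\<^bsub>ring_of C\<^esub> x) (I +>\<^bsub>ring_of C\<^esub> y) = I +>\<^bsub>ring_of C\<^esub> (x * y)"
  "x \<in> C \<Longrightarrow> y \<in> C \<Longrightarrow> add (ring_of C Quot I) (I +>\<^bsub>ring_of C\<^esub> x) (I +>\<^bsub>ring_of C\<^esub> y) = I +>\<^bsub>ring_of C\<^esub> (x + y)"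
  "one (ring_of C Quot I) = I +>\<^bsub>ring_of C\<^esub> 1"
  "zero (ring_of C Quot I) = I +>\<^bsub>ring_of C\<^esub> 0"
proof -
  interpret ideal I "ring_of C" by (rule I)
  show "carrier (ring_of C Quot I) = {I +>\<^bsub>ring_of C\<^esub> x | x. x \<in> C}"
    by (auto simp: FactRing_def A_RCOSETS_def')
  show "x \<in> C \<Longrightarrow> y \<in> C \<Longrightarrow> mult (ring_of C Quot I) (I +>\<^bsub>ring_of C\<^esub> x) (I +>\<^bsub>ring_of C\<^esub> y) = I +>\<^bsub>ring_of C\<^esub> (x * y)"
    using rcoset_mult_add[of x y] by (simp add: FactRing_def)
  show "x \<in> C \<Longrightarrow> y \<in> C \<Longrightarrow> add (ring_of C Quot I) (I +>\<^bsub>ring_of C\<^esub> x) (I +>\<^bsub>ring_of C\<^esub> y) = I +>\<^bsub>ring_of C\<^esub> (x + y)"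
    using a_rcos_sum[of x y] by (simp add: FactRing_def)
  show "one (ring_of C Quot I) = I +>\<^bsub>ring_of C\<^esub> 1" by (simp add: FactRing_def)
  show "zero (ring_of C Quot I) = I +>\<^bsub>ring_of C\<^esub> 0" by (simp add: FactRing_def coset_ring_of)
qed

lemma cring_quot: "cring (ring_of C Quot I)"
  using ideal.quotient_is_cring[OF I cring_ring_of[OF C]] .

context
  fixes A :: "'b::comm_ring_1 set" and h :: "'b \<Rightarrow> 'a"
  assumes A: "is_subring A" and hom: "subring_hom A C h"
begin

lemma h: "x \<in> A \<Longrightarrow> h x \<in> C" "x \<in> A \<Longrightarrow> y \<in> A \<Longrightarrow> h (x + y) = h x + h y"
  "x \<in> A \<Longrightarrow> y \<in> A \<Longrightarrow> h (x * y) = h x * h y" "h 1 = 1"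
  using hom unfolding subring_hom_def by blast+

abbreviation quot_module :: "('b, 'a set) module"
  where "quot_module \<equiv> restrict_scalars (\<lambda>q. I +>\<^bsub>ring_of C\<^esub> h q) (ring_of C Quot I)"

lemma quot_module_simps:
  "carrier quot_module = {I +>\<^bsub>ring_of C\<^esub> x | x. x \<in> C}"
  "x \<in> C \<Longrightarrow> y \<in> C \<Longrightarrow> add quot_module (I +>\<^bsub>ring_of C\<^esub> x) (I +>\<^bsub>ring_of C\<^esub> y) = I +>\<^bsub>ring_of C\<^esub> (x + y)"
  "c \<in> A \<Longrightarrow> x \<in> C \<Longrightarrow> smult quot_module c (I +>\<^bsub>ring_of C\<^esub> x) = I +>\<^bsub>ring_of C\<^esub> (h c * x)"
  "zero quot_module = I +>\<^bsub>ring_of C\<^esub> 0"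
  using quot_simps h(1) by (simp_all add: restrict_scalars_def)

lemma module_quot: "module (ring_of A) quot_module"
proof -
  interpret Q: cring "ring_of C Quot I" by (rule cring_quot)
  have ab: "abelian_group quot_module"
  proof (rule abelian_groupI)
    fix x assume "x \<in> carrier quot_module"
    then have "x \<in> carrier (ring_of C Quot I)" by (simp add: restrict_scalars_def)
    then show "\<exists>y\<in>carrier quot_module. y \<oplus>\<^bsub>quot_module\<^esub> x = \<zero>\<^bsub>quot_module\<^esub>"
      using Q.l_neg Q.a_inv_closed by (auto simp: restrict_scalars_def)
  qed (auto simp: restrict_scalars_def Q.a_ac)
  have in_A: "a \<in> A" if "a \<in> carrier (ring_of A)" for a using that by simp
  show ?thesis
  proof (rule moduleI)
    show "cring (ring_of A)" by (rule cring_ring_of[OF A])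
    show "abelian_group quot_module" by (rule ab)
  next
    fix a x assume "a \<in> carrier (ring_of A)" "x \<in> carrier quot_module"
    then show "a \<odot>\<^bsub>quot_module\<^esub> x \<in> carrier quot_module"
      using quot_module_simps(3) h(1) subring_closed(4)[OF C] by (auto simp: quot_module_simps(1))
  next
    fix a b x assume *: "a \<in> carrier (ring_of A)" "b \<in> carrier (ring_of A)" "x \<in> carrier quot_module"
    then obtain x' where x: "x = I +>\<^bsub>ring_of C\<^esub> x'" "x' \<in> C" by (auto simp: quot_module_simps(1))
    have ab: "a \<in> A" "b \<in> A" using * by auto
    show "(a \<oplus>\<^bsub>ring_of A\<^esub> b) \<odot>\<^bsub>quot_module\<^esub> x = a \<odot>\<^bsub>quot_module\<^esub> x \<oplus>\<^bsub>quot_module\<^esub> b \<odot>\<^bsub>quot_module\<^esub> x"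
      using ab x by (simp add: quot_module_simps h subring_closed[OF A] subring_closed[OF C] distrib_right)
    show "(a \<otimes>\<^bsub>ring_of A\<^esub> b) \<odot>\<^bsub>quot_module\<^esub> x = a \<odot>\<^bsub>quot_module\<^esub> (b \<odot>\<^bsub>quot_module\<^esub> x)"
      using ab x by (simp add: quot_module_simps h subring_closed[OF A] subring_closed[OF C] mult.assoc)
  next
    fix a x y assume *: "a \<in> carrier (ring_of A)" "x \<in> carrier quot_module" "y \<in> carrier quot_module"
    then obtain x' y' where x: "x = I +>\<^bsub>ring_of C\<^esub> x'" "x' \<in> C" "y = I +>\<^bsub>ring_of C\<^esub> y'" "y' \<in> C"
      by (auto simp: quot_module_simps(1))
    have a: "a \<in> A" using * by auto
    show "a \<odot>\<^bsub>quot_module\<^esub> (x \<oplus>\<^bsub>quot_module\<^esub> y) = a \<odot>\<^bsub>quot_module\<^esub> x \<oplus>\<^bsub>quot_module\<^esub> a \<odot>\<^bsub>quot_module\<^esub> y"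
      using a x by (simp add: quot_module_simps h subring_closed[OF C] distrib_left)
  next
    fix x assume *: "x \<in> carrier quot_module"
    then obtain x' where x: "x = I +>\<^bsub>ring_of C\<^esub> x'" "x' \<in> C" by (auto simp: quot_module_simps(1))
    show "\<one>\<^bsub>ring_of A\<^esub> \<odot>\<^bsub>quot_module\<^esub> x = x"
      using x by (simp add: quot_module_simps h subring_closed[OF A])
  qed
qed

lemma finsum_quot_module:
  assumes "finite B" "\<And>j. j \<in> B \<Longrightarrow> g j \<in> C"
  shows "finsum quot_module (\<lambda>j. I +>\<^bsub>ring_of C\<^esub> g j) B = I +>\<^bsub>ring_of C\<^esub> (sum g B)"
proof -
  interpret M: module "ring_of A" quot_module by (rule module_quot)
  show ?thesis
    using assms
  proof (induction B rule: finite_induct)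
    case empty
    show ?case unfolding M.finsum_empty by (simp add: quot_module_simps(4))
  next
    case (insert j B)
    have C': "\<And>k. k \<in> insert j B \<Longrightarrow> I +>\<^bsub>ring_of C\<^esub> g k \<in> carrier quot_module"
      using insert.prems by (auto simp: quot_module_simps(1))
    have "finsum quot_module (\<lambda>j. I +>\<^bsub>ring_of C\<^esub> g j) (insert j B) =
        (I +>\<^bsub>ring_of C\<^esub> g j) \<oplus>\<^bsub>quot_module\<^esub> finsum quot_module (\<lambda>j. I +>\<^bsub>ring_of C\<^esub> g j) B"
      by (rule M.finsum_insert) (use insert.hyps C' in \<open>auto simp del: quot_module_simps\<close>)
    also have "\<dots> = I +>\<^bsub>ring_of C\<^esub> (g j + sum g B)"
      using insert sum_mem[of C B g] subring_closed[OF C] by (simp add: quot_module_simps(2))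
    finally show ?case using insert by simp
  qed
qed

end

end

section \<open>The projections on functions\<close>

lemma fract_map_Fract:
  assumes "\<And>a b. h (a * b) = h a * h b" "\<And>a. h a = 0 \<Longrightarrow> a = 0" "g \<noteq> 0"
  shows "fract_map h (Fract f g) = Fract (h f) (h g)"
  unfolding fract_map_def
proof (rule the_equality)
  show "\<exists>f' g'. g' \<noteq> 0 \<and> Fract f g = Fract f' g' \<and> Fract (h f) (h g) = Fract (h f') (h g')"
    using assms(3) by blast
  fix w assume "\<exists>f' g'. g' \<noteq> 0 \<and> Fract f g = Fract f' g' \<and> w = Fract (h f') (h g')"
  then obtain f' g' where *: "g' \<noteq> 0" "Fract f g = Fract f' g'" "w = Fract (h f') (h g')" by blast
  have "f * g' = f' * g" using * assms(3) by (simp add: eq_fract)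
  then have "h f * h g' = h f' * h g" using assms(1) by metis
  moreover have "h g \<noteq> 0" "h g' \<noteq> 0" using assms(2,3) * by blast+
  ultimately show "w = Fract (h f) (h g)" using * by (simp add: eq_fract)
qed

lemma diff_fract_same: "(D :: 'a::idom) \<noteq> 0 \<Longrightarrow> Fract a D - Fract b D = Fract (a - b) D"
  by (simp add: eq_fract algebra_simps)

lemma embed_y_simps:
  "embed_y (f * g) = embed_y f * embed_y g" "embed_y (f + g) = embed_y f + embed_y g"
  "embed_y f = 0 \<longleftrightarrow> f = 0" "embed_y 1 = 1" "embed_y 0 = 0"
  by (auto simp: embed_y_def mult_single single_add) (metis lookup_single_eq lookup_zero)

lemma embed_y_piece: "f \<in> CX 1 \<Longrightarrow> homogeneous e f \<Longrightarrow> embed_y f \<in> piece (proj_1_n n) (e, 0)"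
  by (simp add: proj_1_n_def embed_y_def Kyx_eq bihomogeneous_single)

lemma piece_proj_n: "f \<in> piece (proj_n n) d \<longleftrightarrow> f \<in> CX n \<and> homogeneous d f"
  by (simp add: proj_n_def Kx_eq)

lemma piece_proj_1_n: "F \<in> piece (proj_1_n n) de \<longleftrightarrow> F \<in> CYX n \<and> bihomogeneous de F"
  by (simp add: proj_1_n_def Kyx_eq)

lemma fract_map_embed_y: "g \<noteq> 0 \<Longrightarrow> fract_map embed_y (Fract f g) = Fract (embed_y f) (embed_y g)"
  by (rule fract_map_Fract) (auto simp: embed_y_simps)

lemma pr1_mem_iff: "f \<in> pr1 P \<longleftrightarrow> f \<in> CX 1 \<and> embed_y f \<in> P"
  by (simp add: contract_def proj_n_def Kx_eq)

lemma prime_pr1: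
  assumes "primeideal P (coord_ring (proj_1_n n))"
  shows "primeideal (pr1 P) (coord_ring (proj_n 1))"
proof -
  interpret Y: graded_space "proj_n 1" "CX 1" by (rule graded_proj_n)
  interpret YX: graded_space "proj_1_n n" "CYX n" by (rule graded_proj_1_n)
  note P = YX.prime_closed[OF assms]
  note Pc = ideal_closed[OF subring_CYX P(4)]
  have e: "embed_y f \<in> CYX n" if "f \<in> CX 1" for f :: "'a mpoly" using that by (simp add: embed_y_def)
  show ?thesis
    unfolding Y.coord primeideal_ring_of_iff[OF subring_CX] ideal_ring_of_iff[OF subring_CX] pr1_mem_iff subset_iff Ball_def
    using P(1,5) Pc(1,2,3) e by (auto simp: CX_closed embed_y_simps)
qed

section \<open>Flatness\<close>

context graded_space
begin

lemma common_denominator: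
  assumes P: "primeideal P (coord_ring S)" and "finite V" "V \<subseteq> {J +>\<^bsub>R\<^esub> x | x. x \<in> local_carrier P}"
  shows "\<exists>d G \<Phi>. G \<in> piece S d \<and> G \<notin> P \<and> (\<forall>x\<in>V. \<Phi> x \<in> piece S d \<and> x = J +>\<^bsub>R\<^esub> Fract (\<Phi> x) G)"
  using assms(2,3)
proof (induction V rule: finite_induct)
  case empty
  then show ?case using piece_one prime_closed(1)[OF P] by auto
next
  case (insert x V)
  have "V \<subseteq> {J +>\<^bsub>R\<^esub> x | x. x \<in> local_carrier P}" using insert.prems by (rule insert_subset[THEN iffD1, THEN conjunct2])
  from insert.IH[OF this] obtain d G \<Phi> where G: "G \<in> piece S d" "G \<notin> P"
      "\<forall>y\<in>V. \<Phi> y \<in> piece S d \<and> y = J +>\<^bsub>R\<^esub> Fract (\<Phi> y) G"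
    by (elim exE conjE) (rule that)
  have "x \<in> {J +>\<^bsub>R\<^esub> x | x. x \<in> local_carrier P}" using insert.prems by (rule insert_subset[THEN iffD1, THEN conjunct1])
  then obtain w where w: "x = J +>\<^bsub>R\<^esub> w" "w \<in> local_carrier P" by blast
  then obtain f g e where "w = Fract f g" and x': "f \<in> piece S e" "g \<in> piece S e" "g \<notin> P" by blast
  then have x: "x = J +>\<^bsub>R\<^esub> Fract f g" "f \<in> piece S e" "g \<in> piece S e" "g \<notin> P" using w by simp_all
  have nz: "G \<noteq> 0" "g \<noteq> 0" using G x prime_closed(2)[OF P] by auto
  define \<Psi> where "\<Psi> y = (if y = x then f * G else \<Phi> y * g)" for y
  have "\<Psi> y \<in> piece S (d + e) \<and> y = J +>\<^bsub>R\<^esub> Fract (\<Psi> y) (G * g)" if "y \<in> insert x V" for y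
  proof (cases "y = x")
    case True
    have "Fract f g = Fract (f * G) (G * g)" using nz by (simp add: eq_fract)
    then show ?thesis using True x G piece_mult[of f e G d] by (simp add: \<Psi>_def add.commute)
  next
    case False
    then have "Fract (\<Phi> y) G = Fract (\<Phi> y * g) (G * g)" using nz by (simp add: eq_fract)
    then show ?thesis using False bspec[OF G(3), of y] that x piece_mult by (simp add: \<Psi>_def)
  qed
  moreover have "G * g \<in> piece S (d + e)" by (rule piece_mult[OF G(1) x(3)])
  moreover have "G * g \<notin> P" by (rule prime_closed(3)[OF P G(1) x(3) G(2) x(4)])
  ultimately show ?case by (intro exI[of _ "d + e"] exI[of _ "G * g"] exI[of _ \<Psi>] conjI ballI) blast+
qed

lemma common_annihilator:
  assumes P: "primeideal P (coord_ring S)" and I: "ideal I (ring_of C)"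
    and "finite Z" "\<forall>z\<in>Z. \<exists>e. \<exists>h\<in>piece S e. h \<notin> P \<and> h * z \<in> I"
  shows "\<exists>e. \<exists>H\<in>piece S e. H \<notin> P \<and> (\<forall>z\<in>Z. H * z \<in> I)"
  using assms(3,4)
proof (induction Z rule: finite_induct)
  case empty
  then show ?case using piece_one prime_closed(1)[OF P] by auto
next
  case (insert z Z)
  have "\<exists>e. \<exists>H\<in>piece S e. H \<notin> P \<and> (\<forall>z\<in>Z. H * z \<in> I)" using insert.IH insert.prems by simp
  then obtain e H where H: "H \<in> piece S e" "H \<notin> P" "\<forall>z\<in>Z. H * z \<in> I" by blast
  obtain d h where h: "h \<in> piece S d" "h \<notin> P" "h * z \<in> I" using insert.prems by blast
  have "(h * H) * y \<in> I" if "y \<in> insert z Z" for y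
  proof (cases "y = z")
    case True
    have "H * (h * z) \<in> I" using h H piece_C ideal_closed(3)[OF C I] by blast
    then show ?thesis using True by (simp add: ac_simps)
  next
    case False
    then have "h * (H * y) \<in> I" using that h H piece_C ideal_closed(3)[OF C I] by blast
    then show ?thesis by (simp add: ac_simps)
  qed
  moreover have "h * H \<in> piece S (d + e)" by (rule piece_mult[OF h(1) H(1)])
  moreover have "h * H \<notin> P" by (rule prime_closed(3)[OF P h(1) H(1) h(2) H(2)])
  ultimately show ?case by blast
qed

end

context deformation
begin

lemma embed_y_power: "embed_y (u ^ k) = embed_y u ^ k"
  by (induction k) (auto simp: embed_y_simps)

text \<open>Over the chart \<open>u \<noteq> 0\<close> the coordinates of \<^const>\<open>coord_form\<close>, divided by a power of \<open>u\<close>, are linear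
  over the local ring of the base, and every element is recovered from them. Finitely many elements of
  the stalk involve finitely many denominators and finitely many multipliers that turn relations in the
  stalk into membership in the ideal; one degree \<open>K\<close> accommodates all of them.\<close>

lemma flat_at:
  assumes P: "primeideal P (coord_ring (proj_1_n n))" and uP: "embed_y u \<notin> P"
  shows "flat_module TYPE('x) TYPE('y) (local_ring (proj_n 1) (pr1 P))
    (restrict_scalars (\<lambda>q. ideal_stalk (zero_scheme (proj_1_n n) I) P +>\<^bsub>local_ring (proj_1_n n) P\<^esub> fract_map embed_y q)
      (structure_stalk (proj_1_n n) (zero_scheme (proj_1_n n) I) P))"
proof -
  interpret Y: graded_space "proj_n 1 :: ('k mpoly, nat) proj_space" "CX 1" by (rule graded_proj_n)
  interpret YX: graded_space "proj_1_n n :: ('k mpoly mpoly, nat \<times> nat) proj_space" "CYX n" by (rule graded_proj_1_n)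
  let ?p = "pr1 P"
  have p: "primeideal ?p (coord_ring (proj_n 1))" by (rule prime_pr1[OF P])
  define LA where "LA = Y.local_carrier ?p"
  define LC where "LC = YX.local_carrier P"
  define IP where "IP = YX.stalk I P"
  define h where "h = (fract_map embed_y :: 'k mpoly fract \<Rightarrow> 'k mpoly mpoly fract)"
  have subA: "is_subring LA" unfolding LA_def by (rule Y.local_subring[OF p])
  have subC: "is_subring LC" unfolding LC_def by (rule YX.local_subring[OF P])
  have idealP: "ideal IP (ring_of LC)" unfolding IP_def LC_def by (rule YX.stalk_ideal[OF P ideal_I])
  note Ac = subring_closed[OF subA] and Cc = subring_closed[OF subC]
  note Pp = YX.prime_closed[OF P] and pp = Y.prime_closed[OF p]
  have LA_E: "\<exists>f g e. q = Fract f g \<and> f \<in> piece (proj_n 1) e \<and> g \<in> piece (proj_n 1) e \<and> g \<notin> ?p \<and> g \<noteq> 0 \<and>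
      embed_y f \<in> piece (proj_1_n n) (e, 0) \<and> embed_y g \<in> piece (proj_1_n n) (e, 0) \<and> embed_y g \<notin> P \<and>
      h q = Fract (embed_y f) (embed_y g)" if qA: "q \<in> LA" for q
  proof -
    obtain f g e where q: "q = Fract f g" "f \<in> piece (proj_n 1) e" "g \<in> piece (proj_n 1) e" "g \<notin> ?p"
      using qA unfolding LA_def by auto
    have "g \<noteq> 0" using q(4) pp(2) by blast
    moreover have "embed_y g \<notin> P" using q by (simp add: pr1_mem_iff piece_proj_n)
    ultimately show ?thesis
      using q embed_y_piece[of f e n] embed_y_piece[of g e n] fract_map_embed_y[of g f] unfolding h_def piece_proj_n by blast
  qed
  have h_in: "h q \<in> LC" if "q \<in> LA" for q
    using LA_E[OF that] unfolding LC_def by blast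
  have h_ring: "h (x + y) = h x + h y" "h (x * y) = h x * h y" if xA: "x \<in> LA" and yA: "y \<in> LA" for x y
  proof -
    obtain f g where x: "x = Fract f g" "g \<noteq> 0" "h x = Fract (embed_y f) (embed_y g)" using LA_E[OF xA] by blast
    obtain f' g' where y: "y = Fract f' g'" "g' \<noteq> 0" "h y = Fract (embed_y f') (embed_y g')" using LA_E[OF yA] by blast
    have nz: "g * g' \<noteq> 0" "embed_y g \<noteq> 0" "embed_y g' \<noteq> 0" using x y by (auto simp: embed_y_simps)
    show "h (x + y) = h x + h y" "h (x * y) = h x * h y"
      using x y nz fract_map_embed_y[OF nz(1)] by (simp_all add: h_def embed_y_simps)
  qed
  have h1: "h 1 = 1" using fract_map_embed_y[of 1 1] by (simp add: h_def One_fract_def embed_y_simps)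
  have hom: "subring_hom LA LC h"
    unfolding subring_hom_def using h_in h_ring h1 by blast
  note M = module_quot[OF subC idealP subA hom]
  note Ms = quot_module_simps[OF subC idealP subA hom]
  note Mfs = finsum_quot_module[OF subC idealP subA hom]
  let ?M = "restrict_scalars (\<lambda>q. IP +>\<^bsub>ring_of LC\<^esub> h q) (ring_of LC Quot IP)"
  let ?cs = "\<lambda>x. IP +>\<^bsub>ring_of LC\<^esub> x"
  have uN: "u ^ N \<in> piece (proj_n 1) N" "u ^ N \<notin> ?p" "embed_y (u ^ N) \<notin> P" "u ^ N \<noteq> 0"
    "embed_y (u ^ N) \<in> piece (proj_1_n n) (N, 0)" for N
  proof -
    show "u ^ N \<in> piece (proj_n 1) N" by (simp add: piece_proj_n)
    show "embed_y (u ^ N) \<in> piece (proj_1_n n) (N, 0)" by (rule embed_y_piece) simp_all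
    have uC: "embed_y u \<in> CYX n" using uv_CX by (simp add: embed_y_def)
    have "embed_y u ^ k \<in> CYX n \<and> embed_y u ^ k \<notin> P" for k
      by (induction k) (use uP uC Pp(1,5) CYX_closed in auto)
    then show "embed_y (u ^ N) \<notin> P" by (simp add: embed_y_power)
    then show "u ^ N \<notin> ?p" "u ^ N \<noteq> 0" using Pp(2) by (auto simp: pr1_mem_iff embed_y_simps simp del: power_eq_0_iff power_not_zero)
  qed
  have "flat_module TYPE('x) TYPE('y) (ring_of LA) ?M"
  proof (rule flat_criterion[OF M])
    fix U T1 T2
    assume U: "finite U" "U \<subseteq> carrier ?M" and T1: "finite T1" "T1 \<subseteq> carrier ?M \<times> carrier ?M"
      and T2: "finite T2" "T2 \<subseteq> carrier (ring_of LA) \<times> carrier ?M"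
    interpret M: module "ring_of LA" ?M by (rule M)
    \<comment> \<open>All elements that occur, including the sums and the multiples themselves.\<close>
    define V where "V = U \<union> (fst ` T1 \<union> snd ` T1 \<union> (\<lambda>(x, y). x \<oplus>\<^bsub>?M\<^esub> y) ` T1) \<union> (snd ` T2 \<union> (\<lambda>(c, x). c \<odot>\<^bsub>?M\<^esub> x) ` T2)"
    have T1V: "x \<in> V" "y \<in> V" "x \<oplus>\<^bsub>?M\<^esub> y \<in> V" if "(x, y) \<in> T1" for x y
      unfolding V_def using imageI[OF that, of fst] imageI[OF that, of snd] imageI[OF that, of "\<lambda>(x, y). x \<oplus>\<^bsub>?M\<^esub> y"]
      by simp_all
    have T2V: "x \<in> V" "c \<odot>\<^bsub>?M\<^esub> x \<in> V" if "(c, x) \<in> T2" for c x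
      unfolding V_def using imageI[OF that, of snd] imageI[OF that, of "\<lambda>(c, x). c \<odot>\<^bsub>?M\<^esub> x"] by simp_all
    have V: "finite V" "V \<subseteq> carrier ?M"
    proof -
      show "finite V" unfolding V_def using U T1 T2 by simp
      have "x \<oplus>\<^bsub>?M\<^esub> y \<in> carrier ?M" if "(x, y) \<in> T1" for x y using T1(2) that by (intro M.add.m_closed) auto
      moreover have "c \<odot>\<^bsub>?M\<^esub> x \<in> carrier ?M" if "(c, x) \<in> T2" for c x using T2(2) that by (intro M.smult_closed) auto
      ultimately show "V \<subseteq> carrier ?M" unfolding V_def using U T1 T2 by auto
    qed
    have VC: "V \<subseteq> {?cs x | x. x \<in> YX.local_carrier P}" using V(2) unfolding Ms(1) unfolding LC_def .
    then obtain ed G \<Phi> where G: "G \<in> piece (proj_1_n n) ed" "G \<notin> P"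
      and \<Phi>: "\<forall>x\<in>V. \<Phi> x \<in> piece (proj_1_n n) ed \<and> x = ?cs (Fract (\<Phi> x) G)"
      using YX.common_denominator[OF P V(1) VC] by (elim exE conjE) (rule that)
    have G0: "G \<noteq> 0" using G Pp(2) by blast
    have F_in: "Fract (\<Phi> x) G \<in> LC" if "x \<in> V" for x
      unfolding LC_def using \<Phi> that G by (intro YX.local_carrierI) auto
    have "\<forall>q. \<exists>fg. q \<in> LA \<longrightarrow> (\<exists>e. q = Fract (fst fg) (snd fg) \<and> snd fg \<notin> ?p \<and> snd fg \<noteq> 0 \<and> fst fg \<in> CX 1 \<and> snd fg \<in> CX 1 \<and>
      embed_y (fst fg) \<in> piece (proj_1_n n) (e, 0) \<and> embed_y (snd fg) \<in> piece (proj_1_n n) (e, 0) \<and> embed_y (snd fg) \<notin> P \<and>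
      h q = Fract (embed_y (fst fg)) (embed_y (snd fg)))"
    proof
      fix q
      show "\<exists>fg. q \<in> LA \<longrightarrow> (\<exists>e. q = Fract (fst fg) (snd fg) \<and> snd fg \<notin> ?p \<and> snd fg \<noteq> 0 \<and> fst fg \<in> CX 1 \<and> snd fg \<in> CX 1 \<and>
      embed_y (fst fg) \<in> piece (proj_1_n n) (e, 0) \<and> embed_y (snd fg) \<in> piece (proj_1_n n) (e, 0) \<and> embed_y (snd fg) \<notin> P \<and>
      h q = Fract (embed_y (fst fg)) (embed_y (snd fg)))"
      proof (cases "q \<in> LA")
        case True
        obtain f g e where "q = Fract f g \<and> f \<in> piece (proj_n 1) e \<and> g \<in> piece (proj_n 1) e \<and> g \<notin> ?p \<and> g \<noteq> 0 \<and>
          embed_y f \<in> piece (proj_1_n n) (e, 0) \<and> embed_y g \<in> piece (proj_1_n n) (e, 0) \<and> embed_y g \<notin> P \<and>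
          h q = Fract (embed_y f) (embed_y g)" using LA_E[OF True] by blast
        then show ?thesis by (intro exI[of _ "(f, g)"] impI exI[of _ e], unfold piece_proj_n fst_conv snd_conv) blast
      qed simp
    qed
    then obtain fg where fg: "\<forall>q. q \<in> LA \<longrightarrow> (\<exists>e. q = Fract (fst (fg q)) (snd (fg q)) \<and> snd (fg q) \<notin> ?p \<and> snd (fg q) \<noteq> 0 \<and> fst (fg q) \<in> CX 1 \<and> snd (fg q) \<in> CX 1 \<and>
      embed_y (fst (fg q)) \<in> piece (proj_1_n n) (e, 0) \<and> embed_y (snd (fg q)) \<in> piece (proj_1_n n) (e, 0) \<and> embed_y (snd (fg q)) \<notin> P \<and>
      h q = Fract (embed_y (fst (fg q))) (embed_y (snd (fg q))))"
      by (rule choice[THEN exE])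
    define nu where "nu q = fst (fg q)" for q
    define de where "de q = snd (fg q)" for q
    have nd: "\<exists>e. q = Fract (nu q) (de q) \<and> de q \<notin> ?p \<and> de q \<noteq> 0 \<and> nu q \<in> CX 1 \<and> de q \<in> CX 1 \<and>
      embed_y (nu q) \<in> piece (proj_1_n n) (e, 0) \<and> embed_y (de q) \<in> piece (proj_1_n n) (e, 0) \<and> embed_y (de q) \<notin> P \<and>
      h q = Fract (embed_y (nu q)) (embed_y (de q))" if "q \<in> LA" for q
      unfolding nu_def de_def using fg that by blast
    \<comment> \<open>The given instances of additivity and linearity say that these numerators vanish in the stalk.\<close>
    define Z where "Z = (\<lambda>(x, y). \<Phi> (x \<oplus>\<^bsub>?M\<^esub> y) - (\<Phi> x + \<Phi> y)) ` T1 \<union>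
      (\<lambda>(c, x). embed_y (nu c) * \<Phi> x - embed_y (de c) * \<Phi> (c \<odot>\<^bsub>?M\<^esub> x)) ` T2"
    have finZ: "finite Z" unfolding Z_def using T1(1) T2(1) by simp
    have annZ: "\<exists>e. \<exists>h\<in>piece (proj_1_n n) e. h \<notin> P \<and> h * z \<in> I" if z: "z \<in> Z" for z
    proof -
      consider (add) x y where "(x, y) \<in> T1" "z = \<Phi> (x \<oplus>\<^bsub>?M\<^esub> y) - (\<Phi> x + \<Phi> y)"
        | (sc) c x where "(c, x) \<in> T2" "z = embed_y (nu c) * \<Phi> x - embed_y (de c) * \<Phi> (c \<odot>\<^bsub>?M\<^esub> x)"
        using z unfolding Z_def by auto
      then show ?thesis
      proof cases
        case add
        have xy: "x \<in> V" "y \<in> V" "x \<oplus>\<^bsub>?M\<^esub> y \<in> V" by (rule T1V[OF add(1)])+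
        have "?cs (Fract (\<Phi> (x \<oplus>\<^bsub>?M\<^esub> y)) G) = x \<oplus>\<^bsub>?M\<^esub> y" using \<Phi> xy(3) by simp
        also have "\<dots> = ?cs (Fract (\<Phi> x) G) \<oplus>\<^bsub>?M\<^esub> ?cs (Fract (\<Phi> y) G)" using \<Phi> xy(1,2) by simp
        also have "\<dots> = ?cs (Fract (\<Phi> x) G + Fract (\<Phi> y) G)" by (rule Ms(2)[OF F_in[OF xy(1)] F_in[OF xy(2)]])
        finally have "Fract (\<Phi> (x \<oplus>\<^bsub>?M\<^esub> y)) G - (Fract (\<Phi> x) G + Fract (\<Phi> y) G) \<in> IP"
          using coset_eq_iff[OF subC idealP F_in[OF xy(3)] Cc(3)[OF F_in[OF xy(1)] F_in[OF xy(2)]]] by blast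
        moreover have "Fract (\<Phi> (x \<oplus>\<^bsub>?M\<^esub> y)) G - (Fract (\<Phi> x) G + Fract (\<Phi> y) G) = Fract z G"
          unfolding add(2) using G0 by (simp add: eq_fract algebra_simps)
        ultimately have "Fract z G \<in> YX.stalk I P" unfolding IP_def by simp
        moreover have "z \<in> piece (proj_1_n n) ed"
          unfolding add(2) using \<Phi> xy by (intro YX.piece_diff YX.piece_add) auto
        ultimately show ?thesis using YX.stalk_mem_iff[OF P ideal_I _ G] by blast
      next
        case sc
        have xy: "x \<in> V" "c \<odot>\<^bsub>?M\<^esub> x \<in> V" by (rule T2V[OF sc(1)])+
        have c: "c \<in> LA" using sc(1) T2(2) by auto
        obtain e where e: "de c \<noteq> 0" "embed_y (nu c) \<in> piece (proj_1_n n) (e, 0)" "embed_y (de c) \<in> piece (proj_1_n n) (e, 0)"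
          "embed_y (de c) \<notin> P" "h c = Fract (embed_y (nu c)) (embed_y (de c))" using nd[OF c] by blast
        have e0: "embed_y (de c) \<noteq> 0" using e(1) by (simp add: embed_y_simps)
        have "?cs (Fract (\<Phi> (c \<odot>\<^bsub>?M\<^esub> x)) G) = c \<odot>\<^bsub>?M\<^esub> x" using \<Phi> xy(2) by simp
        also have "\<dots> = c \<odot>\<^bsub>?M\<^esub> ?cs (Fract (\<Phi> x) G)" using \<Phi> xy(1) by simp
        also have "\<dots> = ?cs (h c * Fract (\<Phi> x) G)" by (rule Ms(3)[OF c F_in[OF xy(1)]])
        finally have "h c * Fract (\<Phi> x) G - Fract (\<Phi> (c \<odot>\<^bsub>?M\<^esub> x)) G \<in> IP"
          using coset_eq_iff[OF subC idealP Cc(4)[OF h_in[OF c] F_in[OF xy(1)]] F_in[OF xy(2)]] by simp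
        moreover have "h c * Fract (\<Phi> x) G - Fract (\<Phi> (c \<odot>\<^bsub>?M\<^esub> x)) G = Fract z (embed_y (de c) * G)"
          unfolding e(5) sc(2) using G0 e0 by (simp add: eq_fract algebra_simps)
        ultimately have "Fract z (embed_y (de c) * G) \<in> YX.stalk I P" unfolding IP_def by simp
        moreover have "z \<in> piece (proj_1_n n) ((e, 0) + ed)"
          unfolding sc(2) using \<Phi> xy e by (intro YX.piece_diff YX.piece_mult) auto
        moreover have "embed_y (de c) * G \<in> piece (proj_1_n n) ((e, 0) + ed)" using e G by (intro YX.piece_mult)
        moreover have "embed_y (de c) * G \<notin> P" by (rule Pp(3)[OF e(3) G(1) e(4) G(2)])
        ultimately show ?thesis using YX.stalk_mem_iff[OF P ideal_I] by blast
      qed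
    qed
    have annZ': "\<forall>z\<in>Z. \<exists>e. \<exists>h\<in>piece (proj_1_n n) e. h \<notin> P \<and> h * z \<in> I"
      by (rule ballI, rule annZ)
    obtain ed' H where H: "H \<in> piece (proj_1_n n) ed'" "H \<notin> P" "\<forall>z\<in>Z. H * z \<in> I"
      using YX.common_annihilator[OF P ideal_I finZ annZ'] by (elim exE bexE conjE) (rule that)
    obtain e K where eK: "ed' + ed = (e, K)" by (cases "ed' + ed")
    have HG: "H * G \<in> piece (proj_1_n n) (e, K)" "H * G \<notin> P"
      using YX.piece_mult[OF H(1) G(1)] Pp(3)[OF H(1) G(1) H(2) G(2)] eK by auto
    have H\<Phi>: "H * \<Phi> x \<in> piece (proj_1_n n) (e, K)" if "x \<in> V" for x
      using YX.piece_mult[OF H(1), of "\<Phi> x" ed] \<Phi> that eK by auto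
    let ?N = "e + K"
    define B where "B = standard K"
    \<comment> \<open>Multiplication by \<open>H\<close> moves the relations into \<open>I\<close>, where the coordinate forms vanish.\<close>
    define b where "b \<beta> x = (if x \<in> V then Fract (coord_form K \<beta> (H * \<Phi> x)) (u ^ ?N) else 0)" for \<beta> x
    let ?D = "embed_y (u ^ K) * (H * G)"
    have D: "?D \<in> piece (proj_1_n n) (?N, K)" "?D \<notin> P" "?D \<noteq> 0"
    proof -
      have "(K, 0) + (e, K) = (?N, K)" by (simp add: add.commute)
      then show "?D \<in> piece (proj_1_n n) (?N, K)" using YX.piece_mult[OF uN(5) HG(1)] by metis
      show "?D \<notin> P" by (rule Pp(3)[OF uN(5) HG(1) uN(3) HG(2)])
      then show "?D \<noteq> 0" using Pp(2) by metis
    qed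
    define mm where "mm \<beta> = ?cs (Fract (Poly_Mapping.single \<beta> (u ^ ?N)) ?D)" for \<beta>
    have B: "\<beta> \<in> monomials n" "expo_deg \<beta> = K" "\<beta> \<notin> multiples D0" if "\<beta> \<in> B" for \<beta>
      using that unfolding B_def standard_def by auto
    have mon_in: "Poly_Mapping.single \<beta> f \<in> piece (proj_1_n n) (?N, K)" if "\<beta> \<in> B" "f \<in> CX 1" "homogeneous ?N f" for \<beta> f
      using B[OF that(1)] that(2,3) by (simp add: piece_proj_1_n bihomogeneous_single)
    have mm_in: "Fract (Poly_Mapping.single \<beta> (u ^ ?N)) ?D \<in> LC" if "\<beta> \<in> B" for \<beta>
      unfolding LC_def by (rule YX.local_carrierI[OF mon_in[OF that uk_CX(1) uk_hom(1)] D(1,2)])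
    have cf: "coord_form K \<beta> (H * \<Phi> x) \<in> CX 1" "homogeneous ?N (coord_form K \<beta> (H * \<Phi> x))" if "x \<in> V" for \<beta> x
      using H\<Phi>[OF that] coord_form_CX coord_form_hom by (auto simp: piece_proj_1_n)
    have b_in: "b \<beta> x \<in> LA" for \<beta> x
    proof (cases "x \<in> V")
      case True
      then have "Fract (coord_form K \<beta> (H * \<Phi> x)) (u ^ ?N) \<in> LA"
        unfolding LA_def using cf uN(1,2) by (intro Y.local_carrierI) (auto simp: piece_proj_n)
      then show ?thesis using True by (simp add: b_def)
    qed (simp add: b_def Ac)
    have kill: "coord_form K \<beta> (H * z) = 0" if "\<beta> \<in> B" "z \<in> Z" for \<beta> z
      using coord_form_ideal[of \<beta> K "H * z"] B[OF that(1)] H(3) that(2) by simp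
    have b_add: "b \<beta> (x \<oplus>\<^bsub>?M\<^esub> y) = b \<beta> x + b \<beta> y" if "\<beta> \<in> B" "(x, y) \<in> T1" for \<beta> x y
    proof -
      have xy: "x \<in> V" "y \<in> V" "x \<oplus>\<^bsub>?M\<^esub> y \<in> V" by (rule T1V[OF that(2)])+
      have "\<Phi> (x \<oplus>\<^bsub>?M\<^esub> y) - (\<Phi> x + \<Phi> y) \<in> Z" unfolding Z_def using that(2) by force
      then have "coord_form K \<beta> (H * (\<Phi> (x \<oplus>\<^bsub>?M\<^esub> y) - (\<Phi> x + \<Phi> y))) = 0" by (rule kill[OF that(1)])
      then have "coord_form K \<beta> (H * \<Phi> (x \<oplus>\<^bsub>?M\<^esub> y)) = coord_form K \<beta> (H * \<Phi> x) + coord_form K \<beta> (H * \<Phi> y)"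
        by (simp add: right_diff_distrib distrib_left coord_form_diff coord_form_add)
      then show ?thesis using xy uN(4)[of ?N] by (simp add: b_def eq_fract algebra_simps)
    qed
    have b_smult: "b \<beta> (c \<odot>\<^bsub>?M\<^esub> x) = c * b \<beta> x" if "\<beta> \<in> B" "(c, x) \<in> T2" for \<beta> c x
    proof -
      have xy: "x \<in> V" "c \<odot>\<^bsub>?M\<^esub> x \<in> V" by (rule T2V[OF that(2)])+
      have c: "c \<in> LA" using that(2) T2(2) by auto
      have e: "de c \<noteq> 0" "c = Fract (nu c) (de c)" using nd[OF c] by blast+
      have "embed_y (nu c) * \<Phi> x - embed_y (de c) * \<Phi> (c \<odot>\<^bsub>?M\<^esub> x) \<in> Z" unfolding Z_def using that(2) by force
      then have "coord_form K \<beta> (H * (embed_y (nu c) * \<Phi> x - embed_y (de c) * \<Phi> (c \<odot>\<^bsub>?M\<^esub> x))) = 0" by (rule kill[OF that(1)])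
      moreover have "H * (embed_y (nu c) * \<Phi> x - embed_y (de c) * \<Phi> (c \<odot>\<^bsub>?M\<^esub> x)) =
          embed_y (nu c) * (H * \<Phi> x) - embed_y (de c) * (H * \<Phi> (c \<odot>\<^bsub>?M\<^esub> x))" by (simp add: algebra_simps)
      ultimately have eq: "nu c * coord_form K \<beta> (H * \<Phi> x) = de c * coord_form K \<beta> (H * \<Phi> (c \<odot>\<^bsub>?M\<^esub> x))"
        by (simp add: embed_y_def coord_form_diff coord_form_smult)
      have "c * b \<beta> x = Fract (nu c * coord_form K \<beta> (H * \<Phi> x)) (de c * u ^ ?N)"
        by (subst e(2)) (simp add: b_def xy(1))
      also have "\<dots> = Fract (coord_form K \<beta> (H * \<Phi> (c \<odot>\<^bsub>?M\<^esub> x))) (u ^ ?N)"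
        unfolding eq using e(1) uN(4)[of ?N] by (simp add: eq_fract)
      finally show ?thesis using xy(2) by (simp add: b_def)
    qed
    have expand: "x = (\<Oplus>\<^bsub>?M\<^esub>\<beta>\<in>B. b \<beta> x \<odot>\<^bsub>?M\<^esub> mm \<beta>)" if x: "x \<in> U" for x
    proof -
      have xV: "x \<in> V" unfolding V_def using x by blast
      let ?c = "\<lambda>\<beta>. coord_form K \<beta> (H * \<Phi> x)"
      let ?g = "\<lambda>\<beta>. Fract (Poly_Mapping.single \<beta> (?c \<beta>)) ?D"
      have g_in: "?g \<beta> \<in> LC" if "\<beta> \<in> B" for \<beta>
        unfolding LC_def by (rule YX.local_carrierI[OF mon_in[OF that cf[OF xV]] D(1,2)])
      have coord_term: "b \<beta> x \<odot>\<^bsub>?M\<^esub> mm \<beta> = ?cs (?g \<beta>)" if \<beta>: "\<beta> \<in> B" for \<beta>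
      proof -
        have "b \<beta> x \<odot>\<^bsub>?M\<^esub> mm \<beta> = ?cs (h (b \<beta> x) * Fract (Poly_Mapping.single \<beta> (u ^ ?N)) ?D)"
          unfolding mm_def by (rule Ms(3)[OF b_in mm_in[OF \<beta>]])
        moreover have "h (b \<beta> x) = Fract (embed_y (?c \<beta>)) (embed_y (u ^ ?N))"
          using xV fract_map_embed_y[OF uN(4)] by (simp add: b_def h_def)
        moreover have "Fract (embed_y (?c \<beta>)) (embed_y (u ^ ?N)) * Fract (Poly_Mapping.single \<beta> (u ^ ?N)) ?D = ?g \<beta>"
        proof -
          have "embed_y (?c \<beta>) * Poly_Mapping.single \<beta> (u ^ ?N) = embed_y (u ^ ?N) * Poly_Mapping.single \<beta> (?c \<beta>)"
            by (simp add: embed_y_def mult_single mult.commute)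
          moreover have "embed_y (u ^ ?N) \<noteq> 0" using uN(4) embed_y_simps(3) by blast
          ultimately show ?thesis using D(3) by (simp add: eq_fract)
        qed
        ultimately show ?thesis by simp
      qed
      have sum_fract: "sum ?g B' = Fract (\<Sum>\<beta>\<in>B'. Poly_Mapping.single \<beta> (?c \<beta>)) ?D" for B'
        by (induction B' rule: infinite_finite_induct) (use D(3) in \<open>auto simp: eq_fract Zero_fract_def algebra_simps simp del: fract_collapse\<close>)
      have "(\<Oplus>\<^bsub>?M\<^esub>\<beta>\<in>B. b \<beta> x \<odot>\<^bsub>?M\<^esub> mm \<beta>) = (\<Oplus>\<^bsub>?M\<^esub>\<beta>\<in>B. ?cs (?g \<beta>))"
        using coord_term g_in by (intro M.finsum_cong') (auto simp: Ms(1))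
      also have "\<dots> = ?cs (sum ?g B)"
        using finite_standard g_in by (intro Mfs) (auto simp: B_def)
      also have "\<dots> = ?cs (Fract (\<Phi> x) G)"
      proof -
        let ?F = "embed_y (u ^ K) * (H * \<Phi> x)" and ?S = "\<Sum>\<beta>\<in>B. Poly_Mapping.single \<beta> (?c \<beta>)"
        have FG: "Fract (\<Phi> x) G = Fract ?F ?D"
          using G0 D(3) by (simp add: eq_fract ac_simps)
        have "locally_in_I (?F - ?S)"
          using normal_form[of "H * \<Phi> x" e K] H\<Phi>[OF xV] unfolding B_def embed_y_def piece_proj_1_n by blast
        then obtain M where "embed_y (u ^ M) * (?F - ?S) \<in> I" unfolding locally_in_I_def embed_y_def by blast
        then have "- (embed_y (u ^ M) * (?F - ?S)) \<in> I" by (rule I_closed(5))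
        then have ann: "embed_y (u ^ M) * (?S - ?F) \<in> I"
          by (simp only: mult_minus_right[symmetric] minus_diff_eq)
        have pF: "?F \<in> piece (proj_1_n n) (?N, K)"
          using YX.piece_mult[OF uN(5)[of K] H\<Phi>[OF xV]] by (simp add: add.commute)
        have pS: "?S \<in> piece (proj_1_n n) (?N, K)"
          using mon_in[OF _ cf[OF xV]] YX.piece_zero YX.piece_add by (intro sum_mem) auto
        have "Fract (?S - ?F) ?D \<in> IP"
          unfolding IP_def using YX.stalk_mem_iff[OF P ideal_I YX.piece_diff[OF pS pF] D(1,2)] ann uN(3,5) by blast
        then have "Fract ?S ?D - Fract ?F ?D \<in> IP" by (simp only: diff_fract_same[OF D(3)])
        moreover have "Fract ?S ?D \<in> LC" "Fract ?F ?D \<in> LC"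
          unfolding LC_def using pS pF D by (auto intro: YX.local_carrierI)
        ultimately show ?thesis unfolding sum_fract FG using coset_eq_iff[OF subC idealP] by blast
      qed
      also have "\<dots> = x" using \<Phi> xV by simp
      finally show ?thesis by simp
    qed
    show "\<exists>(B :: expo set) b m. finite B \<and> (\<forall>j\<in>B. b j \<in> carrier ?M \<rightarrow> carrier (ring_of LA)) \<and> m \<in> B \<rightarrow> carrier ?M \<and>
        (\<forall>j\<in>B. \<forall>(x, y)\<in>T1. b j (x \<oplus>\<^bsub>?M\<^esub> y) = b j x \<oplus>\<^bsub>ring_of LA\<^esub> b j y) \<and>
        (\<forall>j\<in>B. \<forall>(c, x)\<in>T2. b j (c \<odot>\<^bsub>?M\<^esub> x) = c \<otimes>\<^bsub>ring_of LA\<^esub> b j x) \<and>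
        (\<forall>x\<in>U. x = (\<Oplus>\<^bsub>?M\<^esub>j\<in>B. b j x \<odot>\<^bsub>?M\<^esub> m j))"
    proof (intro exI[of _ B] exI[of _ b] exI[of _ mm] conjI ballI)
      show "finite B" unfolding B_def by (rule finite_standard)
      show "b \<beta> \<in> carrier ?M \<rightarrow> carrier (ring_of LA)" for \<beta> using b_in by simp
      show "mm \<in> B \<rightarrow> carrier ?M" using mm_in unfolding mm_def Ms(1) by blast
      show "case xy of (x, y) \<Rightarrow> b \<beta> (x \<oplus>\<^bsub>?M\<^esub> y) = b \<beta> x \<oplus>\<^bsub>ring_of LA\<^esub> b \<beta> y" if "\<beta> \<in> B" "xy \<in> T1" for \<beta> xy
        using b_add that by (cases xy) simp
      show "case cx of (c, x) \<Rightarrow> b \<beta> (c \<odot>\<^bsub>?M\<^esub> x) = c \<otimes>\<^bsub>ring_of LA\<^esub> b \<beta> x" if "\<beta> \<in> B" "cx \<in> T2" for \<beta> cx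
        using b_smult that by (cases cx) simp
      show "x = (\<Oplus>\<^bsub>?M\<^esub>\<beta>\<in>B. b \<beta> x \<odot>\<^bsub>?M\<^esub> mm \<beta>)" if "x \<in> U" for x by (rule expand[OF that])
    qed
  qed
  then show ?thesis
    unfolding structure_stalk_def zero_scheme_def YX.local_ring_eq Y.local_ring_eq LA_def LC_def IP_def h_def by simp
qed

end

section \<open>Specialization to a point of the base\<close>

lemma mpoly_induct [case_names zero single add]:
  fixes f :: "'c::comm_ring_1 mpoly"
  assumes "P 0" "\<And>a c. P (Poly_Mapping.single a c)" "\<And>f g. P f \<Longrightarrow> P g \<Longrightarrow> P (f + g)"
  shows "P f"
proof -
  have "(\<Sum>a\<in>Poly_Mapping.keys f. Poly_Mapping.single a (Poly_Mapping.lookup f a)) \<in> {f. P f}"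
    using assms by (intro sum_mem) auto
  then show ?thesis by (simp flip: poly_mapping_eq_sum)
qed

lemma lookup_map_zero: "g 0 = 0 \<Longrightarrow> Poly_Mapping.lookup (Poly_Mapping.map g f) a = g (Poly_Mapping.lookup f a)"
  by (simp add: map.rep_eq when_def)

lemma lookup_embed_x: "Poly_Mapping.lookup (embed_x f) a = Poly_Mapping.single 0 (Poly_Mapping.lookup f a)"
  by (simp add: embed_x_def lookup_map_zero)

lemma embed_x_single [simp]: "embed_x (Poly_Mapping.single a c) = Poly_Mapping.single a (Poly_Mapping.single 0 c)"
  by (rule poly_mapping_eqI) (auto simp: lookup_embed_x lookup_single when_def)

lemma embed_x_add: "embed_x (f + g) = embed_x f + embed_x g"
  by (rule poly_mapping_eqI) (simp add: lookup_embed_x lookup_add single_add)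

lemma embed_x_zero [simp]: "embed_x 0 = 0"
  by (rule poly_mapping_eqI) (simp add: lookup_embed_x)

lemma embed_x_mult: "embed_x (f * g) = embed_x f * embed_x g"
proof (induction f rule: mpoly_induct)
  case (single a c)
  show ?case
    by (induction g rule: mpoly_induct) (simp_all add: mult_single embed_x_add distrib_left)
qed (simp_all add: embed_x_add distrib_right)

lemma embed_x_one: "embed_x 1 = 1"
  using embed_x_single[of 0 1] by simp

lemma embed_x_eq_0_iff: "embed_x f = 0 \<longleftrightarrow> f = 0"
proof
  assume *: "embed_x f = 0"
  have "Poly_Mapping.lookup f a = 0" for a
    using lookup_embed_x[of f a] unfolding * by (metis lookup_single_eq lookup_zero)
  then show "f = 0" by (intro poly_mapping_eqI) simp
qed simp

lemma single_eq_0_iff: "Poly_Mapping.single k c = 0 \<longleftrightarrow> c = 0"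
  by (metis lookup_single_eq lookup_zero single_zero)

lemma keys_embed_x: "Poly_Mapping.keys (embed_x f) = Poly_Mapping.keys f"
proof -
  have "a \<in> Poly_Mapping.keys (embed_x f) \<longleftrightarrow> a \<in> Poly_Mapping.keys f" for a
    by (simp only: in_keys_iff lookup_embed_x single_eq_0_iff)
  then show ?thesis by blast
qed

lemma embed_x_CYX: "f \<in> CX n \<Longrightarrow> embed_x f \<in> CYX n"
  unfolding CYX_def CX_def[of n] mem_Collect_eq keys_embed_x lookup_embed_x using single_CX[OF monomials_zero] by blast

lemma embed_x_piece: "f \<in> piece (proj_n n) d \<Longrightarrow> embed_x f \<in> piece (proj_1_n n) (0, d)"
  unfolding piece_proj_n piece_proj_1_n bihomogeneous_def homogeneous_def[of d]
  by (simp add: embed_x_CYX keys_embed_x lookup_embed_x homogeneous_def[of d "embed_x f"])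

lemma fract_map_embed_x: "g \<noteq> 0 \<Longrightarrow> fract_map embed_x (Fract f g) = Fract (embed_x f) (embed_x g)"
  by (rule fract_map_Fract) (auto simp: embed_x_mult embed_x_eq_0_iff)

lemma lookup_xpow_mult: "Poly_Mapping.lookup (xpow m * g) (b + m) = Poly_Mapping.lookup g b"
  by (induction g rule: mpoly_induct)
     (simp_all add: mult_single distrib_left lookup_add lookup_single when_def add.commute)

lemma lookup_xpow_mult_0: "\<nexists>b'. b = b' + m \<Longrightarrow> Poly_Mapping.lookup (xpow m * g) b = 0"
  by (induction g rule: mpoly_induct)
     (auto simp: mult_single distrib_left lookup_add lookup_single when_def add.commute)

lemma lookup_smult: "Poly_Mapping.lookup (Poly_Mapping.single 0 c * F) a = c * Poly_Mapping.lookup F a"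
  for F :: "'c::comm_ring_1 mpoly"
  by (induction F rule: mpoly_induct)
     (simp_all add: mult_single distrib_left lookup_add lookup_single when_def)

locale chart =
  fixes i0 i1 :: nat
  assumes i01: "i0 \<noteq> i1" "i0 \<le> 1" "i1 \<le> 1"
begin

abbreviation yp :: "nat \<Rightarrow> expo" where "yp e \<equiv> Poly_Mapping.single i0 e"

lemma yp_in [simp]: "yp e \<in> monomials 1" "evar i0 \<in> monomials 1" "evar i1 \<in> monomials 1"
  using i01 by (simp_all add: monomials_eq_from) (simp add: monomials_from_def)

lemma yp_inj: "yp e = yp e' \<longleftrightarrow> e = e'"
  by (metis lookup_single_eq)

lemma yp_add_iff: "s + t = yp e \<longleftrightarrow> (\<exists>i\<le>e. s = yp i \<and> t = yp (e - i))"
proof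
  assume st: "s + t = yp e"
  have "Poly_Mapping.lookup s j + Poly_Mapping.lookup t j = (e when i0 = j)" for j
    using st by (metis lookup_add lookup_single)
  then have *: "Poly_Mapping.lookup s i0 + Poly_Mapping.lookup t i0 = e"
    "\<And>j. j \<noteq> i0 \<Longrightarrow> Poly_Mapping.lookup s j = 0 \<and> Poly_Mapping.lookup t j = 0"
    by (simp, metis (full_types) add_is_0 when_simps(2))
  have "s = yp (Poly_Mapping.lookup s i0)" "t = yp (Poly_Mapping.lookup t i0)"
    using *(2) by (intro poly_mapping_eqI; auto simp: lookup_single when_def)+
  then show "\<exists>i\<le>e. s = yp i \<and> t = yp (e - i)" using *(1) by (metis add_diff_cancel_left' le_add1)
qed (auto simp flip: single_add)

text \<open>\<open>spec e\<close> extracts the coefficient of the \<open>e\<close>-th power of the first variable of the chart. On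
  elements of degree \<open>e\<close> in \<open>y\<close> it is evaluation at the point where the other variable vanishes.\<close>

definition spec :: "nat \<Rightarrow> 'k::field mpoly mpoly \<Rightarrow> 'k mpoly"
  where "spec e F = Poly_Mapping.map (\<lambda>c. Poly_Mapping.lookup c (yp e)) F"

lemma lookup_spec: "Poly_Mapping.lookup (spec e F) a = Poly_Mapping.lookup (Poly_Mapping.lookup F a) (yp e)"
  by (simp add: spec_def lookup_map_zero)

lemma spec_zero [simp]: "spec e 0 = 0"
  by (rule poly_mapping_eqI) (simp add: lookup_spec)

lemma spec_add: "spec e (F + G) = spec e F + spec e G"
  by (rule poly_mapping_eqI) (simp add: lookup_spec lookup_add)

lemma spec_single: "spec e (Poly_Mapping.single a c) = Poly_Mapping.single a (Poly_Mapping.lookup c (yp e))"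
  by (rule poly_mapping_eqI) (simp add: lookup_spec lookup_single when_def)

lemma spec_CX: "F \<in> CYX n \<Longrightarrow> spec e F \<in> CX n"
  by (auto simp: CX_def CYX_def lookup_spec in_keys_iff)

lemma lookup_mult_yp:
  fixes c d :: "'k::field mpoly"
  shows "Poly_Mapping.lookup (c * d) (yp e) = (\<Sum>i\<le>e. Poly_Mapping.lookup c (yp i) * Poly_Mapping.lookup d (yp (e - i)))"
proof (induction c rule: mpoly_induct)
  case (single s x)
  show ?case
  proof (induction d rule: mpoly_induct)
    case (single t y)
    show ?case
    proof (cases "s + t = yp e")
      case True
      then obtain i where i: "i \<le> e" "s = yp i" "t = yp (e - i)" using yp_add_iff by blast
      have "(\<Sum>k\<le>e. Poly_Mapping.lookup (Poly_Mapping.single s x) (yp k) * Poly_Mapping.lookup (Poly_Mapping.single t y) (yp (e - k)))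
         = (\<Sum>k\<le>e. if k = i then x * y else 0)"
        unfolding i by (intro sum.cong) (auto simp: lookup_single when_def yp_inj)
      then show ?thesis using True i(1) by (simp add: mult_single lookup_single)
    next
      case False
      then have "(\<Sum>k\<le>e. Poly_Mapping.lookup (Poly_Mapping.single s x) (yp k) * Poly_Mapping.lookup (Poly_Mapping.single t y) (yp (e - k))) = 0"
        using yp_add_iff[of s t e] by (intro sum.neutral) (auto simp: lookup_single when_def)
      then show ?thesis using False by (simp add: mult_single lookup_single)
    qed
  qed (simp_all add: distrib_left lookup_add sum.distrib)
qed (simp_all add: distrib_right lookup_add sum.distrib)

lemma spec_mult: "spec e (F * G) = (\<Sum>i\<le>e. spec i F * spec (e - i) G)"
proof (induction F rule: mpoly_induct)
  case (single a c)
  have single_sum: "Poly_Mapping.single b (sum f A) = (\<Sum>i\<in>A. Poly_Mapping.single b (f i))"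
    for b :: expo and f :: "nat \<Rightarrow> 'a" and A
    by (induction A rule: infinite_finite_induct) (auto simp: single_add)
  show ?case
  proof (induction G rule: mpoly_induct)
    case (single b d)
    show ?case by (simp add: mult_single spec_single lookup_mult_yp single_sum)
  qed (simp_all add: distrib_left spec_add sum.distrib)
qed (simp_all add: distrib_right spec_add sum.distrib)

lemma spec_bihom:
  assumes "bihomogeneous (e, d) F"
  shows "homogeneous d (spec e' F)" "e' \<noteq> e \<Longrightarrow> spec e' F = 0"
proof -
  have c: "homogeneous e (Poly_Mapping.lookup F a)" for a using bihomogeneous_coeff[OF assms] by simp
  show "homogeneous d (spec e' F)"
    unfolding homogeneous_def
  proof
    fix a assume "a \<in> Poly_Mapping.keys (spec e' F)"
    then have "a \<in> Poly_Mapping.keys F" by (auto simp: in_keys_iff lookup_spec)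
    then show "expo_deg a = d" using assms by (auto simp: bihomogeneous_def homogeneous_def)
  qed
  assume "e' \<noteq> e"
  then have "Poly_Mapping.lookup (Poly_Mapping.lookup F a) (yp e') = 0" for a
    using c[of a] by (metis expo_deg_single homogeneous_def in_keys_iff)
  then show "spec e' F = 0" by (intro poly_mapping_eqI) (simp add: lookup_spec)
qed

lemma spec_mult_bihom:
  assumes "bihomogeneous (e, d) F" "bihomogeneous (e', d') G"
  shows "spec (e + e') (F * G) = spec e F * spec e' G"
proof -
  have "spec (e + e') (F * G) = (\<Sum>i\<le>e + e'. if i = e then spec e F * spec e' G else 0)"
    unfolding spec_mult using spec_bihom(2)[OF assms(1)] by (intro sum.cong) auto
  then show ?thesis by simp
qed

lemma spec_embed_x: "spec e (embed_x f) = (if e = 0 then f else 0)"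
  by (rule poly_mapping_eqI) (auto simp: lookup_spec lookup_embed_x lookup_single when_def dest: arg_cong[of _ _ expo_deg])

lemma spec_embed_y: "spec e (embed_y f) = Poly_Mapping.single 0 (Poly_Mapping.lookup f (yp e))"
  by (simp add: embed_y_def spec_single)

text \<open>The quotient on division by the second variable: monomials that it does not divide are dropped.\<close>

definition div_v :: "'k::field mpoly \<Rightarrow> 'k mpoly"
  where "div_v = Poly_Mapping.map_key (\<lambda>b. b + evar i1)"

lemma lookup_div_v: "Poly_Mapping.lookup (div_v c) b = Poly_Mapping.lookup c (b + evar i1)"
proof -
  have "inj (\<lambda>b. b + evar i1)" by (simp add: inj_def)
  then show ?thesis unfolding div_v_def by (simp add: map_key.rep_eq)
qed

definition rest :: "'k::field mpoly mpoly \<Rightarrow> 'k mpoly mpoly"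
  where "rest F = Poly_Mapping.map div_v F"

lemma div_v_zero: "div_v 0 = 0"
  by (rule poly_mapping_eqI) (simp add: lookup_div_v)

lemma lookup_rest: "Poly_Mapping.lookup (rest F) a = div_v (Poly_Mapping.lookup F a)"
  by (simp add: rest_def lookup_map_zero div_v_zero)

lemma div_v_CX: "c \<in> CX 1 \<Longrightarrow> div_v c \<in> CX 1"
  by (auto simp: CX_def in_keys_iff lookup_div_v subset_iff)

lemma rest_CYX: "F \<in> CYX n \<Longrightarrow> rest F \<in> CYX n"
  using CYX_coeff[of F n] div_v_CX div_v_zero
  by (auto simp: CYX_def in_keys_iff lookup_rest)

lemma monomial_1_cases:
  assumes "b \<in> monomials 1" "\<nexists>b'. b = b' + evar i1"
  shows "b = yp (Poly_Mapping.lookup b i0)"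
proof (rule poly_mapping_eqI)
  fix j
  have "Poly_Mapping.lookup b i1 = 0" using expo_split_var[of b i1] assms(2) by auto
  moreover have "j = i0 \<or> j = i1 \<or> j \<notin> Poly_Mapping.keys b"
    using assms(1) i01 by (auto simp: monomials_def)
  ultimately show "Poly_Mapping.lookup b j = Poly_Mapping.lookup (yp (Poly_Mapping.lookup b i0)) j"
    by (auto simp: lookup_single when_def in_keys_iff)
qed

lemma yp_no_v: "yp e \<noteq> b' + evar i1"
proof
  assume "yp e = b' + evar i1"
  then have "Poly_Mapping.lookup (yp e) i1 = Poly_Mapping.lookup (b' + evar i1) i1" by simp
  then show False using i01 by (simp add: lookup_single lookup_add lookup_evar)
qed

lemma coeff_decomposition:
  fixes c :: "'k::field mpoly"
  assumes c: "c \<in> CX 1" and N: "\<And>b. b \<in> Poly_Mapping.keys c \<Longrightarrow> Poly_Mapping.lookup b i0 \<le> N"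
  shows "c = xpow (evar i1) * div_v c + (\<Sum>e\<le>N. Poly_Mapping.single (yp e) (Poly_Mapping.lookup c (yp e)))"
proof (rule poly_mapping_eqI)
  fix b
  let ?s = "\<Sum>e\<le>N. Poly_Mapping.lookup (Poly_Mapping.single (yp e) (Poly_Mapping.lookup c (yp e))) b"
  have "Poly_Mapping.lookup c b = Poly_Mapping.lookup (xpow (evar i1) * div_v c) b + ?s"
  proof (cases "\<exists>b'. b = b' + evar i1")
    case True
    then obtain b' where b': "b = b' + evar i1" by blast
    have "?s = 0" using yp_no_v b' by (intro sum.neutral) (auto simp: lookup_single when_def)
    then show ?thesis by (simp add: b' lookup_xpow_mult lookup_div_v)
  next
    case False
    have 0: "Poly_Mapping.lookup (xpow (evar i1) * div_v c) b = 0" by (rule lookup_xpow_mult_0[OF False])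
    show ?thesis
    proof (cases "b \<in> Poly_Mapping.keys c")
      case True
      then have "b \<in> monomials 1" using c by (auto simp: CX_def)
      then have b: "b = yp (Poly_Mapping.lookup b i0)" by (rule monomial_1_cases[OF _ False])
      have "?s = (\<Sum>e\<le>N. if e = Poly_Mapping.lookup b i0 then Poly_Mapping.lookup c b else 0)"
        using b by (intro sum.cong) (auto simp: lookup_single when_def)
      then show ?thesis using 0 N[OF True] by simp
    next
      case nk: False
      then have "?s = 0" by (intro sum.neutral) (auto simp: lookup_single when_def in_keys_iff)
      then show ?thesis using 0 nk by (simp add: in_keys_iff)
    qed
  qed
  then show "Poly_Mapping.lookup c b = Poly_Mapping.lookup (xpow (evar i1) * div_v c + (\<Sum>e\<le>N. Poly_Mapping.single (yp e) (Poly_Mapping.lookup c (yp e)))) b"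
    by (simp add: lookup_add lookup_sum)
qed

text \<open>Modulo the second variable of the chart a polynomial is determined by its specializations, which are
  the coefficients of the powers of the first variable.\<close>

lemma decomposition:
  assumes F: "F \<in> CYX n"
  shows "\<exists>N0. \<forall>N\<ge>N0. F = embed_y (xpow (evar i1)) * rest F + (\<Sum>e\<le>N. embed_y (xpow (yp e)) * embed_x (spec e F))"
proof -
  let ?K = "\<Union>a\<in>Poly_Mapping.keys F. Poly_Mapping.keys (Poly_Mapping.lookup F a)"
  have fin: "finite ?K" by simp
  let ?N0 = "\<Sum>b\<in>?K. Poly_Mapping.lookup b i0"
  have bound: "Poly_Mapping.lookup b i0 \<le> ?N0" if "b \<in> Poly_Mapping.keys (Poly_Mapping.lookup F a)" for a b
  proof -
    have "a \<in> Poly_Mapping.keys F" using that by (auto simp: in_keys_iff)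
    then have "b \<in> ?K" using that by blast
    then show ?thesis by (rule member_le_sum) (use fin in auto)
  qed
  have "F = embed_y (xpow (evar i1)) * rest F + (\<Sum>e\<le>N. embed_y (xpow (yp e)) * embed_x (spec e F))" if "?N0 \<le> N" for N
  proof (rule poly_mapping_eqI)
    fix a
    have "Poly_Mapping.lookup F a = xpow (evar i1) * div_v (Poly_Mapping.lookup F a) +
        (\<Sum>e\<le>N. Poly_Mapping.single (yp e) (Poly_Mapping.lookup (Poly_Mapping.lookup F a) (yp e)))"
      using bound that by (intro coeff_decomposition CYX_coeff[OF F]) (meson le_trans)
    also have "\<dots> = Poly_Mapping.lookup (embed_y (xpow (evar i1)) * rest F + (\<Sum>e\<le>N. embed_y (xpow (yp e)) * embed_x (spec e F))) a"
      by (simp add: lookup_add lookup_sum embed_y_def lookup_smult lookup_rest lookup_embed_x lookup_spec mult_single)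
    finally show "Poly_Mapping.lookup F a = \<dots>" .
  qed
  then show ?thesis by blast
qed

lemma decomposition_bihom:
  assumes F: "F \<in> CYX n" "bihomogeneous (e, d) F"
  shows "F = embed_y (xpow (evar i1)) * rest F + embed_y (xpow (yp e)) * embed_x (spec e F)"
proof -
  obtain N0 where N0: "\<forall>N\<ge>N0. F = embed_y (xpow (evar i1)) * rest F + (\<Sum>e\<le>N. embed_y (xpow (yp e)) * embed_x (spec e F))"
    using decomposition[OF F(1)] by blast
  have "(\<Sum>e'\<le>max N0 e. embed_y (xpow (yp e')) * embed_x (spec e' F)) =
      (\<Sum>e'\<le>max N0 e. if e' = e then embed_y (xpow (yp e)) * embed_x (spec e F) else 0)"
    using spec_bihom(2)[OF F(2)] by (intro sum.cong) auto
  also have "\<dots> = embed_y (xpow (yp e)) * embed_x (spec e F)" by simp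
  finally have "(\<Sum>e'\<le>max N0 e. embed_y (xpow (yp e')) * embed_x (spec e' F)) = embed_y (xpow (yp e)) * embed_x (spec e F)" .
  then show ?thesis using N0[rule_format, of "max N0 e"] by simp
qed

lemma rest_bihom:
  assumes F: "F \<in> CYX n" "bihomogeneous (e, d) F"
  shows "bihomogeneous (e, d) (embed_y (xpow (evar i0)) * rest F)"
proof -
  have "homogeneous e (xpow (evar i0) * div_v (Poly_Mapping.lookup F a))" for a
  proof -
    have c: "homogeneous e (Poly_Mapping.lookup F a)" using bihomogeneous_coeff[OF F(2)] by simp
    have "expo_deg b = e - 1 \<and> e \<ge> 1" if "b \<in> Poly_Mapping.keys (div_v (Poly_Mapping.lookup F a))" for b
    proof -
      have "b + evar i1 \<in> Poly_Mapping.keys (Poly_Mapping.lookup F a)"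
        using that by (simp add: in_keys_iff lookup_div_v)
      then have "expo_deg (b + evar i1) = e" using c unfolding homogeneous_def by blast
      then show ?thesis by simp
    qed
    then have h: "homogeneous (e - 1) (div_v (Poly_Mapping.lookup F a))" "e \<ge> 1 \<or> div_v (Poly_Mapping.lookup F a) = 0"
      unfolding homogeneous_def by (blast, metis keys_eq_empty equals0I)
    show ?thesis
    proof (cases "e \<ge> 1")
      case True
      then show ?thesis using homogeneous_mult[of 1 "xpow (evar i0)" "e - 1", OF _ h(1)] by simp
    qed (use h(2) in simp)
  qed
  moreover have "homogeneous d (embed_y (xpow (evar i0)) * rest F)"
    unfolding homogeneous_def
  proof
    fix a assume "a \<in> Poly_Mapping.keys (embed_y (xpow (evar i0)) * rest F)"
    then have "a \<in> Poly_Mapping.keys F"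
      by (auto simp: in_keys_iff embed_y_def lookup_smult lookup_rest div_v_zero)
    then show "expo_deg a = d" using F(2) by (auto simp: bihomogeneous_def homogeneous_def)
  qed
  ultimately show ?thesis
    unfolding bihomogeneous_def by (simp add: embed_y_def lookup_smult lookup_rest)
qed

text \<open>The polynomials that restrict into \<open>T\<close> on the fibre where the second variable vanishes: their residue,
  a polynomial in the first variable over \<open>K[x]\<close>, has all coefficients in \<open>T\<close>.\<close>

definition lift_ideal :: "nat \<Rightarrow> 'k::field mpoly set \<Rightarrow> 'k mpoly mpoly set"
  where "lift_ideal n T = {F \<in> CYX n. \<forall>e. spec e F \<in> T}"

lemma lift_ideal_ideal:
  fixes T :: "'k::field mpoly set"
  assumes T: "ideal T (ring_of (CX n))"
  shows "ideal (lift_ideal n T) (ring_of (CYX n))"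
  unfolding ideal_ring_of_iff[OF subring_CYX]
proof (intro conjI ballI)
  note Tc = ideal_closed[OF subring_CX T]
  show "lift_ideal n T \<subseteq> CYX n" "0 \<in> lift_ideal n T"
    by (auto simp: lift_ideal_def CYX_closed Tc)
  fix x c :: "'k mpoly mpoly" assume x: "x \<in> lift_ideal n T"
  show "x + y \<in> lift_ideal n T" if "y \<in> lift_ideal n T" for y
    using x that by (auto simp: lift_ideal_def CYX_closed Tc spec_add)
  assume c: "c \<in> CYX n"
  have "spec e (c * x) \<in> T" for e
    unfolding spec_mult using x spec_CX[OF c] Tc(3)
    by (intro ideal_sum_closed[OF subring_CX T]) (auto simp: lift_ideal_def)
  then show "c * x \<in> lift_ideal n T" using x c by (auto simp: lift_ideal_def CYX_closed)
qed

lemma lift_ideal_mono: "T \<subseteq> T' \<Longrightarrow> lift_ideal n T \<subseteq> lift_ideal n T'"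
  unfolding lift_ideal_def by blast

text \<open>As in Gauss's lemma: if neither factor lies in the ideal, the product of their first coefficients outside
  \<open>T\<close> is, modulo \<open>T\<close>, a coefficient of the product.\<close>

lemma lift_ideal_prime:
  fixes T :: "'k::field mpoly set"
  assumes T: "primeideal T (ring_of (CX n))"
  shows "primeideal (lift_ideal n T) (ring_of (CYX n))"
  unfolding primeideal_ring_of_iff[OF subring_CYX]
proof (intro conjI ballI impI)
  have Tp: "ideal T (ring_of (CX n))" "1 \<notin> T" "\<And>x y. x \<in> CX n \<Longrightarrow> y \<in> CX n \<Longrightarrow> x * y \<in> T \<Longrightarrow> x \<in> T \<or> y \<in> T"
    using T[unfolded primeideal_ring_of_iff[OF subring_CX]] by auto
  note Tc = ideal_closed[OF subring_CX Tp(1)]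
  show "ideal (lift_ideal n T) (ring_of (CYX n))" by (rule lift_ideal_ideal[OF Tp(1)])
  have "spec 0 1 = (1 :: 'k mpoly)" using spec_embed_x[of 0 1] by (simp add: embed_x_one)
  then have "spec 0 1 \<notin> T" using Tp(2) by simp
  then show "1 \<notin> lift_ideal n T" unfolding lift_ideal_def by blast
  fix F G assume F: "F \<in> CYX n" and G: "G \<in> CYX n" and FG: "F * G \<in> lift_ideal n T"
  show "F \<in> lift_ideal n T \<or> G \<in> lift_ideal n T"
  proof (rule ccontr)
    assume "\<not> ?thesis"
    then have ex: "\<exists>e. spec e F \<notin> T" "\<exists>e. spec e G \<notin> T" using F G by (auto simp: lift_ideal_def)
    define i where "i = (LEAST e. spec e F \<notin> T)"
    define j where "j = (LEAST e. spec e G \<notin> T)"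
    have i: "spec i F \<notin> T" "\<And>e. e < i \<Longrightarrow> spec e F \<in> T"
      unfolding i_def using LeastI_ex[OF ex(1)] not_less_Least by blast+
    have j: "spec j G \<notin> T" "\<And>e. e < j \<Longrightarrow> spec e G \<in> T"
      unfolding j_def using LeastI_ex[OF ex(2)] not_less_Least by blast+
    have sT: "(\<Sum>k\<in>{..i + j} - {i}. spec k F * spec (i + j - k) G) \<in> T" (is "?s \<in> T")
    proof (intro ideal_sum_closed[OF subring_CX Tp(1)])
      fix k assume k: "k \<in> {..i + j} - {i}"
      show "spec k F * spec (i + j - k) G \<in> T"
      proof (cases "k < i")
        case True
        then show ?thesis using i(2) spec_CX[OF G] Tc(4) by blast
      next
        case False
        then have "i + j - k < j" using k by auto
        then show ?thesis using j(2) spec_CX[OF F] Tc(3) by blast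
      qed
    qed
    have "spec (i + j) (F * G) = spec i F * spec j G + (\<Sum>k\<in>{..i + j} - {i}. spec k F * spec (i + j - k) G)"
      unfolding spec_mult by (subst sum.remove[of _ i]) auto
    then have "spec i F * spec j G = spec (i + j) (F * G) - ?s" by simp
    moreover have "spec (i + j) (F * G) \<in> T" using FG by (simp add: lift_ideal_def)
    ultimately have "spec i F * spec j G \<in> T" using Tc(6)[OF _ sT] by simp
    then show False using Tp(3)[OF spec_CX[OF F] spec_CX[OF G]] i(1) j(1) by blast
  qed
qed

lemma lift_ideal_embed_x: "ideal T (ring_of (CX n)) \<Longrightarrow> f \<in> CX n \<Longrightarrow> embed_x f \<in> lift_ideal n T \<longleftrightarrow> f \<in> T"
  using embed_x_CYX[of f n] ideal_closed(1)[OF subring_CX[of n]] by (auto simp: lift_ideal_def spec_embed_x)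

lemma lift_ideal_bihom:
  assumes "ideal T (ring_of (CX n))" "F \<in> CYX n" "bihomogeneous (e, d) F"
  shows "F \<in> lift_ideal n T \<longleftrightarrow> spec e F \<in> T"
  using spec_bihom(2)[OF assms(3)] ideal_closed(1)[OF subring_CX assms(1)] assms(2)
  by (auto simp: lift_ideal_def) metis

lemma embed_y_CYX: "f \<in> CX 1 \<Longrightarrow> embed_y f \<in> CYX n"
  by (simp add: embed_y_def)

text \<open>An ideal that contains the second variable contains a polynomial as soon as it contains the
  specializations.\<close>

lemma lift_ideal_subset:
  assumes T: "ideal T (ring_of (CYX n))" and v: "embed_y (xpow (evar i1)) \<in> T"
    and x: "\<And>f. f \<in> S \<Longrightarrow> embed_x f \<in> T"
  shows "lift_ideal n S \<subseteq> T"
proof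
  note Tc = ideal_closed[OF subring_CYX T]
  fix F assume F: "F \<in> lift_ideal n S"
  then have FC: "F \<in> CYX n" by (simp add: lift_ideal_def)
  obtain N where N: "F = embed_y (xpow (evar i1)) * rest F + (\<Sum>e\<le>N. embed_y (xpow (yp e)) * embed_x (spec e F))"
    using decomposition[OF FC] by blast
  have "embed_y (xpow (evar i1)) * rest F \<in> T" by (rule Tc(4)[OF v rest_CYX[OF FC]])
  moreover have "(\<Sum>e\<le>N. embed_y (xpow (yp e)) * embed_x (spec e F)) \<in> T"
  proof (intro ideal_sum_closed[OF subring_CYX T])
    fix e
    have "embed_x (spec e F) \<in> T" using x F by (simp add: lift_ideal_def)
    then show "embed_y (xpow (yp e)) * embed_x (spec e F) \<in> T" by (rule Tc(3)) (rule embed_y_CYX[OF single_CX[OF yp_in(1)]])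
  qed
  ultimately have "embed_y (xpow (evar i1)) * rest F + (\<Sum>e\<le>N. embed_y (xpow (yp e)) * embed_x (spec e F)) \<in> T"
    by (rule Tc(2))
  then show "F \<in> T" using N by simp
qed

end

lemma piece_one_proj_n: "1 \<in> piece (proj_n n) 0"
  by (simp add: piece_proj_n CX_closed)

lemma pr2_mem_iff: "f \<in> pr2 n P \<longleftrightarrow> f \<in> CX n \<and> embed_x f \<in> P"
  by (simp add: contract_def proj_n_def Kx_eq)

lemma coord_proj_n: "coord_ring (proj_n n) = ring_of (CX n)"
  by (simp add: proj_n_def Kx_eq)

lemma coord_proj_1_n: "coord_ring (proj_1_n n) = ring_of (CYX n)"
  by (simp add: proj_1_n_def Kyx_eq)

lemma ideal_embed_x_preimage:
  assumes "ideal T (ring_of (CYX n))"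
  shows "ideal {f \<in> CX n. embed_x f \<in> T} (ring_of (CX n))"
  unfolding ideal_ring_of_iff[OF subring_CX]
proof (intro conjI ballI)
  note Tc = ideal_closed[OF subring_CYX assms]
  show "0 \<in> {f \<in> CX n. embed_x f \<in> T}" using Tc(1) by (simp add: CX_closed)
  fix x assume x: "x \<in> {f \<in> CX n. embed_x f \<in> T}"
  show "x + y \<in> {f \<in> CX n. embed_x f \<in> T}" if "y \<in> {f \<in> CX n. embed_x f \<in> T}" for y
    using x that Tc(2) by (simp add: CX_closed embed_x_add)
  show "c * x \<in> {f \<in> CX n. embed_x f \<in> T}" if "c \<in> CX n" for c
    using x that Tc(3)[OF _ embed_x_CYX[OF that]] by (simp add: CX_closed embed_x_mult)
qed blast

lemma homogeneous_ideal_iff: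
  assumes "coord_ring S = ring_of C" "is_subring C" "ideal T (ring_of C)"
  shows "homogeneous_ideal S T \<longleftrightarrow> T \<subseteq> genideal (ring_of C) {f \<in> T. \<exists>d. f \<in> piece S d}"
proof -
  have "genideal (ring_of C) {f \<in> T. \<exists>d. f \<in> piece S d} \<subseteq> T"
    by (rule genideal_least[OF assms(2,3)]) blast
  then show ?thesis unfolding homogeneous_ideal_def assms(1) using assms(3) by blast
qed

lemma topspace_zariski: "1 \<in> piece S d \<Longrightarrow> (\<And>P. P \<in> points S \<Longrightarrow> 1 \<notin> P) \<Longrightarrow> topspace (zariski S) = points S"
  unfolding zariski_def by auto

context chart
begin

abbreviation uy :: "'k::field mpoly mpoly" where "uy \<equiv> embed_y (xpow (evar i0))"
abbreviation vy :: "'k::field mpoly mpoly" where "vy \<equiv> embed_y (xpow (evar i1))"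

text \<open>The ideal generated by the second variable, the point of \<open>P\<^sup>1\<close> where it vanishes, described by its
  coefficients.\<close>

definition pt :: "'k::field mpoly set"
  where "pt = {f \<in> CX 1. \<forall>e. Poly_Mapping.lookup f (yp e) = 0}"

lemma irrelevant_1_n: "irrelevant (proj_1_n n) = {{uy, vy}, {embed_x (xpow (evar i)) | i. i \<le> n}}"
proof -
  have "{embed_y (xpow (Poly_Mapping.single i 1)) | i. i \<le> 1} = {uy, vy :: 'a mpoly mpoly}"
  proof -
    have "i \<le> 1 \<longleftrightarrow> i = i0 \<or> i = i1" for i using i01 by auto
    then show ?thesis by (auto simp: evar_def)
  qed
  then show ?thesis by (simp add: proj_1_n_def evar_def)
qed

lemma irrelevant_n: "irrelevant (proj_n n) = {{xpow (evar i) | i. i \<le> n}}"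
  by (simp add: proj_n_def evar_def)

lemma evar_i0: "evar i0 = yp 1"
  by (simp add: evar_def)

lemma lookup_v_yp [simp]: "Poly_Mapping.lookup (xpow (evar i1)) (yp e) = 0"
proof -
  have "yp e \<noteq> evar i1" using yp_no_v[of e 0] by simp
  then show ?thesis by (simp add: lookup_single when_def)
qed

lemma v_pt: "xpow (evar i1) \<in> (pt :: 'k::field mpoly set)"
  by (simp add: pt_def)

lemma u_not_pt: "xpow (evar i0) \<notin> (pt :: 'k::field mpoly set)"
  by (auto simp: pt_def evar_i0 intro!: exI[of _ 1])

lemma pt_ideal: "ideal (pt :: 'k::field mpoly set) (ring_of (CX 1))"
  unfolding ideal_ring_of_iff[OF subring_CX]
  by (auto simp: pt_def CX_closed lookup_add lookup_mult_yp)

lemma pt_eq_genideal: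
  assumes "w = xpow (evar i1) \<or> w = - xpow (evar i1)"
  shows "genideal (Kx 1) {w} = (pt :: 'k::field mpoly set)"
proof
  have wpt: "w \<in> pt" using assms v_pt ideal_closed(5)[OF subring_CX pt_ideal] by blast
  then show "genideal (Kx 1) {w} \<subseteq> pt"
    unfolding Kx_eq by (intro genideal_least[OF subring_CX pt_ideal]) simp
  have wC: "{w} \<subseteq> CX 1" using wpt ideal_closed(7)[OF subring_CX pt_ideal] by blast
  note G = genideal_ring_of[OF subring_CX wC]
  note Gc = ideal_closed[OF subring_CX G(1)]
  have vG: "xpow (evar i1) \<in> genideal (ring_of (CX 1)) {w}"
    using assms G(2) Gc(5) by (metis insert_subset minus_minus)
  show "pt \<subseteq> genideal (Kx 1) {w}"
  proof
    fix f :: "'k mpoly" assume f: "f \<in> pt"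
    then have fC: "f \<in> CX 1" by (simp add: pt_def)
    let ?N = "\<Sum>b\<in>Poly_Mapping.keys f. Poly_Mapping.lookup b i0"
    have "f = xpow (evar i1) * div_v f + (\<Sum>e\<le>?N. Poly_Mapping.single (yp e) (Poly_Mapping.lookup f (yp e)))"
      by (rule coeff_decomposition[OF fC]) (rule member_le_sum; simp)
    also have "\<dots> = xpow (evar i1) * div_v f" using f by (simp add: pt_def)
    finally have eq: "f = xpow (evar i1) * div_v f" .
    have "xpow (evar i1) * div_v f \<in> genideal (ring_of (CX 1)) {w}" by (rule Gc(4)[OF vG div_v_CX[OF fC]])
    then show "f \<in> genideal (Kx 1) {w}" unfolding Kx_eq using eq by simp
  qed
qed

lemma uy_CYX: "uy \<in> CYX n" "vy \<in> CYX n" "embed_y (xpow (yp e)) \<in> CYX n"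
  by (auto intro!: embed_y_CYX)

text \<open>The point of the fibre above a point of \<open>P\<^sup>n\<close>. Its homogeneity comes from \<open>lift_ideal_subset\<close>: the
  ideal is generated by the second variable and by the elements of \<open>q\<close>, hence by forms.\<close>

lemma point_up:
  assumes q: "q \<in> points (proj_n n)"
  shows "lift_ideal n q \<in> points (proj_1_n n)" "pr1 (lift_ideal n q) = pt" "pr2 n (lift_ideal n q) = q"
proof -
  have pq: "primeideal q (ring_of (CX n))" and hq: "homogeneous_ideal (proj_n n) q"
    and iq: "\<not> {xpow (evar i) | i. i \<le> n} \<subseteq> q"
    using q unfolding points_def coord_proj_n irrelevant_n by auto
  have Iq: "ideal q (ring_of (CX n))" "1 \<notin> q" using pq unfolding primeideal_ring_of_iff[OF subring_CX] by auto
  note qc = ideal_closed[OF subring_CX Iq(1)]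
  show p2: "pr2 n (lift_ideal n q) = q"
    using qc(7) lift_ideal_embed_x[OF Iq(1)] by (auto simp: pr2_mem_iff)
  have const: "Poly_Mapping.single 0 c \<in> q \<longleftrightarrow> c = 0" for c
  proof
    assume c: "Poly_Mapping.single 0 c \<in> q"
    show "c = 0"
    proof (rule ccontr)
      assume "c \<noteq> 0"
      have "Poly_Mapping.single 0 (inverse c) * Poly_Mapping.single 0 c \<in> q" using c by (intro qc(3)) auto
      then have "(1 :: 'a mpoly) \<in> q" using \<open>c \<noteq> 0\<close> by (simp add: mult_single)
      then show False using Iq(2) by simp
    qed
  qed (simp add: qc(1))
  have "f \<in> pr1 (lift_ideal n q) \<longleftrightarrow> f \<in> pt" for f
    using embed_y_CYX[of f n] by (auto simp: pr1_mem_iff lift_ideal_def spec_embed_y const pt_def)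
  then show p1: "pr1 (lift_ideal n q) = pt" by blast
  have pP: "primeideal (lift_ideal n q) (ring_of (CYX n))" by (rule lift_ideal_prime[OF pq])
  have IP: "ideal (lift_ideal n q) (ring_of (CYX n))" by (rule lift_ideal_ideal[OF Iq(1)])
  have "homogeneous_ideal (proj_1_n n) (lift_ideal n q)"
    unfolding homogeneous_ideal_iff[OF coord_proj_1_n subring_CYX IP]
  proof (rule lift_ideal_subset)
    let ?G = "{F \<in> lift_ideal n q. \<exists>d. F \<in> piece (proj_1_n n) d}"
    have GC: "?G \<subseteq> CYX n" by (auto simp: lift_ideal_def)
    note G = genideal_ring_of[OF subring_CYX GC]
    show "ideal (genideal (ring_of (CYX n)) ?G) (ring_of (CYX n))" by (rule G(1))
    have "vy \<in> lift_ideal n q" using uy_CYX(2) by (simp add: lift_ideal_def spec_embed_y qc(1))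
    moreover have "vy \<in> piece (proj_1_n n) (1, 0)" by (rule embed_y_piece) auto
    ultimately show "vy \<in> genideal (ring_of (CYX n)) ?G" using G(2) by blast
    have "q \<subseteq> {f \<in> CX n. embed_x f \<in> genideal (ring_of (CYX n)) ?G}"
    proof -
      have "{f \<in> q. \<exists>d. f \<in> piece (proj_n n) d} \<subseteq> {f \<in> CX n. embed_x f \<in> genideal (ring_of (CYX n)) ?G}"
      proof
        fix f assume "f \<in> {f \<in> q. \<exists>d. f \<in> piece (proj_n n) d}"
        then obtain d where f: "f \<in> q" "f \<in> piece (proj_n n) d" by blast
        have fC: "f \<in> CX n" using f qc(7) by blast
        have "embed_x f \<in> ?G" using lift_ideal_embed_x[OF Iq(1) fC] f embed_x_piece by blast
        then show "f \<in> {f \<in> CX n. embed_x f \<in> genideal (ring_of (CYX n)) ?G}" using G(2) fC by blast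
      qed
      from genideal_least[OF subring_CX ideal_embed_x_preimage[OF G(1)] this]
      show ?thesis using hq unfolding homogeneous_ideal_iff[OF coord_proj_n subring_CX Iq(1)] by blast
    qed
    then show "\<And>f. f \<in> q \<Longrightarrow> embed_x f \<in> genideal (ring_of (CYX n)) ?G" by blast
  qed
  moreover have "\<not> V \<subseteq> lift_ideal n q" if V: "V \<in> irrelevant (proj_1_n n)" for V
  proof
    assume sub: "V \<subseteq> lift_ideal n q"
    consider "V = {uy, vy}" | "V = {embed_x (xpow (evar i)) | i. i \<le> n}" using V unfolding irrelevant_1_n by blast
    then show False
    proof cases
      case 1
      then have "xpow (evar i0) \<in> pr1 (lift_ideal n q)" using sub by (auto simp: pr1_mem_iff)
      then show False using p1 u_not_pt by blast
    next
      case 2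
      have "xpow (evar i) \<in> q" if "i \<le> n" for i
      proof -
        have "xpow (evar i) \<in> pr2 n (lift_ideal n q)" using sub 2 that by (auto simp: pr2_mem_iff monomials_eq_from)
        then show ?thesis using p2 by simp
      qed
      then show False using iq by blast
    qed
  qed
  ultimately show "lift_ideal n q \<in> points (proj_1_n n)"
    unfolding points_def coord_proj_1_n using pP by blast
qed

lemma point_over:
  assumes P: "P \<in> points (proj_1_n n)" and p1: "pr1 P = pt"
  shows "vy \<in> P" "uy \<notin> P"
proof -
  show "vy \<in> P" using v_pt p1 pr1_mem_iff by blast
  show "uy \<notin> P" using u_not_pt p1 pr1_mem_iff[of "xpow (evar i0)" P] by auto
qed

text \<open>A point over \<open>pt\<close> contains the second variable and not the first one. By the decomposition of a form it
  contains the form if and only if it contains the specialization, so it is determined by its contraction.\<close>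

lemma point_down:
  assumes P: "P \<in> points (proj_1_n n)" and p1: "pr1 P = pt"
  shows "pr2 n P \<in> points (proj_n n)" "lift_ideal n (pr2 n P) = P"
proof -
  interpret YX: graded_space "proj_1_n n :: ('a mpoly mpoly, nat \<times> nat) proj_space" "CYX n" by (rule graded_proj_1_n)
  have pP: "primeideal P (coord_ring (proj_1_n n))" and hP: "homogeneous_ideal (proj_1_n n) P"
    and iP: "\<not> {embed_x (xpow (evar i)) | i. i \<le> n} \<subseteq> P"
    using P unfolding points_def irrelevant_1_n by auto
  note Pp = YX.prime_closed[OF pP]
  note Pc = ideal_closed[OF subring_CYX Pp(4)]
  note uv = point_over[OF assms]
  let ?q = "pr2 n P"
  have q_eq: "?q = {f \<in> CX n. embed_x f \<in> P}" using pr2_mem_iff by blast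
  have Iq: "ideal ?q (ring_of (CX n))" unfolding q_eq by (rule ideal_embed_x_preimage[OF Pp(4)])
  note qc = ideal_closed[OF subring_CX Iq]
  have pq: "primeideal ?q (ring_of (CX n))"
    unfolding primeideal_ring_of_iff[OF subring_CX]
  proof (intro conjI ballI impI)
    show "1 \<notin> ?q" using Pp(1) by (simp add: pr2_mem_iff embed_x_one)
    fix x y assume "x \<in> CX n" "y \<in> CX n" "x * y \<in> ?q"
    then show "x \<in> ?q \<or> y \<in> ?q" using Pp(5)[of "embed_x x" "embed_x y"] embed_x_CYX by (auto simp: pr2_mem_iff embed_x_mult)
  qed (rule Iq)
  have u_pow: "embed_y (xpow (yp e)) \<notin> P" for e
  proof (induction e)
    case 0
    then show ?case using Pp(1) by (simp add: embed_y_simps)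
  next
    case (Suc e)
    have "embed_y (xpow (yp (Suc e))) = uy * embed_y (xpow (yp e))"
      by (simp add: embed_y_def mult_single evar_def plus_1_eq_Suc flip: single_add)
    then show ?case using Suc uv(2) Pp(5) uy_CYX by metis
  qed
  have spec_in: "spec e F \<in> ?q" if F: "F \<in> P" "F \<in> piece (proj_1_n n) (e, d)" for F e d
  proof -
    have FC: "F \<in> CYX n" "bihomogeneous (e, d) F" using F(2) by (auto simp: piece_proj_1_n)
    have "embed_y (xpow (yp e)) * embed_x (spec e F) = F - vy * rest F"
      using decomposition_bihom[OF FC] by (metis add_diff_cancel_left')
    also have "\<dots> \<in> P" by (rule Pc(6)[OF F(1) Pc(4)[OF uv(1) rest_CYX[OF FC(1)]]])
    finally have "embed_x (spec e F) \<in> P"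
      using Pp(5)[OF uy_CYX(3) embed_x_CYX[OF spec_CX[OF FC(1)]]] u_pow by blast
    then show ?thesis using spec_CX[OF FC(1)] by (simp add: pr2_mem_iff)
  qed
  have P_sub: "P \<subseteq> lift_ideal n T" if T: "ideal T (ring_of (CX n))"
    and sub: "\<And>F e d. F \<in> P \<Longrightarrow> F \<in> piece (proj_1_n n) (e, d) \<Longrightarrow> spec e F \<in> T" for T
  proof -
    have "{F \<in> P. \<exists>d. F \<in> piece (proj_1_n n) d} \<subseteq> lift_ideal n T"
    proof
      fix F assume "F \<in> {F \<in> P. \<exists>d. F \<in> piece (proj_1_n n) d}"
      then obtain e d where F: "F \<in> P" "F \<in> piece (proj_1_n n) (e, d)" by auto
      then show "F \<in> lift_ideal n T"
        using lift_ideal_bihom[OF T, of F e d] sub[OF F] by (simp add: piece_proj_1_n)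
    qed
    from genideal_least[OF subring_CYX lift_ideal_ideal[OF T] this]
    show ?thesis using hP unfolding homogeneous_ideal_iff[OF coord_proj_1_n subring_CYX Pp(4)] by blast
  qed
  show "lift_ideal n ?q = P"
  proof
    show "P \<subseteq> lift_ideal n ?q" by (rule P_sub[OF Iq spec_in])
    show "lift_ideal n ?q \<subseteq> P" by (rule lift_ideal_subset[OF Pp(4) uv(1)]) (simp add: pr2_mem_iff)
  qed
  let ?G = "{f \<in> ?q. \<exists>d. f \<in> piece (proj_n n) d}"
  have GC: "?G \<subseteq> CX n" using qc(7) by blast
  note G = genideal_ring_of[OF subring_CX GC]
  have "P \<subseteq> lift_ideal n (genideal (ring_of (CX n)) ?G)"
  proof (rule P_sub[OF G(1)])
    fix F e d assume F: "F \<in> P" "F \<in> piece (proj_1_n n) (e, d)"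
    then have "spec e F \<in> piece (proj_n n) d" using spec_bihom(1) spec_CX by (auto simp: piece_proj_1_n piece_proj_n)
    then show "spec e F \<in> genideal (ring_of (CX n)) ?G" using spec_in[OF F] G(2) by blast
  qed
  then have "?q \<subseteq> genideal (ring_of (CX n)) ?G"
    using lift_ideal_embed_x[OF G(1)] pr2_mem_iff by blast
  then have "homogeneous_ideal (proj_n n) ?q"
    unfolding homogeneous_ideal_iff[OF coord_proj_n subring_CX Iq] .
  moreover have "\<not> {xpow (evar i) | i. i \<le> n} \<subseteq> ?q"
    using iP by (auto simp: pr2_mem_iff)
  ultimately show "?q \<in> points (proj_n n)"
    unfolding points_def coord_proj_n irrelevant_n using pq by blast
qed

text \<open>The basic open set of a form \<open>F\<close> corresponds to that of the specialization of \<open>F\<close>, and the one of \<open>f\<close>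
  to that of its image in \<open>K[y, x]\<close>.\<close>

lemma homeomorphic_fibre:
  fixes W :: "'a::field mpoly set set"
  assumes W: "W \<subseteq> points (proj_n n)" and Z: "Z = {P \<in> points (proj_1_n n). pr1 P = pt \<and> pr2 n P \<in> W}"
  shows "homeomorphic_map (subtopology (zariski (proj_1_n n)) Z) (subtopology (zariski (proj_n n)) W) (pr2 n)"
proof -
  let ?X = "zariski (proj_1_n n) :: 'a mpoly mpoly set topology"
    and ?Y = "zariski (proj_n n) :: 'a mpoly set topology"
  have one: "1 \<notin> P" if "P \<in> points (proj_1_n n)" for P :: "'a mpoly mpoly set"
    using that primeideal_ring_of_iff[OF subring_CYX] unfolding points_def coord_proj_1_n by blast
  have one': "1 \<notin> q" if "q \<in> points (proj_n n)" for q :: "'a mpoly set"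
    using that primeideal_ring_of_iff[OF subring_CX] unfolding points_def coord_proj_n by blast
  interpret YX: graded_space "proj_1_n n :: ('a mpoly mpoly, nat \<times> nat) proj_space" "CYX n" by (rule graded_proj_1_n)
  have tX: "topspace ?X = points (proj_1_n n)" by (rule topspace_zariski[OF YX.piece_one one])
  have tY: "topspace ?Y = points (proj_n n)" by (rule topspace_zariski[OF piece_one_proj_n one'])
  have tZ: "topspace (subtopology ?X Z) = Z" "topspace (subtopology ?Y W) = W"
    using tX tY W Z by auto
  have up: "lift_ideal n q \<in> Z \<and> pr2 n (lift_ideal n q) = q" if "q \<in> W" for q
    using point_up[of q n] that W unfolding Z by auto
  have down: "pr2 n P \<in> W \<and> lift_ideal n (pr2 n P) = P" if "P \<in> Z" for P
    using point_down(2)[of P n] that unfolding Z by blast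
  have c1: "continuous_map (subtopology ?X Z) ?Y (pr2 n)"
    unfolding zariski_def[of "proj_n n"] continuous_on_generated_topo_iff tZ
  proof (intro conjI allI impI)
    fix U :: "'a mpoly set set" assume "U \<in> {{P \<in> points (proj_n n). f \<notin> P} | f. \<exists>d. f \<in> piece (proj_n n) d}"
    then obtain f d where U: "U = {P \<in> points (proj_n n). f \<notin> P}" "f \<in> piece (proj_n n) d" by blast
    have "openin ?X {P \<in> points (proj_1_n n). embed_x f \<notin> P}"
      unfolding zariski_def using embed_x_piece[OF U(2)] by (intro topology_generated_by_Basis) blast
    moreover have "pr2 n -` U \<inter> Z = {P \<in> points (proj_1_n n). embed_x f \<notin> P} \<inter> Z"
      using down W U(2) unfolding U(1) Z by (auto simp: pr2_mem_iff piece_proj_n)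
    ultimately show "openin (subtopology ?X Z) (pr2 n -` U \<inter> Z)"
      unfolding openin_subtopology by blast
  next
    show "pr2 n ` Z \<subseteq> \<Union> {{P \<in> points (proj_n n). f \<notin> P} | f. \<exists>d. f \<in> piece (proj_n n) d}"
      unfolding tY[unfolded zariski_def topology_generated_by_topspace] using down W by blast
  qed
  have c2: "continuous_map (subtopology ?Y W) ?X (lift_ideal n)"
    unfolding zariski_def[of "proj_1_n n"] continuous_on_generated_topo_iff tZ
  proof (intro conjI allI impI)
    fix U :: "'a mpoly mpoly set set" assume "U \<in> {{P \<in> points (proj_1_n n). F \<notin> P} | F. \<exists>d. F \<in> piece (proj_1_n n) d}"
    then obtain F e d where U: "U = {P \<in> points (proj_1_n n). F \<notin> P}" "F \<in> piece (proj_1_n n) (e, d)" by auto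
    have F: "F \<in> CYX n" "bihomogeneous (e, d) F" using U(2) by (auto simp: piece_proj_1_n)
    have sF: "spec e F \<in> piece (proj_n n) d" using F spec_bihom(1) spec_CX by (auto simp: piece_proj_n)
    have "openin ?Y {q \<in> points (proj_n n). spec e F \<notin> q}"
      unfolding zariski_def using sF by (intro topology_generated_by_Basis) blast
    moreover have "lift_ideal n -` U \<inter> W = {q \<in> points (proj_n n). spec e F \<notin> q} \<inter> W"
    proof -
      have "F \<in> lift_ideal n q \<longleftrightarrow> spec e F \<in> q" if "q \<in> W" for q
      proof -
        have "ideal q (ring_of (CX n))"
          using that W primeideal_ring_of_iff[OF subring_CX] unfolding points_def coord_proj_n by blast
        then show ?thesis by (rule lift_ideal_bihom[OF _ F])
      qed
      then show ?thesis using up W unfolding U(1) Z by blast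
    qed
    ultimately show "openin (subtopology ?Y W) (lift_ideal n -` U \<inter> W)"
      unfolding openin_subtopology by blast
  next
    show "lift_ideal n ` W \<subseteq> \<Union> {{P \<in> points (proj_1_n n). f \<notin> P} | f. \<exists>d. f \<in> piece (proj_1_n n) d}"
      unfolding tX[unfolded zariski_def topology_generated_by_topspace] using up Z by blast
  qed
  have "homeomorphic_maps (subtopology ?X Z) (subtopology ?Y W) (pr2 n) (lift_ideal n)"
    unfolding homeomorphic_maps_def continuous_map_in_subtopology tZ
    using c1 c2 up down by blast
  then show ?thesis unfolding homeomorphic_map_maps by blast
qed

end

section \<open>The fibre\<close>

text \<open>A ring homomorphism induces an isomorphism of quotients if it pulls the second ideal back to the
  first and hits every class.\<close>

lemma quotient_iso:
  fixes \<phi> :: "'a::comm_ring_1 \<Rightarrow> 'b::comm_ring_1"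
  assumes A: "is_subring A" "ideal K (ring_of A)" and C: "is_subring C" "ideal Z (ring_of C)"
    and \<phi>: "subring_hom A C \<phi>"
    and ker: "\<And>x. x \<in> A \<Longrightarrow> \<phi> x \<in> Z \<longleftrightarrow> x \<in> K" and surj: "\<And>y. y \<in> C \<Longrightarrow> \<exists>x\<in>A. y - \<phi> x \<in> Z"
  shows "\<exists>h\<in>ring_iso (ring_of A Quot K) (ring_of C Quot Z). \<forall>x\<in>A. h (K +>\<^bsub>ring_of A\<^esub> x) = Z +>\<^bsub>ring_of C\<^esub> \<phi> x"
proof -
  have ph: "\<phi> x \<in> C" "\<phi> (x + y) = \<phi> x + \<phi> y" "\<phi> (x * y) = \<phi> x * \<phi> y" "\<phi> 1 = 1" if "x \<in> A" "y \<in> A" for x y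
    using \<phi> that unfolding subring_hom_def by auto
  note Ac = subring_closed[OF A(1)]
  note qa = quot_simps[OF A] and qc = quot_simps[OF C]
  have diff: "\<phi> (x - y) = \<phi> x - \<phi> y" if "x \<in> A" "y \<in> A" for x y
    using ph(2)[of "x - y" y] that Ac by simp
  have coset: "K +>\<^bsub>ring_of A\<^esub> x = K +>\<^bsub>ring_of A\<^esub> y \<longleftrightarrow> Z +>\<^bsub>ring_of C\<^esub> \<phi> x = Z +>\<^bsub>ring_of C\<^esub> \<phi> y"
    if "x \<in> A" "y \<in> A" for x y
    using coset_eq_iff[OF A that] coset_eq_iff[OF C ph(1)[OF that(1,1)] ph(1)[OF that(2,2)]]
      ker[OF Ac(6)[OF that]] diff[OF that] by simp
  define h where "h X = Z +>\<^bsub>ring_of C\<^esub> \<phi> (SOME x. x \<in> A \<and> X = K +>\<^bsub>ring_of A\<^esub> x)" for X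
  have h: "h (K +>\<^bsub>ring_of A\<^esub> x) = Z +>\<^bsub>ring_of C\<^esub> \<phi> x" if x: "x \<in> A" for x
  proof -
    let ?s = "SOME y. y \<in> A \<and> K +>\<^bsub>ring_of A\<^esub> x = K +>\<^bsub>ring_of A\<^esub> y"
    have "?s \<in> A \<and> K +>\<^bsub>ring_of A\<^esub> x = K +>\<^bsub>ring_of A\<^esub> ?s" by (rule someI[of _ x]) (simp add: x)
    then show ?thesis unfolding h_def using coset[OF x, of ?s] by simp
  qed
  have "h \<in> ring_iso (ring_of A Quot K) (ring_of C Quot Z)"
  proof (rule ring_iso_memI)
    fix X Y assume "X \<in> carrier (ring_of A Quot K)" "Y \<in> carrier (ring_of A Quot K)"
    then obtain x y where xy: "X = K +>\<^bsub>ring_of A\<^esub> x" "x \<in> A" "Y = K +>\<^bsub>ring_of A\<^esub> y" "y \<in> A" unfolding qa(1) by blast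
    have in_A: "x * y \<in> A" "x + y \<in> A" using xy Ac by auto
    show "h X \<in> carrier (ring_of C Quot Z)" unfolding qc(1) using h xy(1,2) ph(1) by blast
    show "h (X \<otimes>\<^bsub>ring_of A Quot K\<^esub> Y) = h X \<otimes>\<^bsub>ring_of C Quot Z\<^esub> h Y"
      using xy in_A by (simp add: qa(2) qc(2) h ph)
    show "h (X \<oplus>\<^bsub>ring_of A Quot K\<^esub> Y) = h X \<oplus>\<^bsub>ring_of C Quot Z\<^esub> h Y"
      using xy in_A by (simp add: qa(3) qc(3) h ph)
  next
    show "h \<one>\<^bsub>ring_of A Quot K\<^esub> = \<one>\<^bsub>ring_of C Quot Z\<^esub>"
      unfolding qa(4) qc(4) using h[OF Ac(2)] ph(4)[OF Ac(2,2)] by simp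
    show "bij_betw h (carrier (ring_of A Quot K)) (carrier (ring_of C Quot Z))"
      unfolding bij_betw_def
    proof
      show "inj_on h (carrier (ring_of A Quot K))"
      proof (rule inj_onI)
        fix X Y assume "X \<in> carrier (ring_of A Quot K)" "Y \<in> carrier (ring_of A Quot K)" and eq: "h X = h Y"
        then obtain x y where xy: "X = K +>\<^bsub>ring_of A\<^esub> x" "x \<in> A" "Y = K +>\<^bsub>ring_of A\<^esub> y" "y \<in> A" unfolding qa(1) by blast
        then show "X = Y" using eq coset[OF xy(2,4)] h by simp
      qed
      show "h ` carrier (ring_of A Quot K) = carrier (ring_of C Quot Z)"
      proof
        show "h ` carrier (ring_of A Quot K) \<subseteq> carrier (ring_of C Quot Z)"
          unfolding qa(1) qc(1) using h ph(1) by blast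
        show "carrier (ring_of C Quot Z) \<subseteq> h ` carrier (ring_of A Quot K)"
        proof
          fix Y assume "Y \<in> carrier (ring_of C Quot Z)"
          then obtain y where y: "Y = Z +>\<^bsub>ring_of C\<^esub> y" "y \<in> C" unfolding qc(1) by blast
          obtain x where x: "x \<in> A" "y - \<phi> x \<in> Z" using surj[OF y(2)] by blast
          then have "Y = h (K +>\<^bsub>ring_of A\<^esub> x)" using coset_eq_iff[OF C y(2) ph(1)[OF x(1,1)]] h y(1) by simp
          then show "Y \<in> h ` carrier (ring_of A Quot K)" unfolding qa(1) using x(1) by blast
        qed
      qed
    qed
  qed
  then show ?thesis using h by blast
qed

definition monomial_span :: "nat \<Rightarrow> expo set \<Rightarrow> 'k::field mpoly set"
  where "monomial_span n T = {f \<in> CX n. Poly_Mapping.keys f \<subseteq> T}"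

lemma monomial_span_ideal:
  assumes "\<And>b m. m \<in> T \<Longrightarrow> b + m \<in> T"
  shows "ideal (monomial_span n T) (ring_of (CX n))"
  unfolding ideal_ring_of_iff[OF subring_CX]
proof (intro conjI ballI)
  fix x y :: "'k::field mpoly" assume x: "x \<in> monomial_span n T"
  show "x + y \<in> monomial_span n T" if "y \<in> monomial_span n T"
    using x that keys_add[of x y] by (auto simp: monomial_span_def CX_closed)
  assume "y \<in> CX n"
  then show "y * x \<in> monomial_span n T"
    using x keys_mult[of y x] assms by (fastforce simp: monomial_span_def CX_closed)
qed (auto simp: monomial_span_def CX_closed)

context deformation
begin

sublocale ch?: chart i0 i1
  by unfold_locales (use i01 in auto)

definition J0 :: "'k mpoly set"
  where "J0 = monomial_span n (multiples D0)"

lemma J0_ideal: "ideal J0 (ring_of (CX n))"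
  unfolding J0_def by (rule monomial_span_ideal) (rule multiples_add)

text \<open>Setting \<open>u = 1\<close> and \<open>v = 0\<close> turns the generator \<open>u c + v c'\<close> into \<open>c\<close>.\<close>

lemma I_subset_lift: "I \<subseteq> lift_ideal n J0"
  unfolding I_eq Kyx_eq
proof (rule genideal_least[OF subring_CYX lift_ideal_ideal[OF J0_ideal]], rule subsetI)
  fix F :: "'k mpoly mpoly"
  assume F: "F \<in> xpow ` (D0 \<inter> D1) \<union> {Poly_Mapping.single c u + Poly_Mapping.single c' v | c c'. (c, c') \<in> Q}"
  then have FC: "F \<in> CYX n" using gens_CYX by blast
  have single_J0: "Poly_Mapping.single m k \<in> J0" if "m \<in> D0" for m k
    using that D0(1) multiplesI[OF that, of 0] by (auto simp: J0_def monomial_span_def CX_closed)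
  have "spec e F \<in> J0" for e
    using F
  proof
    assume "F \<in> xpow ` (D0 \<inter> D1)"
    then show ?thesis using single_J0 by (auto simp: spec_single)
  next
    assume "F \<in> {Poly_Mapping.single c u + Poly_Mapping.single c' v | c c'. (c, c') \<in> Q}"
    then obtain c c' where c: "F = Poly_Mapping.single c u + Poly_Mapping.single c' v" "(c, c') \<in> Q" by blast
    have "Poly_Mapping.lookup v (yp e) = 0" using v_pt by (simp add: pt_def)
    then show ?thesis using single_J0 Q_mem(1)[OF c(2)] by (simp add: c(1) spec_add spec_single)
  qed
  then show "F \<in> lift_ideal n J0" using FC by (simp add: lift_ideal_def)
qed

text \<open>The points of the fibre of the family are those of the scheme of \<open>J0\<close>.\<close>

lemma J0_subset_iff:
  assumes q: "ideal q (ring_of (CX n))"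
  shows "I \<subseteq> lift_ideal n q \<longleftrightarrow> J0 \<subseteq> q"
proof
  assume "J0 \<subseteq> q"
  then show "I \<subseteq> lift_ideal n q" using I_subset_lift lift_ideal_mono by blast
next
  assume I: "I \<subseteq> lift_ideal n q"
  have D0q: "xpow m \<in> q" if m: "m \<in> D0" for m
  proof (cases "m \<in> D1")
    case True
    then have "xpow m \<in> lift_ideal n q" using gen_mem(1) I that by blast
    then have "spec 0 (xpow m) \<in> q" by (simp add: lift_ideal_def)
    then show ?thesis by (simp add: spec_single)
  next
    case False
    then obtain c' where c: "(m, c') \<in> Q" using m fst_Q by force
    then have "Poly_Mapping.single m u + Poly_Mapping.single c' v \<in> lift_ideal n q" using gen_mem(2) I by blast
    then have "spec 1 (Poly_Mapping.single m u + Poly_Mapping.single c' v) \<in> q" by (simp add: lift_ideal_def)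
    moreover have "Poly_Mapping.lookup v (yp 1) = 0" using v_pt by (simp add: pt_def)
    ultimately show ?thesis by (simp add: spec_add spec_single evar_i0)
  qed
  show "J0 \<subseteq> q"
  proof
    fix f assume f: "f \<in> J0"
    have "(\<Sum>a\<in>Poly_Mapping.keys f. Poly_Mapping.single a (Poly_Mapping.lookup f a)) \<in> q"
    proof (intro ideal_sum_closed[OF subring_CX q])
      fix a assume a: "a \<in> Poly_Mapping.keys f"
      then have "a \<in> multiples D0" "a \<in> monomials n" using f by (auto simp: J0_def monomial_span_def CX_def)
      then obtain b m where bm: "a = b + m" "m \<in> D0" unfolding multiples_def by blast
      have "b \<in> monomials n" using \<open>a \<in> monomials n\<close> bm by simp
      then have "Poly_Mapping.single b (Poly_Mapping.lookup f a) * xpow m \<in> q"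
        using D0q[OF bm(2)] by (intro ideal_closed(3)[OF subring_CX q]) auto
      then show "Poly_Mapping.single a (Poly_Mapping.lookup f a) \<in> q" by (simp add: bm(1) mult_single)
    qed
    then show "f \<in> q" by (simp flip: poly_mapping_eq_sum)
  qed
qed

end

lemma add_fract_same: "(D :: 'a::idom) \<noteq> 0 \<Longrightarrow> Fract a D + Fract b D = Fract (a + b) D"
  by (simp add: eq_fract algebra_simps)

context deformation
begin

text \<open>The local rings of the fibre. Restricting fractions along the embedding of \<open>K[x]\<close> and specializing
  them are inverse to each other modulo the ideal of the fibre: \<open>F/G\<close> differs from its specialization by
  a multiple of \<open>v/u\<close>, and the specialization of the ideal \<open>I\<close> is \<open>J0\<close>.\<close>

lemma fibre_stalk_iso:
  assumes P: "P \<in> points (proj_1_n n)" and p1: "pr1 P = pt"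
    and q: "q = pr2 n P"
    and ZP: "ZP = genideal (local_ring (proj_1_n n) P)
       (ideal_stalk (zero_scheme (proj_1_n n) I) P \<union> fract_map embed_y ` ideal_stalk (zero_scheme (proj_n 1) pt) pt)"
  shows "\<exists>h\<in>ring_iso (local_ring (proj_n n) q Quot ideal_stalk (zero_scheme (proj_n n) J0) q)
      (local_ring (proj_1_n n) P Quot ZP).
    \<forall>x\<in>carrier (local_ring (proj_n n) q).
      h (ideal_stalk (zero_scheme (proj_n n) J0) q +>\<^bsub>local_ring (proj_n n) q\<^esub> x) =
      ZP +>\<^bsub>local_ring (proj_1_n n) P\<^esub> fract_map embed_x x"
proof -
  interpret Y: graded_space "proj_n 1 :: ('k mpoly, nat) proj_space" "CX 1" by (rule graded_proj_n)
  interpret X: graded_space "proj_n n :: ('k mpoly, nat) proj_space" "CX n" by (rule graded_proj_n)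
  interpret YX: graded_space "proj_1_n n :: ('k mpoly mpoly, nat \<times> nat) proj_space" "CYX n" by (rule graded_proj_1_n)
  have pP: "primeideal P (coord_ring (proj_1_n n))" using P by (simp add: points_def)
  have pq: "primeideal q (coord_ring (proj_n n))" using point_down(1)[OF P p1] q by (simp add: points_def)
  have Pq: "P = lift_ideal n q" using point_down(2)[OF P p1] q by simp
  note Pp = YX.prime_closed[OF pP] and qp = X.prime_closed[OF pq]
  note uv = point_over[OF P p1]
  define A where "A = X.local_carrier q"
  define C where "C = YX.local_carrier P"
  define K where "K = X.stalk J0 q"
  define IP where "IP = YX.stalk I P"
  define m where "m = fract_map embed_y ` Y.stalk pt pt"
  have ZP_eq: "ZP = genideal (ring_of C) (IP \<union> m)"
    unfolding ZP zero_scheme_def YX.local_ring_eq C_def IP_def m_def by simp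
  have subA: "is_subring A" unfolding A_def by (rule X.local_subring[OF pq])
  have subC: "is_subring C" unfolding C_def by (rule YX.local_subring[OF pP])
  note Cc = subring_closed[OF subC]
  have idK: "ideal K (ring_of A)" unfolding K_def A_def by (rule X.stalk_ideal[OF pq J0_ideal])
  have P_bihom: "F \<in> P \<longleftrightarrow> spec e F \<in> q" if "F \<in> piece (proj_1_n n) (e, d)" for F e d
    unfolding Pq using that qp(4) by (intro lift_ideal_bihom) (auto simp: piece_proj_1_n)
  have P_x: "embed_x g \<in> P \<longleftrightarrow> g \<in> q" if "g \<in> CX n" for g
    using q that by (simp add: pr2_mem_iff)
  have pt_not: "embed_y g \<notin> P" if "g \<in> CX 1" "g \<notin> pt" for g
    using that p1 by (metis pr1_mem_iff)
  have u_piece: "uy \<in> piece (proj_1_n n) (1, 0)" "vy \<in> piece (proj_1_n n) (1, 0)"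
    by (rule embed_y_piece; simp)+
  have uy0: "(uy :: 'k mpoly mpoly) \<noteq> 0" using uv(2) Pp(2) by metis
  \<comment> \<open>the generator of the maximal ideal of the base\<close>
  have vu: "Fract vy uy \<in> m"
  proof -
    have "Fract v u \<in> Y.stalk pt pt"
      using v_pt u_not_pt by (intro Y.stalkI[of _ _ 1]) (auto simp: piece_proj_n)
    moreover have "fract_map embed_y (Fract v u) = Fract vy uy"
      using uy0 by (intro fract_map_embed_y) (auto simp: embed_y_simps)
    ultimately show ?thesis unfolding m_def by force
  qed
  have m_elem: "\<exists>f g e. w = Fract (embed_y f) (embed_y g) \<and> f \<in> pt \<and> embed_y f \<in> piece (proj_1_n n) (e, 0) \<and>
      embed_y g \<in> piece (proj_1_n n) (e, 0) \<and> embed_y g \<notin> P" if w: "w \<in> m" for w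
  proof -
    obtain f g e where fg: "w = fract_map embed_y (Fract f g)" "f \<in> pt" "f \<in> piece (proj_n 1) e" "g \<in> piece (proj_n 1) e" "g \<notin> pt"
      using w unfolding m_def by blast
    have gP: "embed_y g \<notin> P" using pt_not fg by (simp add: piece_proj_n)
    then have "g \<noteq> 0" using Pp(2) by (auto simp: embed_y_simps)
    then have "w = Fract (embed_y f) (embed_y g)" unfolding fg(1) by (rule fract_map_embed_y)
    moreover have "embed_y f \<in> piece (proj_1_n n) (e, 0)" "embed_y g \<in> piece (proj_1_n n) (e, 0)"
      using fg(3,4) by (auto intro: embed_y_piece simp: piece_proj_n)
    ultimately show ?thesis using fg(2) gP by blast
  qed
  have gens_C: "IP \<union> m \<subseteq> C"
  proof (rule Un_least)
    show "IP \<subseteq> C" unfolding IP_def C_def by (rule YX.stalk_subset)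
    show "m \<subseteq> C"
    proof
      fix w assume "w \<in> m"
      then show "w \<in> C" using m_elem[of w] unfolding C_def by blast
    qed
  qed
  have idZ: "ideal ZP (ring_of C)" and gens_Z: "IP \<union> m \<subseteq> ZP"
    unfolding ZP_eq using genideal_ring_of[OF subC gens_C] by auto
  note Zc = ideal_closed[OF subC idZ]
  let ?\<phi> = "fract_map embed_x :: 'k mpoly fract \<Rightarrow> 'k mpoly mpoly fract"
  have A_E: "\<exists>f g d. x = Fract f g \<and> f \<in> piece (proj_n n) d \<and> g \<in> piece (proj_n n) d \<and> g \<notin> q \<and> g \<noteq> 0 \<and>
      embed_x f \<in> piece (proj_1_n n) (0, d) \<and> embed_x g \<in> piece (proj_1_n n) (0, d) \<and> embed_x g \<notin> P \<and>
      ?\<phi> x = Fract (embed_x f) (embed_x g)" if xA: "x \<in> A" for x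
  proof -
    obtain f g d where x: "x = Fract f g" "f \<in> piece (proj_n n) d" "g \<in> piece (proj_n n) d" "g \<notin> q"
      using xA unfolding A_def by blast
    have "g \<noteq> 0" using x(4) qp(2) by blast
    moreover have "embed_x g \<notin> P" using x P_x by (simp add: piece_proj_n)
    ultimately show ?thesis
      using x embed_x_piece[OF x(2)] embed_x_piece[OF x(3)] fract_map_embed_x[of g f] by blast
  qed
  have hom: "subring_hom A C ?\<phi>"
    unfolding subring_hom_def
  proof (intro conjI ballI)
    show "?\<phi> x \<in> C" if "x \<in> A" for x using A_E[OF that] unfolding C_def by blast
    show "?\<phi> 1 = 1" using fract_map_embed_x[of 1 1] by (simp add: One_fract_def embed_x_one)
    fix x y assume xA: "x \<in> A" and yA: "y \<in> A"
    obtain f g where x: "x = Fract f g" "g \<noteq> 0" "?\<phi> x = Fract (embed_x f) (embed_x g)" using A_E[OF xA] by blast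
    obtain f' g' where y: "y = Fract f' g'" "g' \<noteq> 0" "?\<phi> y = Fract (embed_x f') (embed_x g')" using A_E[OF yA] by blast
    have nz: "g * g' \<noteq> 0" "embed_x g \<noteq> 0" "embed_x g' \<noteq> 0" using x y by (auto simp: embed_x_eq_0_iff)
    show "?\<phi> (x + y) = ?\<phi> x + ?\<phi> y" "?\<phi> (x * y) = ?\<phi> x * ?\<phi> y"
      using x y nz fract_map_embed_x[OF nz(1)] by (simp_all add: embed_x_mult embed_x_add)
  qed
  \<comment> \<open>The fractions whose specialization lies in the stalk of \<open>J0\<close>. They form an ideal, so that
    \<open>ZP\<close> consists of such fractions as soon as its generators do.\<close>
  define S where "S = {w. \<exists>F G e d d' h. w = Fract F G \<and> F \<in> piece (proj_1_n n) (e, d) \<and> G \<in> piece (proj_1_n n) (e, d) \<and> G \<notin> P \<and>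
    h \<in> piece (proj_n n) d' \<and> h \<notin> q \<and> h * spec e F \<in> J0}"
  have S_I: "Fract F G \<in> S" if "F \<in> piece (proj_1_n n) (e, d)" "G \<in> piece (proj_1_n n) (e, d)" "G \<notin> P"
    "h \<in> piece (proj_n n) d'" "h \<notin> q" "h * spec e F \<in> J0" for F G e d d' h
    unfolding S_def using that by blast
  note Jc = ideal_closed[OF subring_CX J0_ideal]
  have spec_piece: "spec e F \<in> piece (proj_n n) d" if "F \<in> piece (proj_1_n n) (e, d)" for F :: "'k mpoly mpoly" and e d
    using that spec_CX spec_bihom(1) by (auto simp: piece_proj_1_n piece_proj_n)
  have spec_prod: "spec (e + e') (F * G) = spec e F * spec e' G"
    if "F \<in> piece (proj_1_n n) (e, d)" "G \<in> piece (proj_1_n n) (e', d')" for F G :: "'k mpoly mpoly" and e d e' d'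
    using that by (intro spec_mult_bihom) (auto simp: piece_proj_1_n)
  have pm: "F * G \<in> piece (proj_1_n n) (e + e', d + d')"
    if "F \<in> piece (proj_1_n n) (e, d)" "G \<in> piece (proj_1_n n) (e', d')" for F G :: "'k mpoly mpoly" and e d e' d'
    using YX.piece_mult[OF that] by simp
  have idS: "ideal S (ring_of C)"
    unfolding ideal_ring_of_iff[OF subC]
  proof (intro conjI ballI)
    show "S \<subseteq> C" unfolding S_def C_def by blast
    have "Fract 0 1 \<in> S"
    proof (rule S_I)
      show "(1 :: 'k mpoly mpoly) \<in> piece (proj_1_n n) (0, 0)" using YX.piece_one by (simp add: zero_prod_def)
      show "(0 :: 'k mpoly mpoly) \<in> piece (proj_1_n n) (0, 0)" by (rule YX.piece_zero)
      show "(1 :: 'k mpoly) \<in> piece (proj_n n) 0" by (rule piece_one_proj_n)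
    qed (use Pp(1) qp(1) Jc(1) in auto)
    then show "0 \<in> S" by (simp add: Zero_fract_def)
    fix x c assume "x \<in> S"
    then obtain F G e d d1 h where x: "x = Fract F G" "F \<in> piece (proj_1_n n) (e, d)" "G \<in> piece (proj_1_n n) (e, d)" "G \<notin> P"
      "h \<in> piece (proj_n n) d1" "h \<notin> q" "h * spec e F \<in> J0" unfolding S_def by blast
    have G0: "G \<noteq> 0" using x(4) Pp(2) by blast
    {
      fix y assume "y \<in> S"
      then obtain F' G' e' d' d2 h' where y: "y = Fract F' G'" "F' \<in> piece (proj_1_n n) (e', d')" "G' \<in> piece (proj_1_n n) (e', d')" "G' \<notin> P"
        "h' \<in> piece (proj_n n) d2" "h' \<notin> q" "h' * spec e' F' \<in> J0" unfolding S_def by blast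
      have G0': "G' \<noteq> 0" using y(4) Pp(2) by blast
      have sum: "x + y = Fract (F * G' + F' * G) (G * G')" using x(1) y(1) G0 G0' by simp
      have p1: "F * G' \<in> piece (proj_1_n n) (e + e', d + d')" by (rule pm[OF x(2) y(3)])
      have p2: "F' * G \<in> piece (proj_1_n n) (e + e', d + d')" using pm[OF y(2) x(3)] by (simp add: add.commute)
      have "spec (e + e') (F * G' + F' * G) = spec e F * spec e' G' + spec e' F' * spec e G"
        using spec_prod[OF x(2) y(3)] spec_prod[OF y(2) x(3)] by (simp add: spec_add add.commute)
      then have eq: "(h * h') * spec (e + e') (F * G' + F' * G) =
          (h' * spec e' G') * (h * spec e F) + (h * spec e G) * (h' * spec e' F')" by (simp add: algebra_simps)
      have c1: "h' * spec e' G' \<in> CX n" "h * spec e G \<in> CX n"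
        using X.piece_C x(5) y(5) spec_piece[OF y(3)] spec_piece[OF x(3)] by (meson CX_closed(4) in_mono)+
      have J: "(h * h') * spec (e + e') (F * G' + F' * G) \<in> J0"
        unfolding eq by (intro Jc(2) Jc(3)[OF x(7) c1(1)] Jc(3)[OF y(7) c1(2)])
      show "x + y \<in> S" unfolding sum
        by (rule S_I[OF YX.piece_add[OF p1 p2] pm[OF x(3) y(3)] Pp(3)[OF x(3) y(3) x(4) y(4)] X.piece_mult[OF x(5) y(5)]
              qp(3)[OF x(5) y(5) x(6) y(6)] J])
    }
    assume "c \<in> C"
    then obtain F' G' ed' where c: "c = Fract F' G'" "F' \<in> piece (proj_1_n n) ed'" "G' \<in> piece (proj_1_n n) ed'" "G' \<notin> P"
      unfolding C_def by blast
    obtain e' d' where ed: "ed' = (e', d')" by (cases ed')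
    note c = c[unfolded ed]
    have "c * x = Fract (F' * F) (G' * G)" using c x by simp
    moreover have "h * spec (e' + e) (F' * F) \<in> J0"
    proof -
      have "h * spec (e' + e) (F' * F) = spec e' F' * (h * spec e F)" using spec_prod[OF c(2) x(2)] by (simp add: ac_simps)
      moreover have "spec e' F' * (h * spec e F) \<in> J0"
        by (rule Jc(3)[OF x(7)]) (use spec_piece[OF c(2)] X.piece_C in blast)
      ultimately show ?thesis by (simp only:)
    qed
    ultimately show "c * x \<in> S"
      using S_I[OF pm[OF c(2) x(2)] pm[OF c(3) x(3)] Pp(3)[OF c(3) x(3) c(4) x(4)] x(5,6)] by simp
  qed
  have Z_S: "ZP \<subseteq> S"
    unfolding ZP_eq
  proof (rule genideal_least[OF subC idS], rule Un_least)
    show "IP \<subseteq> S"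
    proof
      fix w assume "w \<in> IP"
      then obtain F G ed where w: "w = Fract F G" "F \<in> I" "F \<in> piece (proj_1_n n) ed" "G \<in> piece (proj_1_n n) ed" "G \<notin> P"
        unfolding IP_def by blast
      obtain e d where ed: "ed = (e, d)" by (cases ed)
      have "1 * spec e F \<in> J0" using w(2) I_subset_lift by (auto simp: lift_ideal_def)
      then show "w \<in> S" unfolding w(1) using S_I[OF w(3,4)[unfolded ed] w(5) piece_one_proj_n qp(1)] by blast
    qed
    show "m \<subseteq> S"
    proof
      fix w assume "w \<in> m"
      then obtain f g e where w: "w = Fract (embed_y f) (embed_y g)" "f \<in> pt" "embed_y f \<in> piece (proj_1_n n) (e, 0)"
        "embed_y g \<in> piece (proj_1_n n) (e, 0)" "embed_y g \<notin> P" using m_elem by blast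
      have "1 * spec e (embed_y f) \<in> J0" using w(2) Jc(1) by (simp add: spec_embed_y pt_def)
      then show "w \<in> S" unfolding w(1) using S_I[OF w(3,4,5) piece_one_proj_n qp(1)] by blast
    qed
  qed
  have ker1: "x \<in> K" if xA: "x \<in> A" and "?\<phi> x \<in> ZP" for x
  proof -
    obtain f g d where x: "x = Fract f g" "f \<in> piece (proj_n n) d" "g \<in> piece (proj_n n) d" "g \<notin> q" "g \<noteq> 0"
      "embed_x f \<in> piece (proj_1_n n) (0, d)" "embed_x g \<in> piece (proj_1_n n) (0, d)" "embed_x g \<notin> P"
      "?\<phi> x = Fract (embed_x f) (embed_x g)" using A_E[OF xA] by blast
    have "Fract (embed_x f) (embed_x g) \<in> S" using that(2) Z_S x(9) by auto
    then obtain F G e d' d1 h where F: "Fract (embed_x f) (embed_x g) = Fract F G" "F \<in> piece (proj_1_n n) (e, d')" "G \<in> piece (proj_1_n n) (e, d')" "G \<notin> P"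
      "h \<in> piece (proj_n n) d1" "h \<notin> q" "h * spec e F \<in> J0" unfolding S_def by blast
    have "embed_x g \<noteq> 0" "G \<noteq> 0" using x(8) F(4) Pp(2) by auto
    then have "embed_x f * G = F * embed_x g" using F(1) by (simp add: eq_fract)
    then have "spec (0 + e) (embed_x f * G) = spec (e + 0) (F * embed_x g)" by simp
    then have "f * spec e G = spec e F * g"
      using spec_prod[OF x(6) F(3)] spec_prod[OF F(2) x(7)] by (simp add: spec_embed_x)
    then have "(h * spec e G) * f = g * (h * spec e F)" by (simp add: ac_simps)
    moreover have "g * (h * spec e F) \<in> J0" using Jc(3)[OF F(7)] x(3) X.piece_C by blast
    moreover have "spec e G \<notin> q" using P_bihom[OF F(3)] F(4) by blast
    ultimately show ?thesis
      unfolding K_def x(1) X.stalk_mem_iff[OF pq J0_ideal x(2,3,4)]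
      using X.piece_mult[OF F(5) spec_piece[OF F(3)]] qp(3)[OF F(5) spec_piece[OF F(3)] F(6)] by metis
  qed
  \<comment> \<open>Modulo the fibre, \<open>c = - (v / u) c'\<close> vanishes for every pair in \<open>Q\<close>.\<close>
  have ker2: "?\<phi> x \<in> ZP" if xA: "x \<in> A" and xK: "x \<in> K" for x
  proof -
    obtain f g d where x: "x = Fract f g" "f \<in> J0" "f \<in> piece (proj_n n) d" "g \<in> piece (proj_n n) d" "g \<notin> q"
      using xK unfolding K_def by blast
    have g0: "g \<noteq> 0" using x(5) qp(2) by blast
    define G where "G = embed_x g"
    have G: "G \<in> piece (proj_1_n n) (0, d)" "G \<notin> P" "G \<noteq> 0"
      using embed_x_piece[OF x(4)] P_x[of g] x(4,5) g0 by (auto simp: G_def piece_proj_n embed_x_eq_0_iff)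
    have G0: "G \<in> piece (proj_1_n n) (0, d)" by (rule G(1))
    have mono: "Fract (Poly_Mapping.single a (Poly_Mapping.single 0 k)) G \<in> ZP"
      if a: "a \<in> monomials n" "expo_deg a = d" "a \<in> multiples D0" for a k
    proof -
      let ?k = "Poly_Mapping.single 0 k :: 'k mpoly"
      obtain b c where bc: "a = b + c" "c \<in> D0" using a(3) unfolding multiples_def by blast
      have b: "b \<in> monomials n" using a(1) bc by simp
      have mon: "Poly_Mapping.single s ?k \<in> piece (proj_1_n n) (0, d)" if "s \<in> monomials n" "expo_deg s = d" for s
        using that by (auto simp: piece_proj_1_n intro: bihomogeneous_single)
      show ?thesis
      proof (cases "c \<in> D1")
        case True
        have "Poly_Mapping.single b ?k * xpow c \<in> I" using gen_mem(1) bc True b by (intro I_closed(3)) auto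
        then have "Poly_Mapping.single a ?k \<in> I" by (simp add: bc mult_single)
        then have "Fract (Poly_Mapping.single a ?k) G \<in> IP"
          unfolding IP_def using YX.stalkI[OF _ mon[OF a(1,2)] G(1,2)] by blast
        then show ?thesis using gens_Z by blast
      next
        case False
        obtain c' where Q: "(c, c') \<in> Q" using False bc fst_Q by force
        let ?a' = "b + c'"
        have c'n: "c' \<in> monomials n" using Q_mem(3)[OF Q] D1(1) by blast
        have a': "?a' \<in> monomials n" "expo_deg ?a' = d" using b a(2) c'n bc Q_deg[OF Q] by auto
        have memI: "Poly_Mapping.single b ?k * (Poly_Mapping.single c u + Poly_Mapping.single c' v) \<in> I"
          using gen_mem(2)[OF Q] b by (intro I_closed(3)) auto
        have split: "uy * Poly_Mapping.single a ?k = Poly_Mapping.single b ?k * (Poly_Mapping.single c u + Poly_Mapping.single c' v) - vy * Poly_Mapping.single ?a' ?k"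
          by (simp add: bc embed_y_def mult_single distrib_left mult.commute)
        have pieces: "uy * Poly_Mapping.single a ?k \<in> piece (proj_1_n n) (1, d)" "vy * Poly_Mapping.single ?a' ?k \<in> piece (proj_1_n n) (1, d)"
          "uy * G \<in> piece (proj_1_n n) (1, d)"
          using pm[OF u_piece(1) mon[OF a(1,2)]] pm[OF u_piece(2) mon[OF a']] pm[OF u_piece(1) G0] by auto
        have uG: "uy * G \<notin> P" by (rule Pp(3)[OF u_piece(1) G0 uv(2) G(2)])
        have uG0: "uy * G \<noteq> 0" using uy0 G(3) by simp
        let ?R = "Poly_Mapping.single b ?k * (Poly_Mapping.single c u + Poly_Mapping.single c' v)"
        have "?R = uy * Poly_Mapping.single a ?k + vy * Poly_Mapping.single ?a' ?k" using split by simp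
        then have "?R \<in> piece (proj_1_n n) (1, d)" using YX.piece_add[OF pieces(1,2)] by metis
        then have "Fract ?R (uy * G) \<in> IP" unfolding IP_def using YX.stalkI[OF memI _ pieces(3) uG] by blast
        then have 1: "Fract ?R (uy * G) \<in> ZP" using gens_Z by blast
        have "Fract (Poly_Mapping.single ?a' ?k) G \<in> C" unfolding C_def by (rule YX.local_carrierI[OF mon[OF a'] G(1,2)])
        moreover have "Fract vy uy \<in> ZP" using vu gens_Z by blast
        ultimately have 2: "Fract vy uy * Fract (Poly_Mapping.single ?a' ?k) G \<in> ZP" by (intro Zc(4))
        have "Fract (Poly_Mapping.single a ?k) G = Fract (uy * Poly_Mapping.single a ?k) (uy * G)"
          using G(3) uG0 uy0 by (simp add: eq_fract ac_simps)
        also have "\<dots> = Fract ?R (uy * G) - Fract vy uy * Fract (Poly_Mapping.single ?a' ?k) G"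
          unfolding split mult_fract by (rule diff_fract_same[OF uG0, symmetric])
        also have "\<dots> \<in> ZP" by (rule Zc(6)[OF 1 2])
        finally show ?thesis .
      qed
    qed
    have sum_fract: "Fract (\<Sum>a\<in>T. Poly_Mapping.single a (k a)) G = (\<Sum>a\<in>T. Fract (Poly_Mapping.single a (k a)) G)" if "finite T" for T k
      using that
    proof (induction T rule: finite_induct)
      case (insert a T)
      then show ?case by (simp add: add_fract_same[OF G(3), symmetric])
    qed (simp add: fract_collapse)
    have "embed_x f = (\<Sum>a\<in>Poly_Mapping.keys f. Poly_Mapping.single a (Poly_Mapping.single 0 (Poly_Mapping.lookup f a)))"
      by (subst poly_mapping_eq_sum) (simp add: keys_embed_x lookup_embed_x)
    then have "Fract (embed_x f) G = (\<Sum>a\<in>Poly_Mapping.keys f. Fract (Poly_Mapping.single a (Poly_Mapping.single 0 (Poly_Mapping.lookup f a))) G)"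
      using sum_fract[OF finite_keys] by simp
    also have "\<dots> \<in> ZP"
    proof (intro ideal_sum_closed[OF subC idZ] mono)
      fix a assume a: "a \<in> Poly_Mapping.keys f"
      then show "a \<in> monomials n" "a \<in> multiples D0" using x(2) by (auto simp: J0_def monomial_span_def CX_def)
      show "expo_deg a = d" using a x(3) by (auto simp: piece_proj_n homogeneous_def)
    qed
    finally show ?thesis unfolding x(1) fract_map_embed_x[OF g0] G_def .
  qed
  have surj: "\<exists>x\<in>A. y - ?\<phi> x \<in> ZP" if yC: "y \<in> C" for y
  proof -
    obtain F G ed where "y = Fract F G" "F \<in> piece (proj_1_n n) ed" "G \<in> piece (proj_1_n n) ed" "G \<notin> P"
      using yC unfolding C_def by blast
    moreover obtain e d where "ed = (e, d)" by (cases ed)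
    ultimately have y: "y = Fract F G" "F \<in> piece (proj_1_n n) (e, d)" "G \<in> piece (proj_1_n n) (e, d)" "G \<notin> P" by simp_all
    have FC: "F \<in> CYX n" "bihomogeneous (e, d) F" "G \<in> CYX n" "bihomogeneous (e, d) G" using y by (auto simp: piece_proj_1_n)
    define f where "f = spec e F"
    define g where "g = spec e G"
    have fg: "f \<in> piece (proj_n n) d" "g \<in> piece (proj_n n) d" "g \<notin> q"
      using spec_piece[OF y(2)] spec_piece[OF y(3)] P_bihom[OF y(3)] y(4) by (auto simp: f_def g_def)
    have g0: "g \<noteq> 0" using fg(3) qp(2) by blast
    have xA: "Fract f g \<in> A" unfolding A_def by (rule X.local_carrierI[OF fg])
    have G0: "G \<noteq> 0" using y(4) Pp(2) by blast
    have gx: "embed_x g \<in> piece (proj_1_n n) (0, d)" "embed_x g \<notin> P" "embed_x g \<noteq> 0" "embed_x f \<in> piece (proj_1_n n) (0, d)"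
      using embed_x_piece fg P_x[of g] g0 by (auto simp: piece_proj_n embed_x_eq_0_iff)
    let ?R = "(uy * rest F) * embed_x g - embed_x f * (uy * rest G)"
    have restp: "uy * rest F \<in> piece (proj_1_n n) (e, d)" "uy * rest G \<in> piece (proj_1_n n) (e, d)"
      using rest_bihom[OF FC(1,2)] rest_bihom[OF FC(3,4)] CYX_closed(4)[OF uy_CYX(1) rest_CYX[OF FC(1)]]
        CYX_closed(4)[OF uy_CYX(1) rest_CYX[OF FC(3)]] by (auto simp: piece_proj_1_n)
    have "(uy * rest F) * embed_x g \<in> piece (proj_1_n n) (e, d + d)" "embed_x f * (uy * rest G) \<in> piece (proj_1_n n) (e, d + d)"
      using pm[OF restp(1) gx(1)] pm[OF gx(4) restp(2)] by auto
    then have Rp: "?R \<in> piece (proj_1_n n) (e, d + d)" by (rule YX.piece_diff)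
    have Dp: "G * embed_x g \<in> piece (proj_1_n n) (e, d + d)" using pm[OF y(3) gx(1)] by simp
    have DP: "G * embed_x g \<notin> P" by (rule Pp(3)[OF y(3) gx(1) y(4) gx(2)])
    have RC: "Fract ?R (G * embed_x g) \<in> C" unfolding C_def by (rule YX.local_carrierI[OF Rp Dp DP])
    have F_eq: "F = vy * rest F + embed_y (xpow (yp e)) * embed_x f" and G_eq: "G = vy * rest G + embed_y (xpow (yp e)) * embed_x g"
      unfolding f_def g_def by (rule decomposition_bihom[OF FC(1,2)], rule decomposition_bihom[OF FC(3,4)])
    have cross: "F * embed_x g - embed_x f * G = vy * (rest F * embed_x g - embed_x f * rest G)"
      by (subst F_eq, subst G_eq) (simp add: algebra_simps)
    have "y - ?\<phi> (Fract f g) = Fract (F * embed_x g - embed_x f * G) (G * embed_x g)"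
      unfolding y(1) fract_map_embed_x[OF g0] using G0 gx(3) by simp
    also have "\<dots> = Fract vy uy * Fract ?R (G * embed_x g)"
      unfolding cross mult_fract using G0 gx(3) uy0 by (simp add: eq_fract algebra_simps)
    also have "\<dots> \<in> ZP" using vu gens_Z RC by (intro Zc(4)) auto
    finally show ?thesis using xA by blast
  qed
  have "\<exists>h\<in>ring_iso (ring_of A Quot K) (ring_of C Quot ZP). \<forall>x\<in>A. h (K +>\<^bsub>ring_of A\<^esub> x) = ZP +>\<^bsub>ring_of C\<^esub> ?\<phi> x"
    by (rule quotient_iso[OF subA idK subC idZ hom _ surj]) (use ker1 ker2 in blast)
  moreover have "ideal_stalk (zero_scheme (proj_n n) J0) q = K" by (simp add: zero_scheme_def K_def)
  ultimately show ?thesis unfolding X.local_ring_eq YX.local_ring_eq A_def C_def by simp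
qed

lemma fibre_iso: "pr2_isomorphism n (fibre n (zero_scheme (proj_1_n n) I) pt) (zero_scheme (proj_n n) J0)"
proof -
  let ?X = "zero_scheme (proj_1_n n) I" and ?W = "zero_scheme (proj_n n) J0"
  let ?Z = "fibre n ?X pt"
  have sZ: "support ?Z = {P \<in> points (proj_1_n n). pr1 P = pt \<and> pr2 n P \<in> support ?W}"
  proof -
    have "I \<subseteq> P \<longleftrightarrow> pr2 n P \<in> points (proj_n n) \<and> J0 \<subseteq> pr2 n P" if P: "P \<in> points (proj_1_n n)" "pr1 P = pt" for P
    proof -
      note d = point_down[OF P]
      have "ideal (pr2 n P) (ring_of (CX n))"
        using d(1) primeideal_ring_of_iff[OF subring_CX] unfolding points_def coord_proj_n by blast
      then show ?thesis using J0_subset_iff[of "pr2 n P"] d by simp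
    qed
    then show ?thesis by (auto simp: fibre_def zero_scheme_def)
  qed
  have "support ?W \<subseteq> points (proj_n n)" by (auto simp: zero_scheme_def)
  from homeomorphic_fibre[OF this sZ]
  have "homeomorphic_map (subtopology (zariski (proj_1_n n)) (support ?Z)) (subtopology (zariski (proj_n n)) (support ?W)) (pr2 n)" .
  moreover have "\<exists>h \<in> ring_iso (structure_stalk (proj_n n) ?W (pr2 n P)) (structure_stalk (proj_1_n n) ?Z P).
        \<forall>q \<in> carrier (local_ring (proj_n n) (pr2 n P)).
          h (ideal_stalk ?W (pr2 n P) +>\<^bsub>local_ring (proj_n n) (pr2 n P)\<^esub> q) =
          ideal_stalk ?Z P +>\<^bsub>local_ring (proj_1_n n) P\<^esub> fract_map embed_x q" if P: "P \<in> support ?Z" for P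
  proof -
    have "P \<in> points (proj_1_n n)" "pr1 P = pt" using P sZ by auto
    from fibre_stalk_iso[OF this refl refl]
    show ?thesis unfolding structure_stalk_def by (simp add: fibre_def)
  qed
  ultimately show ?thesis unfolding pr2_isomorphism_def by blast
qed

end

section \<open>Strongly stable ideals and their monomials\<close>

lemma xpow_monomial_span: "xpow m \<in> (monomial_span n T :: 'k::field mpoly set) \<longleftrightarrow> m \<in> monomials n \<and> m \<in> T"
  by (auto simp: monomial_span_def CX_def)

lemma genideal_xpow:
  assumes "A \<subseteq> monomials n"
  shows "genideal (Kx n) (xpow ` A) = (monomial_span n (multiples A) :: 'k::field mpoly set)"
proof
  have sub: "xpow ` A \<subseteq> (CX n :: 'k mpoly set)" using assms by auto
  have id: "ideal (monomial_span n (multiples A) :: 'k mpoly set) (ring_of (CX n))"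
    by (rule monomial_span_ideal) (rule multiples_add)
  have "xpow m \<in> (monomial_span n (multiples A) :: 'k mpoly set)" if "m \<in> A" for m
    unfolding xpow_monomial_span using that assms multiplesI[OF that, of 0] by auto
  then show "genideal (Kx n) (xpow ` A) \<subseteq> (monomial_span n (multiples A) :: 'k mpoly set)"
    unfolding Kx_eq by (intro genideal_least[OF subring_CX id]) blast
  note G = genideal_ring_of[OF subring_CX sub]
  show "(monomial_span n (multiples A) :: 'k mpoly set) \<subseteq> genideal (Kx n) (xpow ` A)"
    unfolding Kx_eq
  proof
    fix f :: "'k mpoly" assume f: "f \<in> monomial_span n (multiples A)"
    have "(\<Sum>a\<in>Poly_Mapping.keys f. Poly_Mapping.single a (Poly_Mapping.lookup f a)) \<in> genideal (ring_of (CX n)) (xpow ` A)"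
    proof (intro ideal_sum_closed[OF subring_CX G(1)])
      fix a assume "a \<in> Poly_Mapping.keys f"
      then have a: "a \<in> monomials n" "a \<in> multiples A" using f by (auto simp: monomial_span_def CX_def)
      then obtain b m where bm: "a = b + m" "m \<in> A" unfolding multiples_def by blast
      have b: "Poly_Mapping.single b (Poly_Mapping.lookup f a) \<in> CX n" using a(1) bm(1) by simp
      have "(xpow m :: 'k mpoly) \<in> genideal (ring_of (CX n)) (xpow ` A)" by (rule subsetD[OF G(2) imageI[OF bm(2)]])
      from ideal_closed(3)[OF subring_CX G(1) this b]
      show "Poly_Mapping.single a (Poly_Mapping.lookup f a) \<in> genideal (ring_of (CX n)) (xpow ` A)"
        by (simp add: bm(1) mult_single)
    qed
    then show "f \<in> genideal (ring_of (CX n)) (xpow ` A)" by (simp flip: poly_mapping_eq_sum)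
  qed
qed

lemma lookup_gen: "Poly_Mapping.lookup (gen a) i = int (Poly_Mapping.lookup a i)"
  by (simp add: gen_def lookup_map_zero)

lemma gen_add: "gen (a + b) = gen a + gen b"
  by (rule poly_mapping_eqI) (simp add: lookup_gen lookup_add)

lemma gen_evar: "gen (evar i) = Poly_Mapping.single i 1"
  by (rule poly_mapping_eqI) (simp add: lookup_gen lookup_evar lookup_single when_def)

lemma gen_inj: "gen a = gen b \<longleftrightarrow> a = b"
  by (metis lookup_gen of_nat_eq_iff poly_mapping_eqI)

lemma borel_step_iff:
  "borel_step n b a \<longleftrightarrow> (\<exists>m i. i < n \<and> m \<in> monomials n \<and> b = m + evar i \<and> a = m + evar (Suc i))"
proof
  assume "borel_step n b a"
  then obtain i where *: "a \<in> monomials n" "b \<in> monomials n" "i < n" "gen a = e_inc i (gen b)"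
    unfolding borel_step_def by blast
  have l: "int (Poly_Mapping.lookup a j) = int (Poly_Mapping.lookup b j) + (if j = Suc i then 1 else 0) - (if j = i then 1 else 0)" for j
    using arg_cong[OF *(4), of "\<lambda>u. Poly_Mapping.lookup u j"]
    by (simp add: e_inc_def lookup_gen lookup_add lookup_minus lookup_single when_def)
  have "0 < Poly_Mapping.lookup b i" using l[of i] by simp
  then obtain m where m: "b = m + evar i" using expo_split_var by blast
  have "gen a = gen (m + evar (Suc i))"
    unfolding *(4) m e_inc_def gen_add gen_evar by (simp add: Suc_eq_plus1)
  then have "a = m + evar (Suc i)" by (simp only: gen_inj)
  then show "\<exists>m i. i < n \<and> m \<in> monomials n \<and> b = m + evar i \<and> a = m + evar (Suc i)"
    using m * by auto
next
  assume "\<exists>m i. i < n \<and> m \<in> monomials n \<and> b = m + evar i \<and> a = m + evar (Suc i)"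
  then obtain m i where m: "i < n" "m \<in> monomials n" "b = m + evar i" "a = m + evar (Suc i)" by blast
  have "gen a = e_inc i (gen b)" unfolding m(3,4) gen_add gen_evar e_inc_def by (simp add: Suc_eq_plus1)
  then show "borel_step n b a" unfolding borel_step_def using m by (auto simp: monomials_eq_from)
qed

lemma borel_ge_move:
  assumes "i \<le> j" "j \<le> n" "m \<in> monomials n"
  shows "borel_ge n (m + evar j) (m + evar i)"
  using assms
proof (induction j rule: dec_induct)
  case base
  show ?case by (simp add: borel_ge_def)
next
  case (step k)
  then have "borel_step n (m + evar k) (m + evar (Suc k))" unfolding borel_step_iff by (intro exI[of _ m] exI[of _ k]) simp
  then show ?case using step unfolding borel_ge_def by (meson Suc_leD rtranclp.rtrancl_into_rtrancl)
qed

lemma borel_ge_monomials_from: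
  assumes "borel_ge n a b" "b \<in> monomials_from k n"
  shows "a \<in> monomials_from k n"
  using assms(1) unfolding borel_ge_def
proof (induction rule: rtranclp_induct)
  case (step y z)
  then show ?case unfolding borel_step_iff by auto
qed (rule assms(2))

definition ideal_monomials :: "nat \<Rightarrow> 'k::field mpoly set \<Rightarrow> expo set"
  where "ideal_monomials n J = {m \<in> monomials n. xpow m \<in> J}"

lemma strongly_stable_span:
  assumes "strongly_stable n J"
  shows "J = {f \<in> CX n. Poly_Mapping.keys f \<subseteq> ideal_monomials n J}"
    "m \<in> ideal_monomials n J \<Longrightarrow> b \<in> monomials n \<Longrightarrow> b + m \<in> ideal_monomials n J"
proof -
  obtain A where A: "A \<subseteq> monomials n" "J = monomial_span n (multiples A)"
    using assms genideal_xpow unfolding strongly_stable_def monomial_ideal_def by metis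
  have im: "ideal_monomials n J = monomials n \<inter> multiples A"
    unfolding ideal_monomials_def A(2) xpow_monomial_span by blast
  show "J = {f \<in> CX n. Poly_Mapping.keys f \<subseteq> ideal_monomials n J}"
    unfolding im by (auto simp: A(2) monomial_span_def CX_def)
  show "m \<in> ideal_monomials n J \<Longrightarrow> b \<in> monomials n \<Longrightarrow> b + m \<in> ideal_monomials n J"
    unfolding im using multiples_add by auto
qed

lemma strongly_stable_stable_from:
  assumes "strongly_stable n J"
  shows "stable_from 0 n (ideal_monomials n J)"
  unfolding stable_from_def
proof (intro conjI ballI allI impI)
  fix m i assume "m \<in> monomials_from 0 n" "i \<le> n" "m \<in> ideal_monomials n J"
  then show "m + evar i \<in> ideal_monomials n J"
    using strongly_stable_span(2)[OF assms, of m "evar i"] by (simp add: add.commute monomials_eq_from)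
next
  fix m i j assume m: "m \<in> monomials_from 0 n" "i < j" "j \<le> n" "m + evar i \<in> ideal_monomials n J"
  then have "borel_ge n (m + evar j) (m + evar i)" by (intro borel_ge_move) (auto simp: monomials_eq_from)
  moreover have "m + evar j \<in> monomials n" "m + evar i \<in> monomials n" using m by (auto simp: monomials_eq_from)
  ultimately show "m + evar j \<in> ideal_monomials n J"
    using assms m(4) unfolding strongly_stable_def ideal_monomials_def by blast
qed

lemma saturated_saturated_from:
  assumes "saturated n J"
  shows "saturated_from 0 n (ideal_monomials n J)"
  unfolding saturated_from_def
proof (intro ballI impI)
  fix m assume m: "m \<in> monomials_from 0 n" and *: "\<forall>i. 0 \<le> i \<longrightarrow> i \<le> n \<longrightarrow> m + evar i \<in> ideal_monomials n J"
  have mC: "xpow m \<in> carrier (Kx n :: 'a mpoly ring)" using m unfolding Kx_eq by (simp add: monomials_eq_from)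
  have "xpow a * xpow m \<in> J" if a: "a \<in> monomials n" "expo_deg a = 1" for a
  proof -
    obtain i a' where i: "a = a' + evar i" using expo_split_var_deg[of a] a(2) by auto
    then have "a' = 0" using a(2) by (simp add: expo_deg_eq_0_iff)
    then have "i \<le> n" "a = evar i" using i a(1) by (auto simp: monomials_eq_from)
    then show ?thesis using * by (simp add: ideal_monomials_def mult_single add.commute)
  qed
  then have "xpow m \<in> J" using assms mC unfolding saturated_def by blast
  then show "m \<in> ideal_monomials n J" using m by (simp add: ideal_monomials_def monomials_eq_from)
qed

section \<open>Hilbert functions count monomials\<close>

lemma dim_span_monomials:
  fixes S :: "expo set"
  assumes "finite S"
  shows "vector_space.dim (\<lambda>(c::'k::field) f. Poly_Mapping.single 0 c * f) {f :: 'k mpoly. Poly_Mapping.keys f \<subseteq> S} = card S"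
proof -
  interpret V: vector_space "\<lambda>(c::'k) (f :: 'k mpoly). Poly_Mapping.single 0 c * f"
    by unfold_locales (simp_all add: distrib_left distrib_right single_add mult_single flip: mult.assoc)
  let ?B = "xpow ` S :: 'k mpoly set"
  let ?T = "{f :: 'k mpoly. Poly_Mapping.keys f \<subseteq> S}"
  have inj: "inj_on (xpow :: expo \<Rightarrow> 'k mpoly) S"
  proof (rule inj_onI)
    fix a b assume "xpow a = (xpow b :: 'k mpoly)"
    then have "Poly_Mapping.keys (xpow a :: 'k mpoly) = Poly_Mapping.keys (xpow b :: 'k mpoly)" by simp
    then show "a = b" by simp
  qed
  have sum: "(\<Sum>w\<in>?B. Poly_Mapping.single 0 (c w) * w) = (\<Sum>a\<in>S. Poly_Mapping.single a (c (xpow a)))" for c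
    by (subst sum.reindex[OF inj]) (simp add: mult_single)
  have indep: "V.independent ?B"
  proof (subst V.independent_explicit_finite_subsets, intro allI impI ballI)
    fix B' c w assume B': "B' \<subseteq> ?B" "finite B'" and z: "(\<Sum>w\<in>B'. Poly_Mapping.single 0 (c w) * w) = 0" and w: "w \<in> B'"
    define S' where "S' = S \<inter> {a. xpow a \<in> B'}"
    have B'_eq: "B' = xpow ` S'" using B' by (auto simp: S'_def)
    have inj': "inj_on (xpow :: expo \<Rightarrow> 'k mpoly) S'" using inj by (rule inj_on_subset) (auto simp: S'_def)
    obtain a where a: "w = xpow a" and "a \<in> S'" using w B'_eq by blast
    have "finite S'" using assms by (simp add: S'_def)
    have "(\<Sum>w\<in>B'. Poly_Mapping.single 0 (c w) * w) = (\<Sum>a\<in>S'. Poly_Mapping.single a (c (xpow a)))"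
      unfolding B'_eq by (subst sum.reindex[OF inj']) (simp add: mult_single)
    then have "Poly_Mapping.lookup (\<Sum>a\<in>S'. Poly_Mapping.single a (c (xpow a))) a = 0" using z by simp
    then show "c w = 0" using \<open>a \<in> S'\<close> \<open>finite S'\<close> a by (simp add: lookup_sum lookup_single when_def)
  qed
  have "?B \<subseteq> ?T" by auto
  moreover have "?T \<subseteq> V.span ?B"
  proof
    fix f assume f: "f \<in> ?T"
    have "(\<Sum>a\<in>Poly_Mapping.keys f. Poly_Mapping.single 0 (Poly_Mapping.lookup f a) * xpow a) \<in> V.span ?B"
      using f by (intro V.span_sum V.span_scale V.span_base) auto
    moreover have "(\<Sum>a\<in>Poly_Mapping.keys f. Poly_Mapping.single 0 (Poly_Mapping.lookup f a) * xpow a) = f"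
      by (simp add: mult_single flip: poly_mapping_eq_sum)
    ultimately show "f \<in> V.span ?B" by simp
  qed
  ultimately have "V.dim ?T = card ?B" using V.dim_unique[OF _ _ indep refl] by blast
  then show ?thesis by (simp add: card_image[OF inj])
qed

lemma hilbert_function_eq_hf:
  assumes "strongly_stable n (J :: 'k::field mpoly set)"
  shows "hilbert_function n J d = hf 0 n (ideal_monomials n J) d"
proof -
  let ?A = "ideal_monomials n J"
  let ?M = "{m \<in> monomials_from 0 n. expo_deg m = d}"
  have fin: "finite ?M" by simp
  have 1: "{f \<in> carrier (Kx n). homogeneous d f} = {f :: 'k mpoly. Poly_Mapping.keys f \<subseteq> ?M}"
    unfolding Kx_eq by (auto simp: CX_def homogeneous_def monomials_eq_from)
  have 2: "{f \<in> J. homogeneous d f} = {f :: 'k mpoly. Poly_Mapping.keys f \<subseteq> ?M \<inter> ?A}"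
    by (subst strongly_stable_span(1)[OF assms]) (auto simp: CX_def homogeneous_def monomials_eq_from)
  have "hilbert_function n J d = card ?M - card (?M \<inter> ?A)"
    unfolding hilbert_function_def Let_def 1 2 dim_span_monomials[OF fin] dim_span_monomials[OF finite_Int[OF disjI1[OF fin]]] ..
  also have "\<dots> = card (?M - ?A)" using card_Diff_subset_Int[of ?M ?A] fin by simp
  also have "?M - ?A = {m \<in> monomials_from 0 n. expo_deg m = d \<and> m \<notin> ?A}" by blast
  finally show ?thesis unfolding hf_def .
qed

section \<open>Truncations in the Gotzmann degree\<close>

text \<open>Gotzmann's theorem for the saturated ideal: in degrees from \<open>r\<close> on it is generated by its part of degree
  \<open>r\<close>, so this part generates the truncation; and the number of its monomials of degree \<open>r\<close> in the variables
  from \<open>x\<^sub>j\<close> on is determined by the Hilbert polynomial.\<close>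

lemma stable_truncation_facts:
  fixes J :: "'k::field mpoly set"
  assumes r: "length as = r" "sorted_wrt (\<ge>) as" "\<forall>t. poly p t = gotz as t"
    and J: "J \<in> stable_truncations n p r"
  shows "J = monomial_span n (multiples (deg_monomials n r J))"
    "move_closed n (deg_monomials n r J)"
    "j \<le> Suc n \<Longrightarrow> of_nat (card {m \<in> monomials_from j n. expo_deg m = r} - card (deg_monomials n r J \<inter> monomials_from j n)) =
       gotz ((dec_list ^^ j) as) (of_nat r)"
proof -
  obtain Js where Js: "J = truncation r Js" "strongly_stable n Js" "saturated n Js" "is_hilbert_polynomial n Js p"
    using J unfolding stable_truncations_def by blast
  let ?A = "ideal_monomials n Js"
  have st: "stable_from 0 n ?A" by (rule strongly_stable_stable_from[OF Js(2)])
  have ev: "\<exists>N. \<forall>s\<ge>N. of_nat (hf 0 n ?A s) = gotz as (of_nat s)"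
    using Js(4) r(3) unfolding is_hilbert_polynomial_def hilbert_function_eq_hf[OF Js(2)] by metis
  from gotzmann_strongly_stable[OF _ st saturated_saturated_from[OF Js(3)] r(2) ev]
  have gen: "\<And>s m. r \<le> s \<Longrightarrow> m \<in> monomials_from 0 n \<Longrightarrow> m \<in> ?A \<Longrightarrow> expo_deg m = Suc s \<Longrightarrow> \<exists>m' i. m' \<in> ?A \<and> m = m' + evar i"
    and hfj: "\<And>j. j \<le> Suc n \<Longrightarrow> of_nat (hf j n ?A r) = gotz ((dec_list ^^ j) as) (of_nat r)"
    using r(1) by auto
  let ?D = "deg_monomials n r J"
  have D: "?D = {m \<in> ?A. expo_deg m = r}"
    unfolding deg_monomials_def Js(1) truncation_def ideal_monomials_def by auto
  have mult: "m \<in> multiples ?D" if "m \<in> ?A" "r \<le> expo_deg m" for m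
    using that
  proof (induction "expo_deg m - r" arbitrary: m)
    case 0
    then show ?case using multiplesI[of m ?D 0] unfolding D by simp
  next
    case (Suc d)
    define s where "s = expo_deg m - 1"
    have s: "expo_deg m = Suc s" "r \<le> s" using Suc.hyps(2) by (auto simp: s_def)
    have "m \<in> monomials_from 0 n" using Suc.prems(1) by (simp add: ideal_monomials_def monomials_eq_from)
    then obtain m' i where m': "m' \<in> ?A" "m = m' + evar i" using gen[of s m] s Suc.prems(1) by metis
    have "expo_deg m' = s" using s m'(2) by simp
    then have "m' \<in> multiples ?D" using Suc.hyps m'(1) s by simp
    then show ?case using multiples_add[of m' ?D "evar i"] m'(2) by (simp add: add.commute)
  qed
  have mult': "m \<in> ?A \<and> r \<le> expo_deg m" if m: "m \<in> multiples ?D" "m \<in> monomials n" for m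
  proof -
    obtain b d where bd: "m = b + d" "d \<in> ?D" using m(1) unfolding multiples_def by blast
    then show ?thesis using strongly_stable_span(2)[OF Js(2), of d b] m(2) unfolding D by auto
  qed
  have "J = {f \<in> CX n. \<forall>m\<in>Poly_Mapping.keys f. m \<in> ?A \<and> r \<le> expo_deg m}"
    unfolding Js(1) truncation_def by (subst strongly_stable_span(1)[OF Js(2)]) blast
  also have "\<dots> = monomial_span n (multiples ?D)"
    unfolding monomial_span_def CX_def using mult mult' by blast
  finally show "J = monomial_span n (multiples ?D)" .
  show "move_closed n ?D"
    unfolding move_closed_def
  proof (intro allI impI)
    fix m i j assume *: "i < j" "j \<le> n" "m + evar i \<in> ?D"
    then have mi: "m + evar i \<in> ?A" and deg: "expo_deg (m + evar j) = r" unfolding D by auto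
    then have "m \<in> monomials_from 0 n" by (auto simp: ideal_monomials_def monomials_eq_from)
    then have "m + evar j \<in> ?A" using st *(1,2) mi unfolding stable_from_def by (meson zero_le)
    then show "m + evar j \<in> ?D" using deg unfolding D by blast
  qed
  show "of_nat (card {m \<in> monomials_from j n. expo_deg m = r} - card (?D \<inter> monomials_from j n)) =
       gotz ((dec_list ^^ j) as) (of_nat r)" if "j \<le> Suc n"
  proof -
    let ?M = "{m \<in> monomials_from j n. expo_deg m = r}"
    have "hf j n ?A r = card (?M - ?A)" unfolding hf_def by (intro arg_cong[where f = card]) blast
    also have "\<dots> = card ?M - card (?M \<inter> ?A)" by (rule card_Diff_subset_Int) simp
    also have "?M \<inter> ?A = ?D \<inter> monomials_from j n" unfolding D by blast
    finally show ?thesis using hfj[OF that] by simp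
  qed
qed

section \<open>The family of two adjacent ideals\<close>

lemma monomials_from_partial_sum:
  "m \<in> monomials_from k n \<longleftrightarrow> m \<in> monomials n \<and> (\<Sum>i<k. Poly_Mapping.lookup m i) = 0"
proof -
  have "(\<Sum>i<k. Poly_Mapping.lookup m i) = 0 \<longleftrightarrow> (\<forall>i<k. i \<notin> Poly_Mapping.keys m)"
    by (auto simp: in_keys_iff)
  moreover have "Poly_Mapping.keys m \<subseteq> {k..n} \<longleftrightarrow> Poly_Mapping.keys m \<subseteq> {..n} \<and> (\<forall>i<k. i \<notin> Poly_Mapping.keys m)"
  proof (intro iffI conjI subsetI allI impI)
    fix i assume "Poly_Mapping.keys m \<subseteq> {..n} \<and> (\<forall>i<k. i \<notin> Poly_Mapping.keys m)" "i \<in> Poly_Mapping.keys m"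
    then have "i \<le> n" "\<not> i < k" by auto
    then show "i \<in> {k..n}" by simp
  qed fastforce+
  ultimately show ?thesis unfolding monomials_from_def monomials_def by simp
qed

text \<open>A decreasing move shifts weight towards the smaller variables.\<close>

lemma dec_composition_translation:
  assumes "E \<in> dec_compositions n"
  shows "\<exists>\<delta>. (\<forall>w. E w = w + \<delta>) \<and> (\<forall>k. 0 \<le> (\<Sum>i<k. Poly_Mapping.lookup \<delta> i))"
  using assms
proof (induction rule: dec_compositions.induct)
  case identity
  show ?case by (intro exI[of _ 0]) simp
next
  case (compose E j)
  then obtain \<delta> where \<delta>: "\<forall>w. E w = w + \<delta>" "\<forall>k. 0 \<le> (\<Sum>i<k. Poly_Mapping.lookup \<delta> i)" by blast
  let ?\<delta> = "\<delta> + Poly_Mapping.single (j - 1) 1 - Poly_Mapping.single j 1"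
  have "0 \<le> (\<Sum>i<k. Poly_Mapping.lookup ?\<delta> i)" for k
  proof -
    have "(\<Sum>i<k. Poly_Mapping.lookup ?\<delta> i) =
        (\<Sum>i<k. Poly_Mapping.lookup \<delta> i) + ((if j - 1 < k then 1 else 0) - (if j < k then 1 else 0))"
      by (simp add: lookup_add lookup_minus lookup_single when_def sum.distrib sum_subtractf)
    moreover have "0 \<le> (if j - 1 < k then 1 else 0) - (if j < k then 1 else 0 :: int)" by auto
    ultimately show ?thesis using \<delta>(2) by (simp only: add_nonneg_nonneg)
  qed
  moreover have "(e_dec j \<circ> E) w = w + ?\<delta>" for w using \<delta>(1) by (simp add: e_dec_def)
  ultimately show ?case by blast
qed

text \<open>Composing decreasing moves adds a vector with nonnegative partial sums, so whether the result avoids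
  the first \<open>k\<close> variables depends on the argument only through whether the argument avoids them.\<close>

lemma translation_monomials_from:
  assumes "\<forall>w. E w = w + \<delta>" "\<forall>k. 0 \<le> (\<Sum>i<k. Poly_Mapping.lookup \<delta> i)" "gen c = E (gen a)" "c \<in> monomials n" "a \<in> monomials n"
  shows "c \<in> monomials_from k n \<longleftrightarrow> a \<in> monomials_from k n \<and> (\<Sum>i<k. Poly_Mapping.lookup \<delta> i) = 0"
proof -
  have "int (\<Sum>i<k. Poly_Mapping.lookup c i) = int (\<Sum>i<k. Poly_Mapping.lookup a i) + (\<Sum>i<k. Poly_Mapping.lookup \<delta> i)"
  proof -
    have "int (Poly_Mapping.lookup c i) = int (Poly_Mapping.lookup a i) + Poly_Mapping.lookup \<delta> i" for i
      using assms(1,3) by (metis lookup_add lookup_gen)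
    then show ?thesis by (simp add: sum.distrib)
  qed
  then have "(\<Sum>i<k. Poly_Mapping.lookup c i) = 0 \<longleftrightarrow> (\<Sum>i<k. Poly_Mapping.lookup a i) = 0 \<and> (\<Sum>i<k. Poly_Mapping.lookup \<delta> i) = 0"
    using assms(2)[rule_format, of k] by linarith
  then show ?thesis using assms(4,5) unfolding monomials_from_partial_sum by blast
qed

lemma nonempty_diff_iff_card:
  assumes "finite X" "finite Y" "card X = card Y"
  shows "X - Y \<noteq> {} \<longleftrightarrow> Y - X \<noteq> {}"
  using assms by (metis Diff_eq_empty_iff card_subset_eq)

text \<open>The least variables of the two Borel maxima agree. A monomial that is Borel larger uses only variables at
  least as large, so a difference contains a monomial in the variables from \<open>x\<^sub>k\<close> on if and only if its Borel
  maximum is one. Both sets contain equally many such monomials, so one difference contains one if and only if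
  the other does. The moves \<open>E\<close>, being translations with nonnegative partial sums, preserve the agreement.\<close>

lemma adjacent_borel_pair:
  fixes J J' :: "'k::field mpoly set"
  assumes r: "length as = r" "sorted_wrt (\<ge>) as" "\<forall>t. poly p t = gotz as t"
    and J: "J \<in> stable_truncations n p r" and J': "J' \<in> stable_truncations n p r"
    and a: "is_borel_max n (deg_monomials n r J - deg_monomials n r J') a"
    and a': "is_borel_max n (deg_monomials n r J' - deg_monomials n r J) a'"
    and E: "associated_moves n r J J' a a' \<E>"
  shows "borel_pair n r (deg_monomials n r J) (deg_monomials n r J') a a'
    {(c, c'). \<exists>E\<in>\<E>. gen c = E (gen a) \<and> gen c' = E (gen a')}"
proof -
  let ?D = "deg_monomials n r J" and ?D' = "deg_monomials n r J'"
  let ?Q = "{(c, c'). \<exists>E\<in>\<E>. gen c = E (gen a) \<and> gen c' = E (gen a')}"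
  note T = stable_truncation_facts[OF r J] and T' = stable_truncation_facts[OF r J']
  have sub: "?D \<subseteq> monomials n" "?D' \<subseteq> monomials n" and deg: "\<And>m. m \<in> ?D \<Longrightarrow> expo_deg m = r" "\<And>m. m \<in> ?D' \<Longrightarrow> expo_deg m = r"
    by (auto simp: deg_monomials_def)
  have Ed: "\<E> \<subseteq> dec_compositions n" and img: "gen ` (?D - ?D') = {E (gen a) | E. E \<in> \<E>}" "gen ` (?D' - ?D) = {E (gen a') | E. E \<in> \<E>}"
    using E unfolding associated_moves_def by auto
  have am: "a \<in> ?D - ?D'" "a' \<in> ?D' - ?D" using a a' unfolding is_borel_max_def by auto
  have amon: "a \<in> monomials n" "a' \<in> monomials n" using am sub by auto
  have mem: "c \<in> ?D - ?D'" "c' \<in> ?D' - ?D" if cc: "(c, c') \<in> ?Q" for c c'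
  proof -
    have "gen c \<in> gen ` (?D - ?D')" "gen c' \<in> gen ` (?D' - ?D)" unfolding img using cc by auto
    then show "c \<in> ?D - ?D'" "c' \<in> ?D' - ?D" by (auto simp: gen_inj)
  qed
  have max_iff: "b \<in> monomials_from k n \<longleftrightarrow> (X \<inter> monomials_from k n) - (Y \<inter> monomials_from k n) \<noteq> {}"
    if "is_borel_max n (X - Y) b" for X Y b k
    using that borel_ge_monomials_from unfolding is_borel_max_def by blast
  have same_k: "a \<in> monomials_from k n \<longleftrightarrow> a' \<in> monomials_from k n" if k: "k \<le> Suc n" for k
  proof -
    let ?M = "{m \<in> monomials_from k n. expo_deg m = r}"
    have fin: "finite ?M" by simp
    have inM: "?D \<inter> monomials_from k n \<subseteq> ?M" "?D' \<inter> monomials_from k n \<subseteq> ?M" using deg by auto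
    have "of_nat (card ?M - card (?D \<inter> monomials_from k n)) = (of_nat (card ?M - card (?D' \<inter> monomials_from k n)) :: rat)"
      using T(3)[OF k] T'(3)[OF k] by simp
    then have "card ?M - card (?D \<inter> monomials_from k n) = card ?M - card (?D' \<inter> monomials_from k n)"
      by (simp only: of_nat_eq_iff)
    moreover have "card (?D \<inter> monomials_from k n) \<le> card ?M" "card (?D' \<inter> monomials_from k n) \<le> card ?M"
      using card_mono[OF fin] inM by blast+
    ultimately have "card (?D \<inter> monomials_from k n) = card (?D' \<inter> monomials_from k n)" by simp
    from nonempty_diff_iff_card[OF finite_subset[OF inM(1) fin] finite_subset[OF inM(2) fin] this]
    show ?thesis unfolding max_iff[OF a] max_iff[OF a'] .
  qed
  have same: "a \<in> monomials_from k n \<longleftrightarrow> a' \<in> monomials_from k n" for k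
  proof (cases "k \<le> Suc n")
    case False
    then have "monomials_from k n = monomials_from (Suc n) n" by (auto simp: monomials_from_def)
    then show ?thesis using same_k[of "Suc n"] by simp
  qed (rule same_k)
  show ?thesis
  proof
    show "?D \<subseteq> monomials n" "?D' \<subseteq> monomials n" by (rule sub)+
    show "\<And>m. m \<in> ?D \<Longrightarrow> expo_deg m = r" "\<And>m. m \<in> ?D' \<Longrightarrow> expo_deg m = r" by (rule deg; assumption)+
    show "move_closed n ?D" "move_closed n ?D'" by (rule T(2), rule T'(2))
    show "a \<noteq> a'" using am by blast
    show "fst ` ?Q = ?D - ?D'"
    proof
      show "fst ` ?Q \<subseteq> ?D - ?D'" using mem by (metis (no_types, lifting) image_subsetI prod.collapse)
      show "?D - ?D' \<subseteq> fst ` ?Q"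
      proof
        fix c assume "c \<in> ?D - ?D'"
        then obtain F where F: "F \<in> \<E>" "gen c = F (gen a)" using img(1) by blast
        have "F (gen a') \<in> gen ` (?D' - ?D)" unfolding img(2) using F(1) by blast
        then obtain c' where "gen c' = F (gen a')" by (metis imageE)
        then have "(c, c') \<in> ?Q" using F by blast
        then show "c \<in> fst ` ?Q" by force
      qed
    qed
    show "snd ` ?Q = ?D' - ?D"
    proof
      show "snd ` ?Q \<subseteq> ?D' - ?D" using mem by (metis (no_types, lifting) image_subsetI prod.collapse)
      show "?D' - ?D \<subseteq> snd ` ?Q"
      proof
        fix c' assume "c' \<in> ?D' - ?D"
        then obtain F where F: "F \<in> \<E>" "gen c' = F (gen a')" using img(2) by blast
        have "F (gen a) \<in> gen ` (?D - ?D')" unfolding img(1) using F(1) by blast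
        then obtain c where "gen c = F (gen a)" by (metis imageE)
        then have "(c, c') \<in> ?Q" using F by blast
        then show "c' \<in> snd ` ?Q" by force
      qed
    qed
  next
    fix c c' assume cc: "(c, c') \<in> ?Q"
    then obtain F where F: "F \<in> \<E>" "gen c = F (gen a)" "gen c' = F (gen a')" by blast
    obtain \<delta> where \<delta>: "\<forall>w. F w = w + \<delta>" "\<forall>k. 0 \<le> (\<Sum>i<k. Poly_Mapping.lookup \<delta> i)"
      using dec_composition_translation F(1) Ed by blast
    have "gen (c + a') = gen (c' + a)" unfolding gen_add F(2,3) using \<delta>(1) by (simp add: ac_simps)
    then show "c + a' = c' + a" by (simp only: gen_inj)
    fix k
    show "c \<in> monomials_from k n \<longleftrightarrow> c' \<in> monomials_from k n"
      using translation_monomials_from[OF \<delta> F(2) _ amon(1), where k = k] translation_monomials_from[OF \<delta> F(3) _ amon(2), where k = k]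
        mem[OF cc] sub same[of k] by blast
  qed
qed

theorem theorem3p5:
  fixes n r :: nat
    and p :: "rat poly"
    and J J' :: "'k::{alg_closed_field, field_char_0} mpoly set"
    and a a' :: expo
    and \<E> :: "(gexpo \<Rightarrow> gexpo) set"
    and X :: "'k mpoly mpoly subscheme"
  assumes "is_gotzmann_number p r"
    and "J \<in> stable_truncations n p r"
    and "J' \<in> stable_truncations n p r"
    and "borel_adjacent n r J J'"
    and "is_borel_max n (deg_monomials n r J - deg_monomials n r J') a"
    and "is_borel_max n (deg_monomials n r J' - deg_monomials n r J) a'"
    and "associated_moves n r J J' a a' \<E>"
    and "X = zero_scheme (proj_1_n n) (deformation_ideal n r J J' a a' \<E>)"
  shows "flat_over_P1 TYPE('u) TYPE('v) n X \<and>
    pr2_isomorphism n (fibre n X (point_P1 1 0)) (zero_scheme (proj_n n) J) \<and>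
    pr2_isomorphism n (fibre n X (point_P1 0 1)) (zero_scheme (proj_n n) J')"
proof -
  obtain as where as: "length as = r" "sorted_wrt (\<ge>) as" "\<forall>t. poly p t = gotz as t"
    using assms(1) unfolding is_gotzmann_number_def gotz_def by blast
  let ?Q = "{(c, c'). \<exists>E\<in>\<E>. gen c = E (gen a) \<and> gen c' = E (gen a')}"
  let ?D = "deg_monomials n r J" and ?D' = "deg_monomials n r J'"
  let ?I = "deformation_ideal n r J J' a a' \<E>"
  have bp: "borel_pair n r ?D ?D' a a' ?Q" by (rule adjacent_borel_pair[OF as assms(2,3,5,6,7)])
  have I0: "?I = genideal (Kyx n) (xpow ` (?D \<inter> ?D') \<union>
      {Poly_Mapping.single c (xpow (evar 0)) + Poly_Mapping.single c' (xpow (evar 1)) | c c'. (c, c') \<in> ?Q})"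
    unfolding deformation_ideal_def evar_def
    by (intro arg_cong[where f = "genideal (Kyx n)"] arg_cong2[where f = "(\<union>)"] refl) blast
  have I1: "?I = genideal (Kyx n) (xpow ` (?D' \<inter> ?D) \<union>
      {Poly_Mapping.single c (xpow (evar 1)) + Poly_Mapping.single c' (xpow (evar 0)) | c c'. (c, c') \<in> prod.swap ` ?Q})"
    unfolding I0 Int_commute[of ?D']
  proof (intro arg_cong[where f = "genideal (Kyx n)"] arg_cong2[where f = "(\<union>)"] refl)
    have sw: "(c', c) \<in> prod.swap ` ?Q \<longleftrightarrow> (c, c') \<in> ?Q" for c c' by force
    show "{Poly_Mapping.single c (xpow (evar 0)) + Poly_Mapping.single c' (xpow (evar 1) :: 'k mpoly) | c c'. (c, c') \<in> ?Q} =
        {Poly_Mapping.single c (xpow (evar 1)) + Poly_Mapping.single c' (xpow (evar 0)) | c c'. (c, c') \<in> prod.swap ` ?Q}"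
      (is "?L = ?R")
    proof
      show "?L \<subseteq> ?R"
      proof
        fix f assume "f \<in> ?L"
        then obtain c c' where f: "f = Poly_Mapping.single c (xpow (evar 0)) + Poly_Mapping.single c' (xpow (evar 1))"
          and c: "(c, c') \<in> ?Q" by blast
        have "(c', c) \<in> prod.swap ` ?Q" using c unfolding sw .
        moreover have "f = Poly_Mapping.single c' (xpow (evar 1)) + Poly_Mapping.single c (xpow (evar 0))"
          unfolding f by (rule add.commute)
        ultimately show "f \<in> ?R" by blast
      qed
      show "?R \<subseteq> ?L"
      proof
        fix f assume "f \<in> ?R"
        then obtain c' c where f: "f = Poly_Mapping.single c' (xpow (evar 1)) + Poly_Mapping.single c (xpow (evar 0))"
          and c: "(c', c) \<in> prod.swap ` ?Q" by blast
        have "(c, c') \<in> ?Q" using c unfolding sw .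
        moreover have "f = Poly_Mapping.single c (xpow (evar 0)) + Poly_Mapping.single c' (xpow (evar 1))"
          unfolding f by (rule add.commute)
        ultimately show "f \<in> ?L" by blast
      qed
    qed
  qed
  \<comment> \<open>The chart \<open>y\<^sub>1 \<noteq> 0\<close> is the chart \<open>y\<^sub>0 \<noteq> 0\<close> of the family with \<open>J\<close> and \<open>J'\<close> exchanged.\<close>
  interpret d0: deformation n r ?D ?D' a a' ?Q 0 1 ?I
    by (intro deformation.intro[OF bp] deformation_axioms.intro I0) simp_all
  interpret d1: deformation n r ?D' ?D a' a "prod.swap ` ?Q" 1 0 ?I
    by (intro deformation.intro[OF borel_pair.swap[OF bp]] deformation_axioms.intro I1) simp_all
  have J: "d0.J0 = J" unfolding d0.J0_def by (rule stable_truncation_facts(1)[OF as assms(2), symmetric])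
  have J': "d1.J0 = J'" unfolding d1.J0_def by (rule stable_truncation_facts(1)[OF as assms(3), symmetric])
  have p0: "point_P1 1 0 = (d0.pt :: 'k mpoly set)"
    unfolding point_P1_def by (rule d0.pt_eq_genideal) (simp add: evar_def)
  have p1: "point_P1 0 1 = (d1.pt :: 'k mpoly set)"
    unfolding point_P1_def by (rule d1.pt_eq_genideal) (simp add: evar_def)
  have "flat_over_P1 TYPE('u) TYPE('v) n X"
    unfolding flat_over_P1_def
  proof
    fix P assume "P \<in> support X"
    then have P: "P \<in> points (proj_1_n n)" unfolding assms(8) zero_scheme_def by simp
    then have pP: "primeideal P (coord_ring (proj_1_n n))" by (simp add: points_def)
    have "{embed_y (xpow (evar 0)), embed_y (xpow (evar 1) :: 'k mpoly)} \<in> irrelevant (proj_1_n n)"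
      unfolding d0.irrelevant_1_n by blast
    then have "\<not> {embed_y (xpow (evar 0)), embed_y (xpow (evar 1))} \<subseteq> P"
      using P unfolding points_def by blast
    then consider "embed_y (xpow (evar 0)) \<notin> P" | "embed_y (xpow (evar 1)) \<notin> P" by blast
    then show "flat_module TYPE('u) TYPE('v) (local_ring (proj_n 1) (pr1 P))
        (restrict_scalars (\<lambda>q. ideal_stalk X P +>\<^bsub>local_ring (proj_1_n n) P\<^esub> fract_map embed_y q) (structure_stalk (proj_1_n n) X P))"
      unfolding assms(8) by cases (rule d0.flat_at[OF pP], assumption, rule d1.flat_at[OF pP], assumption)
  qed
  moreover have "pr2_isomorphism n (fibre n X (point_P1 1 0)) (zero_scheme (proj_n n) J)"
    using d0.fibre_iso unfolding J p0 assms(8) .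
  moreover have "pr2_isomorphism n (fibre n X (point_P1 0 1)) (zero_scheme (proj_n n) J')"
    using d1.fibre_iso unfolding J' p1 assms(8) .
  ultimately show ?thesis by blast
qed

end
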